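(* Let $\Omega\subset\mathbb{R}^3$ be an open bounded connected contractible domain with Lipschitz boundary, let $\mu,\epsilon$ be positive and constant on each element of a tetrahedral mesh of $\Omega$, and let $\omega>0$ not be a resonance of the cavity $\Omega$. For $I\in\{S,E,H,U,D,M\}$ let $X_0^I$, $Y_0^I$, $b_0^I$ be as follows (spaces with their natural product norms): - $S$ (strong): $X_0^S=H(\mathrm{curl},\Omega)\times\mathring H(\mathrm{curl},\Omega)$, $Y_0^S=L^2(\Omega)^6$, $b_0^S((H,E),(R,S))=(\imath\omega\mu H-\mathrm{curl}\,E,R)_\Omega+(\imath\omega\epsilon E+\mathrm{curl}\,H,S)_\Omega$. - $E$ (primal for $E$): $X_0^E=Y_0^E=\mathring H(\mathrm{curl},\Omega)$, $b_0^E(E,F)=(\mu^{-1}\mathrm{curl}\,E,\mathrm{curl}\,F)_\Omega-\omega^2(\epsilon E,F)_\Omega$. - $H$ (primal for $H$): $X_0^H=Y_0^H=H(\mathrm{curl},\Omega)$, $b_0^H(H,F)=(\epsilon^{-1}\mathrm{curl}\,H,\mathrm{curl}\,F)_\Omega-\omega^2(\mu H,F)_\Omega$. - $U$ (ultraweak): $X_0^U=L^2(\Omega)^6$, $Y_0^U=H(\mathrm{curl},\Omega)\times\mathring H(\mathrm{curl},\Omega)$, $b_0^U((H,E),(R,S))=(H,-\imath\omega\mu R+\mathrm{curl}\,S)_\Omega+(E,-\imath\omega\epsilon S-\mathrm{curl}\,R)_\Omega$. - $D$ (dual mixed): $X_0^D=Y_0^D=H(\mathrm{curl},\Omega)\times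 L^2(\Omega)^3$, $b_0^D((H,E),(R,S))=(\imath\omega\mu H,R)_\Omega-(E,\mathrm{curl}\,R)_\Omega+(\imath\omega\epsilon E+\mathrm{curl}\,H,S)_\Omega$. - $M$ (mixed): $X_0^M=Y_0^M=L^2(\Omega)^3\times\mathring H(\mathrm{curl},\Omega)$, $b_0^M((H,E),(R,S))=(\imath\omega\mu H-\mathrm{curl}\,E,R)_\Omega+(\imath\omega\epsilon E,S)_\Omega+(H,\mathrm{curl}\,S)_\Omega$. Let $(I)$ denote the statement: there is a constant $c_0>0$ such that $$c_0\|x\|_{X_0^I}\le\sup_{y\in Y_0^I}\frac{|b_0^I(x,y)|}{\|y\|_{Y_0^I}}\qquad\text{for all }x\in X_0^I.$$ Then the following implications hold: $$(E)\Rightarrow(S),\quad (S)\Rightarrow(U),\quad (U)\Rightarrow(D),\quad (D)\Rightarrow(H),\quad (H)\Rightarrow(S),\quad (U)\Rightarrow(M),\quad (M)\Rightarrow(E).$$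
   Context: Functions are complex-valued; $\imath$ is the imaginary unit; $(\cdot,\cdot)_\Omega$ is the $L^2(\Omega)$ inner product (of scalar or vector functions). $H(\mathrm{curl},\Omega)$ has norm $\|E\|^2=\|E\|_{L^2}^2+\|\mathrm{curl}\,E\|_{L^2}^2$ and $\mathring H(\mathrm{curl},\Omega)=\{E\in H(\mathrm{curl},\Omega):n\times E|_{\partial\Omega}=0\}$. Suprema omit the zero element. The resonances of the cavity form the countable set of $\omega$ for which the problem of finding $E\in\mathring H(\mathrm{curl},\Omega)$ with $(\mu^{-1}\mathrm{curl}\,E,\mathrm{curl}\,F)_\Omega-\omega^2(\epsilon E,F)_\Omega=\langle g,F\rangle$ for all $F\in\mathring H(\mathrm{curl},\Omega)$ fails to have a unique solution for every $g\in\mathring H(\mathrm{curl},\Omega)'$. *)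

theory Defs
  imports "HOL-Analysis.Analysis"
begin

section \<open>Domains, meshes and coefficients\<close>

text \<open>
  Near each boundary point, \<open>\<Omega>\<close> lies strictly above the graph, in direction \<open>v\<close>, of a
  Lipschitz function \<open>g\<close> on the plane orthogonal to \<open>v\<close>.
\<close>

definition lipschitz_boundary :: "(real^3) set \<Rightarrow> bool" where
  "lipschitz_boundary \<Omega> \<longleftrightarrow>
     (\<forall>p\<in>frontier \<Omega>. \<exists>r>0. \<exists>v L. \<exists>g :: real^3 \<Rightarrow> real.
        norm v = 1 \<and> L-lipschitz_on {y. y \<bullet> v = 0} g \<and>
        \<Omega> \<inter> ball p r = {x \<in> ball p r. g (x - (x \<bullet> v) *\<^sub>R v) < x \<bullet> v})"

text \<open>
  The elements are represented by their closures; hanging nodes are allowed. The coefficients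
  are constant on the open elements, and their values on the (null) union of the element
  boundaries are unconstrained.
\<close>

definition tetrahedral_mesh :: "(real^3) set set \<Rightarrow> (real^3) set \<Rightarrow> bool" where
  "tetrahedral_mesh \<T> \<Omega> \<longleftrightarrow>
     finite \<T> \<and> (\<forall>K\<in>\<T>. 3 simplex K) \<and>
     pairwise (\<lambda>K K'. interior K \<inter> interior K' = {}) \<T> \<and> \<Union>\<T> = closure \<Omega>"

definition piecewise_constant_pos :: "(real^3) set set \<Rightarrow> (real^3 \<Rightarrow> real) \<Rightarrow> bool" where
  "piecewise_constant_pos \<T> \<mu> \<longleftrightarrow> (\<forall>K\<in>\<T>. \<exists>c>0. \<forall>x\<in>interior K. \<mu> x = c)"


section \<open>Square-integrable fields\<close>

text \<open>
  Elements of the function spaces are represented by functions. Equality of elements is equality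
  almost everywhere on \<open>\<Omega>\<close>, so the norms below are seminorms on representatives.
\<close>

type_synonym field3 = "real^3 \<Rightarrow> complex^3"

definition cdot :: "complex^3 \<Rightarrow> complex^3 \<Rightarrow> complex" where
  "cdot u v = (\<Sum>i\<in>UNIV. u $ i * cnj (v $ i))"

definition L2 :: "(real^3) set \<Rightarrow> field3 set" where
  "L2 \<Omega> = {E. E \<in> borel_measurable (lebesgue_on \<Omega>) \<and>
               integrable (lebesgue_on \<Omega>) (\<lambda>x. (norm (E x))\<^sup>2)}"

definition L2_inner :: "(real^3) set \<Rightarrow> field3 \<Rightarrow> field3 \<Rightarrow> complex" where
  "L2_inner \<Omega> E F = (LINT x | lebesgue_on \<Omega>. cdot (E x) (F x))"

definition L2_norm :: "(real^3) set \<Rightarrow> field3 \<Rightarrow> real" where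
  "L2_norm \<Omega> E = sqrt (LINT x | lebesgue_on \<Omega>. (norm (E x))\<^sup>2)"


section \<open>Smooth fields and the classical curl\<close>

primrec C_k :: "nat \<Rightarrow> ('a::real_normed_vector \<Rightarrow> 'b::real_normed_vector) \<Rightarrow> bool" where
  "C_k 0 f \<longleftrightarrow> continuous_on UNIV f"
| "C_k (Suc k) f \<longleftrightarrow>
     (\<forall>x. f differentiable (at x)) \<and> (\<forall>v. C_k k (\<lambda>x. frechet_derivative f (at x) v))"

definition C_infinity :: "('a::real_normed_vector \<Rightarrow> 'b::real_normed_vector) \<Rightarrow> bool" where
  "C_infinity f \<longleftrightarrow> (\<forall>k. C_k k f)"

definition test_fields :: "(real^3) set \<Rightarrow> field3 set" where
  "test_fields \<Omega> = {\<phi>. C_infinity \<phi> \<and> compact (closure {x. \<phi> x \<noteq> 0}) \<and>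
                        closure {x. \<phi> x \<noteq> 0} \<subseteq> \<Omega>}"

definition partial :: "3 \<Rightarrow> field3 \<Rightarrow> field3" where
  "partial j \<phi> x = frechet_derivative \<phi> (at x) (axis j 1)"

definition classical_curl :: "field3 \<Rightarrow> field3" where
  "classical_curl \<phi> x = vector
     [partial 2 \<phi> x $ 3 - partial 3 \<phi> x $ 2,
      partial 3 \<phi> x $ 1 - partial 1 \<phi> x $ 3,
      partial 1 \<phi> x $ 2 - partial 2 \<phi> x $ 1]"


section \<open>The spaces \<open>H(curl)\<close>\<close>

definition is_weak_curl :: "(real^3) set \<Rightarrow> field3 \<Rightarrow> field3 \<Rightarrow> bool" where
  "is_weak_curl \<Omega> E G \<longleftrightarrow>
     G \<in> L2 \<Omega> \<and> (\<forall>\<phi>\<in>test_fields \<Omega>. L2_inner \<Omega> E (classical_curl \<phi>) = L2_inner \<Omega> G \<phi>)"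

text \<open>The weak curl is unique only up to null sets; \<open>curl\<close> picks one representative.\<close>

definition curl :: "(real^3) set \<Rightarrow> field3 \<Rightarrow> field3" where
  "curl \<Omega> E = (SOME G. is_weak_curl \<Omega> E G)"

definition Hcurl :: "(real^3) set \<Rightarrow> field3 set" where
  "Hcurl \<Omega> = {E \<in> L2 \<Omega>. \<exists>G. is_weak_curl \<Omega> E G}"

definition Hcurl_norm :: "(real^3) set \<Rightarrow> field3 \<Rightarrow> real" where
  "Hcurl_norm \<Omega> E = sqrt ((L2_norm \<Omega> E)\<^sup>2 + (L2_norm \<Omega> (curl \<Omega> E))\<^sup>2)"

text \<open>
  The trace \<open>n \<times> E\<close> of \<open>E \<in> H(curl)\<close> on the boundary is a distribution, defined by Green's
  formula through its action on (the boundary values of) fields \<open>\<phi>\<close> that are smooth up to the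
  boundary: for smooth \<open>E\<close> the right-hand side is the integral of \<open>(n \<times> E) \<cdot> cnj \<phi>\<close> over the
  boundary.
\<close>

definition tangential_trace :: "(real^3) set \<Rightarrow> field3 \<Rightarrow> field3 \<Rightarrow> complex" where
  "tangential_trace \<Omega> E \<phi> = L2_inner \<Omega> (curl \<Omega> E) \<phi> - L2_inner \<Omega> E (classical_curl \<phi>)"

definition Hcurl0 :: "(real^3) set \<Rightarrow> field3 set" where
  "Hcurl0 \<Omega> = {E \<in> Hcurl \<Omega>. \<forall>\<phi>. C_infinity \<phi> \<longrightarrow> tangential_trace \<Omega> E \<phi> = 0}"


section \<open>The sesquilinear forms\<close>

definition b_S :: "(real^3) set \<Rightarrow> (real^3 \<Rightarrow> real) \<Rightarrow> (real^3 \<Rightarrow> real) \<Rightarrow> real \<Rightarrow>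
    field3 \<times> field3 \<Rightarrow> field3 \<times> field3 \<Rightarrow> complex" where
  "b_S \<Omega> \<mu> \<epsilon> \<omega> = (\<lambda>(H, E) (R, S).
     L2_inner \<Omega> (\<lambda>x. (\<i> * of_real \<omega> * of_real (\<mu> x)) *s H x - curl \<Omega> E x) R
   + L2_inner \<Omega> (\<lambda>x. (\<i> * of_real \<omega> * of_real (\<epsilon> x)) *s E x + curl \<Omega> H x) S)"

definition b_E :: "(real^3) set \<Rightarrow> (real^3 \<Rightarrow> real) \<Rightarrow> (real^3 \<Rightarrow> real) \<Rightarrow> real \<Rightarrow>
    field3 \<Rightarrow> field3 \<Rightarrow> complex" where
  "b_E \<Omega> \<mu> \<epsilon> \<omega> E F =
     L2_inner \<Omega> (\<lambda>x. inverse (\<mu> x) *\<^sub>R curl \<Omega> E x) (curl \<Omega> F)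
   - of_real (\<omega>\<^sup>2) * L2_inner \<Omega> (\<lambda>x. \<epsilon> x *\<^sub>R E x) F"

definition b_H :: "(real^3) set \<Rightarrow> (real^3 \<Rightarrow> real) \<Rightarrow> (real^3 \<Rightarrow> real) \<Rightarrow> real \<Rightarrow>
    field3 \<Rightarrow> field3 \<Rightarrow> complex" where
  "b_H \<Omega> \<mu> \<epsilon> \<omega> H F =
     L2_inner \<Omega> (\<lambda>x. inverse (\<epsilon> x) *\<^sub>R curl \<Omega> H x) (curl \<Omega> F)
   - of_real (\<omega>\<^sup>2) * L2_inner \<Omega> (\<lambda>x. \<mu> x *\<^sub>R H x) F"

definition b_U :: "(real^3) set \<Rightarrow> (real^3 \<Rightarrow> real) \<Rightarrow> (real^3 \<Rightarrow> real) \<Rightarrow> real \<Rightarrow>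
    field3 \<times> field3 \<Rightarrow> field3 \<times> field3 \<Rightarrow> complex" where
  "b_U \<Omega> \<mu> \<epsilon> \<omega> = (\<lambda>(H, E) (R, S).
     L2_inner \<Omega> H (\<lambda>x. (- \<i> * of_real \<omega> * of_real (\<mu> x)) *s R x + curl \<Omega> S x)
   + L2_inner \<Omega> E (\<lambda>x. (- \<i> * of_real \<omega> * of_real (\<epsilon> x)) *s S x - curl \<Omega> R x))"

definition b_D :: "(real^3) set \<Rightarrow> (real^3 \<Rightarrow> real) \<Rightarrow> (real^3 \<Rightarrow> real) \<Rightarrow> real \<Rightarrow>
    field3 \<times> field3 \<Rightarrow> field3 \<times> field3 \<Rightarrow> complex" where
  "b_D \<Omega> \<mu> \<epsilon> \<omega> = (\<lambda>(H, E) (R, S).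
     L2_inner \<Omega> (\<lambda>x. (\<i> * of_real \<omega> * of_real (\<mu> x)) *s H x) R
   - L2_inner \<Omega> E (curl \<Omega> R)
   + L2_inner \<Omega> (\<lambda>x. (\<i> * of_real \<omega> * of_real (\<epsilon> x)) *s E x + curl \<Omega> H x) S)"

definition b_M :: "(real^3) set \<Rightarrow> (real^3 \<Rightarrow> real) \<Rightarrow> (real^3 \<Rightarrow> real) \<Rightarrow> real \<Rightarrow>
    field3 \<times> field3 \<Rightarrow> field3 \<times> field3 \<Rightarrow> complex" where
  "b_M \<Omega> \<mu> \<epsilon> \<omega> = (\<lambda>(H, E) (R, S).
     L2_inner \<Omega> (\<lambda>x. (\<i> * of_real \<omega> * of_real (\<mu> x)) *s H x - curl \<Omega> E x) R
   + L2_inner \<Omega> (\<lambda>x. (\<i> * of_real \<omega> * of_real (\<epsilon> x)) *s E x) S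
   + L2_inner \<Omega> H (curl \<Omega> S))"


section \<open>Resonances\<close>

text \<open>
  As the forms are antilinear in their second argument, the dual space consists of the bounded
  antilinear functionals.
\<close>

definition Hcurl0_dual :: "(real^3) set \<Rightarrow> (field3 \<Rightarrow> complex) set" where
  "Hcurl0_dual \<Omega> = {g.
     (\<forall>F\<in>Hcurl0 \<Omega>. \<forall>G\<in>Hcurl0 \<Omega>. g (\<lambda>x. F x + G x) = g F + g G) \<and>
     (\<forall>F\<in>Hcurl0 \<Omega>. \<forall>a. g (\<lambda>x. a *s F x) = cnj a * g F) \<and>
     (\<exists>C. \<forall>F\<in>Hcurl0 \<Omega>. cmod (g F) \<le> C * Hcurl_norm \<Omega> F)}"

definition cavity_solution :: "(real^3) set \<Rightarrow> (real^3 \<Rightarrow> real) \<Rightarrow> (real^3 \<Rightarrow> real) \<Rightarrow> real \<Rightarrow>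
    (field3 \<Rightarrow> complex) \<Rightarrow> field3 \<Rightarrow> bool" where
  "cavity_solution \<Omega> \<mu> \<epsilon> \<omega> g E \<longleftrightarrow>
     E \<in> Hcurl0 \<Omega> \<and> (\<forall>F\<in>Hcurl0 \<Omega>. b_E \<Omega> \<mu> \<epsilon> \<omega> E F = g F)"

definition resonance :: "(real^3) set \<Rightarrow> (real^3 \<Rightarrow> real) \<Rightarrow> (real^3 \<Rightarrow> real) \<Rightarrow> real \<Rightarrow> bool" where
  "resonance \<Omega> \<mu> \<epsilon> \<omega> \<longleftrightarrow>
     \<not> (\<forall>g\<in>Hcurl0_dual \<Omega>.
          (\<exists>E. cavity_solution \<Omega> \<mu> \<epsilon> \<omega> g E) \<and>
          (\<forall>E E'. cavity_solution \<Omega> \<mu> \<epsilon> \<omega> g E \<longrightarrow> cavity_solution \<Omega> \<mu> \<epsilon> \<omega> g E' \<longrightarrow>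
             (AE x in lebesgue_on \<Omega>. E x = E' x)))"


section \<open>Inf-sup conditions\<close>

definition prod_norm :: "('a \<Rightarrow> real) \<Rightarrow> ('b \<Rightarrow> real) \<Rightarrow> 'a \<times> 'b \<Rightarrow> real" where
  "prod_norm n m = (\<lambda>(u, v). sqrt ((n u)\<^sup>2 + (m v)\<^sup>2))"

text \<open>
  The supremum is over the representatives of the nonzero elements of \<open>Y\<close>. It is taken in
  \<open>ereal\<close>, so that it is meaningful without a boundedness proof.
\<close>

definition inf_sup :: "'a set \<Rightarrow> ('a \<Rightarrow> real) \<Rightarrow> 'b set \<Rightarrow> ('b \<Rightarrow> real) \<Rightarrow>
    ('a \<Rightarrow> 'b \<Rightarrow> complex) \<Rightarrow> bool" where
  "inf_sup X nX Y nY b \<longleftrightarrow>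
     (\<exists>c>0. \<forall>x\<in>X. ereal (c * nX x) \<le> (SUP y\<in>{y \<in> Y. nY y \<noteq> 0}. ereal (cmod (b x y) / nY y)))"

definition inf_sup_S where
  "inf_sup_S \<Omega> \<mu> \<epsilon> \<omega> \<longleftrightarrow>
     inf_sup (Hcurl \<Omega> \<times> Hcurl0 \<Omega>) (prod_norm (Hcurl_norm \<Omega>) (Hcurl_norm \<Omega>))
             (L2 \<Omega> \<times> L2 \<Omega>) (prod_norm (L2_norm \<Omega>) (L2_norm \<Omega>)) (b_S \<Omega> \<mu> \<epsilon> \<omega>)"

definition inf_sup_E where
  "inf_sup_E \<Omega> \<mu> \<epsilon> \<omega> \<longleftrightarrow>
     inf_sup (Hcurl0 \<Omega>) (Hcurl_norm \<Omega>) (Hcurl0 \<Omega>) (Hcurl_norm \<Omega>) (b_E \<Omega> \<mu> \<epsilon> \<omega>)"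

definition inf_sup_H where
  "inf_sup_H \<Omega> \<mu> \<epsilon> \<omega> \<longleftrightarrow>
     inf_sup (Hcurl \<Omega>) (Hcurl_norm \<Omega>) (Hcurl \<Omega>) (Hcurl_norm \<Omega>) (b_H \<Omega> \<mu> \<epsilon> \<omega>)"

definition inf_sup_U where
  "inf_sup_U \<Omega> \<mu> \<epsilon> \<omega> \<longleftrightarrow>
     inf_sup (L2 \<Omega> \<times> L2 \<Omega>) (prod_norm (L2_norm \<Omega>) (L2_norm \<Omega>))
             (Hcurl \<Omega> \<times> Hcurl0 \<Omega>) (prod_norm (Hcurl_norm \<Omega>) (Hcurl_norm \<Omega>)) (b_U \<Omega> \<mu> \<epsilon> \<omega>)"

definition inf_sup_D where
  "inf_sup_D \<Omega> \<mu> \<epsilon> \<omega> \<longleftrightarrow>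
     inf_sup (Hcurl \<Omega> \<times> L2 \<Omega>) (prod_norm (Hcurl_norm \<Omega>) (L2_norm \<Omega>))
             (Hcurl \<Omega> \<times> L2 \<Omega>) (prod_norm (Hcurl_norm \<Omega>) (L2_norm \<Omega>)) (b_D \<Omega> \<mu> \<epsilon> \<omega>)"

definition inf_sup_M where
  "inf_sup_M \<Omega> \<mu> \<epsilon> \<omega> \<longleftrightarrow>
     inf_sup (L2 \<Omega> \<times> Hcurl0 \<Omega>) (prod_norm (L2_norm \<Omega>) (Hcurl_norm \<Omega>))
             (L2 \<Omega> \<times> Hcurl0 \<Omega>) (prod_norm (L2_norm \<Omega>) (Hcurl_norm \<Omega>)) (b_M \<Omega> \<mu> \<epsilon> \<omega>)"

end

theory Submission
  imports Defs "HOL-Computational_Algebra.Polynomial"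
begin

text \<open>
  Write the Maxwell system as \<open>A (H, E) = (r, s)\<close> with the residuals \<open>r = \<i> \<omega> \<mu> H - curl E\<close> and
  \<open>s = \<i> \<omega> \<epsilon> E + curl H\<close>. An inf-sup condition is an a priori estimate: the norm of \<open>x\<close> is bounded by the
  dual norm of the functional \<open>b x\<close> on the test space. All six forms come from \<open>A\<close> by elimination of a
  field or by integration by parts, and the estimates are transferred accordingly.

  From (E) to (S): Faraday's and Ampere's law express the primal form \<open>b_E E F\<close> through \<open>r\<close> and \<open>s\<close>
  alone, so stability of the primal form bounds \<open>E\<close> by the residuals, and the two equations then bound
  \<open>H\<close> and its curl. From (S) to (U): the ultraweak form is \<open>b_U x y = - (x, A y)\<close>. As \<open>\<omega>\<close> is not a
  resonance, \<open>A y = x\<close> is solvable for every \<open>x\<close> in \<open>L\<^sup>2\<close>: solve a primal problem for the electric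
  field and define the magnetic field by Faraday's law. The strong estimate bounds \<open>y\<close> by \<open>x\<close>, and testing
  with \<open>y\<close> gives \<open>|x|\<^sup>2\<close>. From (U) to (M): after an integration by parts the forms agree for regular test
  functions, so the fields are bounded in \<open>L\<^sup>2\<close>; testing with the Faraday residual bounds the missing
  curl. From (M) to (E): the mixed form of the pair that satisfies Faraday's law exactly is a multiple of
  the primal form. The remaining implications, (H) to (S), (U) to (D) and (D) to (H), are the same
  statements for the system in which the fields and the coefficients are exchanged and the frequency is
  reversed.

  All this rests on one analytic fact, Green's formula \<open>(curl E, H) = (E, curl H)\<close> for \<open>H\<close> with a weak curl
  and \<open>E\<close> with a weak curl and vanishing tangential trace, where the trace is only known to vanish against
  smooth fields (\<open>green_Hcurl0\<close>). It is here that the boundary has to be Lipschitz: the extension of \<open>E\<close> by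
  zero is cut into small pieces by a partition of unity, each piece is moved slightly into the domain
  and mollified, and the resulting test field is inserted into the definition of the weak curl of \<open>H\<close>.
  The limit is justified by the continuity of translations in \<open>L\<^sup>2\<close>. The same mollification argument
  shows that weak curls are unique.
\<close>


section \<open>Smooth functions\<close>

lemma C_k_pred: "C_k (Suc k) f \<Longrightarrow> C_k k f"
proof (induction k arbitrary: f)
  case 0
  then show ?case
    by (auto simp: continuous_on_eq_continuous_at intro: differentiable_imp_continuous_within)
next
  case (Suc k)
  then show ?case by (metis C_k.simps(2))
qed

lemma C_infinity_differentiable: "C_infinity f \<Longrightarrow> f differentiable (at x)"
  unfolding C_infinity_def by (metis C_k.simps(2))

lemma C_infinity_frechet: "C_infinity f \<Longrightarrow> C_infinity (\<lambda>x. frechet_derivative f (at x) v)"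
  unfolding C_infinity_def by (metis C_k.simps(2))

lemma C_infinity_has_derivative:
  "C_infinity f \<Longrightarrow> (f has_derivative frechet_derivative f (at x)) (at x)"
  using C_infinity_differentiable frechet_derivative_works by blast

lemma C_infinity_continuous_on: "C_infinity f \<Longrightarrow> continuous_on S f"
  unfolding C_infinity_def by (metis C_k.simps(1) continuous_on_subset subset_UNIV)

lemma C_infinity_borel [measurable_dest]:
  "C_infinity f \<Longrightarrow> f \<in> borel_measurable borel"
  by (simp add: C_infinity_continuous_on borel_measurable_continuous_onI)

text \<open>
  Smoothness is a coinductive property: it holds for all members of any class of differentiable
  functions that is closed under directional derivatives.
\<close>

lemma C_infinity_coinduct:
  assumes "P f"
    and step: "\<And>f. P f \<Longrightarrow> \<exists>D. (\<forall>x. (f has_derivative D x) (at x)) \<and> (\<forall>v. P (\<lambda>x. D x v))"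
  shows "C_infinity f"
proof -
  have "C_k k g" if "P g" for k g
    using that
  proof (induction k arbitrary: g)
    case 0
    then show ?case
      using step[OF 0]
      by (auto simp: continuous_on_eq_continuous_at intro: has_derivative_continuous)
  next
    case (Suc k)
    obtain D where D: "\<And>x. (g has_derivative D x) (at x)" and PD: "\<And>v. P (\<lambda>x. D x v)"
      using step[OF Suc.prems] by blast
    have "frechet_derivative g (at x) = D x" for x
      using frechet_derivative_at[OF D] by simp
    then show ?case
      using D Suc.IH[OF PD] by (auto intro: differentiableI)
  qed
  then show ?thesis
    using assms(1) by (simp add: C_infinity_def)
qed

lemma C_k_const: "C_k k (\<lambda>x. c)"
  by (induction k arbitrary: c) auto

lemma C_infinity_const [simp]: "C_infinity (\<lambda>x. c)"
  by (simp add: C_infinity_def C_k_const)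

lemma C_k_add: "C_k k f \<Longrightarrow> C_k k g \<Longrightarrow> C_k k (\<lambda>x. f x + g x)"
proof (induction k arbitrary: f g)
  case 0
  then show ?case by (auto intro: continuous_intros)
next
  case (Suc k)
  have "((\<lambda>x. f x + g x) has_derivative
      (\<lambda>v. frechet_derivative f (at x) v + frechet_derivative g (at x) v)) (at x)" for x
    using Suc.prems by (auto intro!: has_derivative_add simp: frechet_derivative_works)
  from frechet_derivative_at[OF this, symmetric] this
  show ?case
    using Suc by (auto intro: differentiableI)
qed

lemma C_infinity_add: "C_infinity f \<Longrightarrow> C_infinity g \<Longrightarrow> C_infinity (\<lambda>x. f x + g x)"
  by (simp add: C_infinity_def C_k_add)

lemma C_infinity_sum:
  "(\<And>i. i \<in> I \<Longrightarrow> C_infinity (f i)) \<Longrightarrow> C_infinity (\<lambda>x. \<Sum>i\<in>I. f i x)"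
proof (induction I rule: infinite_finite_induct)
  case (insert i I)
  then show ?case using C_infinity_add[of "f i" "\<lambda>x. \<Sum>i\<in>I. f i x"] by simp
qed auto

lemma C_k_bilinear:
  assumes "bounded_bilinear pr"
  shows "C_k k f \<Longrightarrow> C_k k g \<Longrightarrow> C_k k (\<lambda>x. pr (f x) (g x))"
proof (induction k arbitrary: f g)
  case 0
  then show ?case using bounded_bilinear.continuous_on[OF assms] by auto
next
  case (Suc k)
  have "((\<lambda>x. pr (f x) (g x)) has_derivative
      (\<lambda>v. pr (f x) (frechet_derivative g (at x) v) + pr (frechet_derivative f (at x) v) (g x)))
      (at x)" for x
    using Suc.prems
    by (auto intro!: bounded_bilinear.FDERIV[OF assms] simp: frechet_derivative_works)
  from frechet_derivative_at[OF this, symmetric] this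
  show ?case
    using Suc C_k_pred[OF Suc.prems(1)] C_k_pred[OF Suc.prems(2)]
    by (auto intro!: differentiableI C_k_add)
qed

lemma C_infinity_bilinear:
  assumes "bounded_bilinear pr" "C_infinity f" "C_infinity g"
  shows "C_infinity (\<lambda>x. pr (f x) (g x))"
  using assms by (simp add: C_infinity_def C_k_bilinear)

lemmas C_infinity_mult = C_infinity_bilinear[OF bounded_bilinear_mult]
lemmas C_infinity_scaleR = C_infinity_bilinear[OF bounded_bilinear_scaleR]
lemmas C_infinity_inner = C_infinity_bilinear[OF bounded_bilinear_inner]

lemma C_infinity_bounded_linear:
  assumes "bounded_linear h"
  shows "C_infinity h"
proof -
  have "C_k k h" for k
  proof (cases k)
    case 0
    then show ?thesis using assms by (simp add: linear_continuous_on)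
  next
    case (Suc j)
    have "(h has_derivative h) (at x)" for x
      using assms bounded_linear_imp_has_derivative by blast
    from this frechet_derivative_at[OF this, symmetric] show ?thesis
      using Suc by (auto intro: differentiableI simp: C_k_const)
  qed
  then show ?thesis by (simp add: C_infinity_def)
qed

lemma C_infinity_linear_image:
  assumes "bounded_linear h" "C_infinity f"
  shows "C_infinity (\<lambda>x. h (f x))"
proof (rule C_infinity_coinduct[where P = "\<lambda>g. \<exists>f. C_infinity f \<and> g = (\<lambda>x. h (f x))"])
  fix g assume "\<exists>f. C_infinity f \<and> g = (\<lambda>x. h (f x))"
  then obtain f where f: "C_infinity f" and g: "g = (\<lambda>x. h (f x))" by blast
  show "\<exists>D. (\<forall>x. (g has_derivative D x) (at x)) \<and>
      (\<forall>v. \<exists>f. C_infinity f \<and> (\<lambda>x. D x v) = (\<lambda>x. h (f x)))"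
  proof (intro exI[where x = "\<lambda>x v. h (frechet_derivative f (at x) v)"] conjI allI)
    show "(g has_derivative (\<lambda>v. h (frechet_derivative f (at x) v))) (at x)" for x
      unfolding g by (rule bounded_linear.has_derivative[OF assms(1) C_infinity_has_derivative[OF f]])
  qed (use C_infinity_frechet[OF f] in blast)
qed (use assms in blast)

lemma C_infinity_minus_arg:
  assumes "C_infinity f"
  shows "C_infinity (\<lambda>x. f (a - x))"
proof (rule C_infinity_coinduct[where P = "\<lambda>g. \<exists>f. C_infinity f \<and> g = (\<lambda>x. f (a - x))"])
  fix g assume "\<exists>f. C_infinity f \<and> g = (\<lambda>x. f (a - x))"
  then obtain f where f: "C_infinity f" and g: "g = (\<lambda>x. f (a - x))" by blast
  show "\<exists>D. (\<forall>x. (g has_derivative D x) (at x)) \<and>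
      (\<forall>v. \<exists>f. C_infinity f \<and> (\<lambda>x. D x v) = (\<lambda>x. f (a - x)))"
  proof (intro exI[where x = "\<lambda>x v. frechet_derivative f (at (a - x)) (- v)"] conjI allI)
    show "(g has_derivative (\<lambda>v. frechet_derivative f (at (a - x)) (- v))) (at x)" for x
      unfolding g
      by (rule has_derivative_compose[OF _ C_infinity_has_derivative[OF f], of "\<lambda>x. a - x" uminus, simplified])
        (auto intro!: derivative_eq_intros)
  qed (use C_infinity_frechet[OF f] in blast)
qed (use assms in blast)

lemma C_infinity_inverse:
  fixes s :: "'a::real_normed_vector \<Rightarrow> real"
  assumes s: "C_infinity s" and nz: "\<And>x. s x \<noteq> 0"
  shows "C_infinity (\<lambda>x. inverse (s x))"
proof -
  have D: "((\<lambda>x. inverse (s x)) has_derivative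
      (\<lambda>v. - (inverse (s x) * frechet_derivative s (at x) v * inverse (s x)))) (at x)" for x
    using nz C_infinity_has_derivative[OF s] by (auto intro!: Deriv.has_derivative_inverse)
  have "C_k k (\<lambda>x. inverse (s x))" for k
  proof (induction k)
    case 0
    then show ?case
      using nz C_infinity_continuous_on[OF s] by (auto intro: continuous_on_inverse)
  next
    case (Suc k)
    have "C_k k (\<lambda>x. - (inverse (s x) * frechet_derivative s (at x) v * inverse (s x)))" for v
    proof -
      have "C_k k (\<lambda>x. (-1) * (inverse (s x) * frechet_derivative s (at x) v * inverse (s x)))"
        using Suc C_infinity_frechet[OF s, of v]
        by (intro C_k_bilinear[OF bounded_bilinear_mult] C_k_const) (auto simp: C_infinity_def)
      then show ?thesis by simp
    qed
    then show ?case
      using D frechet_derivative_at[OF D, symmetric] by (auto intro: differentiableI)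
  qed
  then show ?thesis by (simp add: C_infinity_def)
qed


section \<open>Bump functions\<close>

text \<open>
  The functions \<open>p(1/t) exp(-1/t)\<close>, extended by \<open>0\<close>, form a class that contains the standard flat
  function (\<open>p = 1\<close>) and, unlike that function alone, is closed under differentiation: with
  \<open>u = 1/t\<close>, the derivative in \<open>t\<close> is \<open>-u\<^sup>2\<close> times the one in \<open>u\<close>.
\<close>

definition flat :: "real poly \<Rightarrow> real \<Rightarrow> real" where
  "flat p t = (if t \<le> 0 then 0 else poly p (1 / t) * exp (- (1 / t)))"

lemma flat_tendsto_0: "(flat p \<longlongrightarrow> 0) (at 0)"
proof -
  have lim: "((\<lambda>u. poly p u * exp (- u)) \<longlongrightarrow> 0) at_top"
  proof -
    have "((\<lambda>u. \<Sum>i\<le>degree p. coeff p i * (u ^ i / exp u)) \<longlongrightarrow> (\<Sum>i\<le>degree p. coeff p i * 0)) at_top"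
      by (intro tendsto_intros tendsto_power_div_exp_0)
    then show ?thesis
      by (simp add: poly_altdef sum_distrib_right sum_divide_distrib exp_minus field_simps)
  qed
  have "((\<lambda>t. poly p (inverse t) * exp (- inverse t)) \<longlongrightarrow> 0) (at_right 0)"
    by (rule filterlim_compose[OF lim filterlim_inverse_at_top_right])
  then have "(flat p \<longlongrightarrow> 0) (at_right 0)"
    by (rule Lim_transform_eventually)
      (auto simp: flat_def eventually_at_filter inverse_eq_divide)
  moreover have "(flat p \<longlongrightarrow> 0) (at_left 0)"
    by (rule Lim_transform_eventually[OF tendsto_const])
      (auto simp: flat_def eventually_at_filter)
  ultimately show ?thesis
    by (simp add: filterlim_at_split)
qed

lemma flat_deriv:
  "(flat p has_field_derivative flat ([:0, 0, 1:] * (p - pderiv p)) t) (at t)"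
proof (cases t "0::real" rule: linorder_cases)
  case less
  have "((\<lambda>t. 0) has_field_derivative 0) (at t)" by simp
  then have "(flat p has_field_derivative 0) (at t)"
    by (rule has_field_derivative_transform_within_open[of _ _ _ "{..<0}"]) (use less in \<open>auto simp: flat_def\<close>)
  then show ?thesis using less by (simp add: flat_def)
next
  case greater
  have "((\<lambda>t. poly p (1 / t) * exp (- (1 / t))) has_field_derivative
      flat ([:0, 0, 1:] * (p - pderiv p)) t) (at t)"
    using greater
    by (auto intro!: derivative_eq_intros DERIV_chain2[OF poly_DERIV] simp: flat_def field_simps)
  then show ?thesis
    by (rule has_field_derivative_transform_within_open[of _ _ _ "{0<..}"]) (use greater in \<open>auto simp: flat_def\<close>)
next
  case equal
  have "(\<lambda>h. (flat p (0 + h) - flat p 0) / h) = flat (pCons 0 p)"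
    by (auto simp: fun_eq_iff flat_def)
  then have "(flat p has_field_derivative 0) (at 0)"
    using flat_tendsto_0[of "pCons 0 p"] by (simp add: DERIV_def)
  then show ?thesis using equal by (simp add: flat_def)
qed

lemma C_infinity_flat_compose:
  fixes q :: "'a::real_normed_vector \<Rightarrow> real"
  assumes q: "C_infinity q"
  shows "C_infinity (\<lambda>x. flat p (q x))"
proof -
  have D: "((\<lambda>x. flat p (q x)) has_derivative
      (\<lambda>v. flat ([:0, 0, 1:] * (p - pderiv p)) (q x) * frechet_derivative q (at x) v)) (at x)" for p x
    using has_derivative_compose[OF C_infinity_has_derivative[OF q, of x]
        flat_deriv[of p "q x", unfolded has_field_derivative_def]] by simp
  have "C_k k (\<lambda>x. flat p (q x))" for k
  proof (induction k arbitrary: p)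
    case 0
    show ?case
      using D by (auto simp: continuous_on_eq_continuous_at intro: has_derivative_continuous)
  next
    case (Suc k)
    have "C_k k (\<lambda>x. flat ([:0, 0, 1:] * (p - pderiv p)) (q x) * frechet_derivative q (at x) v)" for v
      using Suc C_infinity_frechet[OF q, of v]
      by (intro C_k_bilinear[OF bounded_bilinear_mult]) (auto simp: C_infinity_def)
    then show ?case
      using D[of p] frechet_derivative_at[OF D[of p], symmetric] by (auto intro: differentiableI)
  qed
  then show ?thesis by (simp add: C_infinity_def)
qed

lemma flat_1_pos_iff: "flat 1 t > 0 \<longleftrightarrow> t > 0"
  by (simp add: flat_def)

lemma flat_1_nonneg: "flat 1 t \<ge> 0"
  by (simp add: flat_def)

definition bump :: "'a::real_inner \<Rightarrow> real \<Rightarrow> 'a \<Rightarrow> real" where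
  "bump c r x = flat 1 (r\<^sup>2 - (x - c) \<bullet> (x - c))"

lemma C_infinity_bump: "C_infinity (bump c r)"
proof -
  have "C_infinity (\<lambda>x. r\<^sup>2 + (-1) * ((x + - c) \<bullet> (x + - c)))"
    by (intro C_infinity_add C_infinity_mult C_infinity_inner C_infinity_const
        C_infinity_bounded_linear[OF bounded_linear_ident])
  from C_infinity_flat_compose[OF this] show ?thesis
    by (simp add: bump_def [abs_def])
qed

lemma bump_nonneg: "bump c r x \<ge> 0"
  by (simp add: bump_def flat_1_nonneg)

lemma bump_pos_iff: "r > 0 \<Longrightarrow> bump c r x > 0 \<longleftrightarrow> x \<in> ball c r"
  using power2_less_imp_less[of "norm (x - c)" r] power_strict_mono[of "norm (x - c)" r 2]
  by (auto simp: bump_def flat_1_pos_iff dist_norm norm_minus_commute power2_norm_eq_inner[symmetric])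

lemma bump_eq_0_iff: "r > 0 \<Longrightarrow> bump c r x = 0 \<longleftrightarrow> x \<notin> ball c r"
  using bump_pos_iff[of r c x] bump_nonneg[of c r x] by linarith


section \<open>Convolution with smooth kernels\<close>

text \<open>
  The kernel is real-valued and the function vector-valued, so that fields are mollified as a whole.
\<close>

definition conv :: "('a::euclidean_space \<Rightarrow> real) \<Rightarrow> ('a \<Rightarrow> 'b::euclidean_space) \<Rightarrow> 'a \<Rightarrow> 'b" where
  "conv k w x = (LINT y | lborel. k (x - y) *\<^sub>R w y)"

definition test_kernel :: "('a::euclidean_space \<Rightarrow> real) \<Rightarrow> bool" where
  "test_kernel k \<longleftrightarrow> C_infinity k \<and> (\<exists>R. \<forall>z. norm z > R \<longrightarrow> k z = 0)"

lemma test_kernel_frechet: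
  assumes "test_kernel k"
  shows "test_kernel (\<lambda>x. frechet_derivative k (at x) v)"
proof -
  obtain R where R: "\<And>z. norm z > R \<Longrightarrow> k z = 0"
    using assms by (auto simp: test_kernel_def)
  have "frechet_derivative k (at z) v = 0" if "norm z > R" for z
  proof -
    have "open {z::'a. norm z > R}"
      by (intro open_Collect_less continuous_intros)
    then have "frechet_derivative (\<lambda>x. 0) (at z) = frechet_derivative k (at z)"
      using that R by (intro frechet_derivative_transform_within_open[where X = "{z. norm z > R}"]) auto
    then show ?thesis by (metis frechet_derivative_const)
  qed
  then show ?thesis
    using assms C_infinity_frechet by (auto simp: test_kernel_def)
qed

lemma compact_support_uniformly_continuous:
  fixes f :: "'a::euclidean_space \<Rightarrow> 'b::metric_space"
  assumes f: "continuous_on UNIV f" and R: "\<And>z. norm z > R \<Longrightarrow> f z = c"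
  shows "uniformly_continuous_on UNIV f"
  unfolding uniformly_continuous_on_def
proof (intro allI impI)
  fix e :: real assume "e > 0"
  have "uniformly_continuous_on (cball 0 (R + 1)) f"
    by (rule compact_uniformly_continuous[OF continuous_on_subset[OF f]]) auto
  then obtain d where d: "d > 0" "\<And>x y. \<lbrakk>x \<in> cball 0 (R + 1); y \<in> cball 0 (R + 1); dist y x < d\<rbrakk> \<Longrightarrow> dist (f y) (f x) < e"
    using \<open>e > 0\<close> unfolding uniformly_continuous_on_def by blast
  have "dist (f y) (f x) < e" if "dist y x < min d 1" for x y
  proof (cases "norm x \<le> R + 1 \<and> norm y \<le> R + 1")
    case True
    then show ?thesis using d that by auto
  next
    case False
    have "\<bar>norm x - norm y\<bar> < 1"
      using that norm_triangle_ineq3[of y x] by (simp add: dist_norm abs_minus_commute)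
    then have "norm x > R" "norm y > R" using False by auto
    then have "f x = c" "f y = c" using R by auto
    then show ?thesis using \<open>e > 0\<close> by simp
  qed
  then show "\<exists>d>0. \<forall>x\<in>UNIV. \<forall>x'\<in>UNIV. dist x' x < d \<longrightarrow> dist (f x') (f x) < e"
    using d(1) by (intro exI[of _ "min d 1"]) auto
qed

lemma test_kernel_bounded:
  assumes "test_kernel k"
  obtains B where "B \<ge> 0" "\<And>z. \<bar>k z\<bar> \<le> B"
proof -
  obtain R where R: "\<And>z. norm z > R \<Longrightarrow> k z = 0"
    using assms by (auto simp: test_kernel_def)
  have "compact (k ` cball 0 R)"
    using assms by (intro compact_continuous_image C_infinity_continuous_on) (auto simp: test_kernel_def)
  then have "bounded (k ` cball 0 R)" by (rule compact_imp_bounded)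
  then obtain B where "\<forall>y\<in>k ` cball 0 R. norm y \<le> B" unfolding bounded_iff by blast
  then have B: "\<bar>k z\<bar> \<le> B" if "norm z \<le> R" for z using that by auto
  have "\<bar>k z\<bar> \<le> \<bar>B\<bar>" for z
    by (cases "norm z \<le> R") (use B[of z] R[of z] in auto)
  then show thesis by (intro that[of "\<bar>B\<bar>"]) auto
qed

text \<open>
  The remainder in the first-order Taylor formula is small uniformly in the base point, because
  the derivative is uniformly continuous. This is what allows differentiation under the integral.
\<close>

lemma test_kernel_uniform_derivative:
  fixes k :: "'a::euclidean_space \<Rightarrow> real"
  assumes k: "test_kernel k" and e: "e > 0"
  shows "\<exists>d>0. \<forall>z h. norm h < d \<longrightarrow> \<bar>k (z + h) - k z - frechet_derivative k (at z) h\<bar> \<le> e * norm h"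
proof -
  let ?D = "\<lambda>z. frechet_derivative k (at z)"
  have kC: "C_infinity k" using k by (simp add: test_kernel_def)
  define e' where "e' = e / DIM('a)"
  have e': "e' > 0" using e by (simp add: e'_def)
  have "\<exists>d>0. \<forall>x y. dist x y < d \<longrightarrow> \<bar>?D x b - ?D y b\<bar> < e'" for b
  proof -
    from test_kernel_frechet[OF k, of b] obtain R where
      "C_infinity (\<lambda>x. ?D x b)" "\<And>z. norm z > R \<Longrightarrow> ?D z b = 0"
      by (auto simp: test_kernel_def)
    then have "uniformly_continuous_on UNIV (\<lambda>x. ?D x b)"
      by (intro compact_support_uniformly_continuous[of _ R 0] C_infinity_continuous_on)
    then have "\<exists>d>0. \<forall>x. \<forall>y. dist y x < d \<longrightarrow> dist (?D y b) (?D x b) < e'"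
      using e' unfolding uniformly_continuous_on_def by simp
    then show ?thesis by (metis dist_real_def)
  qed
  then obtain d where d: "\<And>b. d b > 0" "\<And>b x y. dist x y < d b \<Longrightarrow> \<bar>?D x b - ?D y b\<bar> < e'"
    by metis
  define d0 where "d0 = Min (d ` Basis)"
  have d0: "d0 > 0" "\<And>b. b \<in> Basis \<Longrightarrow> d0 \<le> d b"
    using d(1) by (auto simp: d0_def)
  have "\<bar>k (z + h) - k z - ?D z h\<bar> \<le> e * norm h" if h: "norm h < d0" for z h
  proof -
    have lin: "bounded_linear (?D x)" for x
      using C_infinity_has_derivative[OF kC] has_derivative_bounded_linear by blast
    have "onorm (\<lambda>v. ?D (z + t) v - ?D z v) \<le> e" if t: "t \<in> ball 0 d0" for t
    proof (rule onorm_le)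
      fix v :: 'a
      have *: "?D x v = (\<Sum>b\<in>Basis. (v \<bullet> b) * ?D x b)" for x
      proof -
        interpret bounded_linear "?D x" by (rule lin)
        have "?D x v = ?D x (\<Sum>b\<in>Basis. (v \<bullet> b) *\<^sub>R b)" by (simp add: euclidean_representation)
        then show ?thesis by (simp add: sum scaleR)
      qed
      have "norm (?D (z + t) v - ?D z v) = \<bar>\<Sum>b\<in>Basis. (v \<bullet> b) * (?D (z + t) b - ?D z b)\<bar>"
        by (simp only: * sum_subtractf[symmetric] right_diff_distrib real_norm_def)
      also have "\<dots> \<le> (\<Sum>b\<in>(Basis::'a set). norm v * e')"
      proof (intro order_trans[OF sum_abs] sum_mono)
        fix b :: 'a assume b: "b \<in> Basis"
        have "dist (z + t) z < d b" using t d0(2)[OF b] by (simp add: dist_norm)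
        from d(2)[OF this] show "\<bar>(v \<bullet> b) * (?D (z + t) b - ?D z b)\<bar> \<le> norm v * e'"
          unfolding abs_mult using Basis_le_norm[OF b, of v] by (intro mult_mono) auto
      qed
      also have "\<dots> = e * norm v" by (simp add: e'_def)
      finally show "norm (?D (z + t) v - ?D z v) \<le> e * norm v" .
    qed
    moreover have "((\<lambda>t. k (z + t) - ?D z t) has_derivative (\<lambda>v. ?D (z + t) v - ?D z v)) (at t within ball 0 d0)" for t
    proof -
      have "((\<lambda>t. k (z + t)) has_derivative ?D (z + t)) (at t within ball 0 d0)"
        by (rule has_derivative_compose[OF _ C_infinity_has_derivative[OF kC], of "\<lambda>t. z + t" "\<lambda>t. t", simplified])
          (auto intro!: derivative_eq_intros)
      then show ?thesis
        by (intro has_derivative_diff bounded_linear_imp_has_derivative lin)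
    qed
    ultimately have "norm ((k (z + h) - ?D z h) - (k (z + 0) - ?D z 0)) \<le> e * norm (h - 0)"
      using h d0(1) by (intro differentiable_bound[where S = "ball 0 d0"]) auto
    then show ?thesis
      using linear_0[OF bounded_linear.linear[OF lin[of z]]] by (simp add: algebra_simps)
  qed
  then show ?thesis using d0(1) by blast
qed

lemma integrable_conv_integrand:
  fixes w :: "'a::euclidean_space \<Rightarrow> 'b::euclidean_space"
  assumes k: "test_kernel k" and w: "integrable lborel w"
  shows "integrable lborel (\<lambda>y. k (x - y) *\<^sub>R w y)"
proof -
  obtain B where B: "B \<ge> 0" "\<And>z. \<bar>k z\<bar> \<le> B" using test_kernel_bounded[OF k] by blast
  have [measurable]: "k \<in> borel_measurable borel"
    using k by (auto simp: test_kernel_def intro: C_infinity_borel)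
  have [measurable]: "w \<in> borel_measurable borel" using w borel_measurable_integrable by force
  show ?thesis
  proof (rule Bochner_Integration.integrable_bound)
    show "integrable lborel (\<lambda>y. B * norm (w y))" using w by simp
    show "AE y in lborel. norm (k (x - y) *\<^sub>R w y) \<le> norm (B * norm (w y))"
      using B by (auto intro!: mult_right_mono)
  qed simp
qed

text \<open>Derivatives of a convolution fall on the kernel, which may be differentiated indefinitely.\<close>

lemma conv_has_derivative:
  fixes w :: "'a::euclidean_space \<Rightarrow> 'b::euclidean_space"
  assumes k: "test_kernel k" and w: "integrable lborel w"
  shows "(conv k w has_derivative (\<lambda>v. conv (\<lambda>z. frechet_derivative k (at z) v) w x)) (at x)"
proof -
  let ?D = "\<lambda>z. frechet_derivative k (at z)"
  have lin: "linear (?D z)" for z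
    using k C_infinity_has_derivative has_derivative_linear by (metis test_kernel_def)
  note int = integrable_conv_integrand[OF k w] integrable_conv_integrand[OF test_kernel_frechet[OF k] w]
  show ?thesis
    unfolding has_derivative_at_alt
  proof (intro conjI allI impI)
    have "linear (\<lambda>v. conv (\<lambda>z. ?D z v) w x)"
      by (rule linearI)
        (simp_all add: conv_def linear_add[OF lin] linear_cmul[OF lin] scaleR_add_left int
          flip: Bochner_Integration.integral_add integral_scaleR_right)
    then show "bounded_linear (\<lambda>v. conv (\<lambda>z. ?D z v) w x)"
      by (simp add: linear_conv_bounded_linear)
  next
    fix e :: real assume e: "e > 0"
    define W where "W = (LINT y | lborel. norm (w y))"
    have W: "W \<ge> 0" by (simp add: W_def)
    obtain d where d: "d > 0" "\<And>z h. norm h < d \<Longrightarrow> \<bar>k (z + h) - k z - ?D z h\<bar> \<le> e / (W + 1) * norm h"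
      using test_kernel_uniform_derivative[OF k, of "e / (W + 1)"] e W by (auto simp: field_simps)
    have "norm (conv k w y - conv k w x - conv (\<lambda>z. ?D z (y - x)) w x) \<le> e * norm (y - x)"
      if y: "norm (y - x) < d" for y
    proof -
      have eq: "conv k w y - conv k w x - conv (\<lambda>z. ?D z (y - x)) w x =
          (LINT u | lborel. (k (y - u) - k (x - u) - ?D (x - u) (y - x)) *\<^sub>R w u)"
        by (simp add: conv_def scaleR_diff_left int)
      have "norm (LINT u | lborel. (k (y - u) - k (x - u) - ?D (x - u) (y - x)) *\<^sub>R w u)
          \<le> (LINT u | lborel. e / (W + 1) * norm (y - x) * norm (w u))"
      proof (rule Bochner_Integration.integral_norm_bound_integral)
        show "integrable lborel (\<lambda>u. (k (y - u) - k (x - u) - ?D (x - u) (y - x)) *\<^sub>R w u)"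
          by (simp add: scaleR_diff_left int)
        show "integrable lborel (\<lambda>u. e / (W + 1) * norm (y - x) * norm (w u))" using w by simp
        fix u
        have "\<bar>k (y - u) - k (x - u) - ?D (x - u) (y - x)\<bar> \<le> e / (W + 1) * norm (y - x)"
          using d(2)[OF y, of "x - u"] by (simp add: algebra_simps)
        then show "norm ((k (y - u) - k (x - u) - ?D (x - u) (y - x)) *\<^sub>R w u) \<le> e / (W + 1) * norm (y - x) * norm (w u)"
          unfolding norm_scaleR by (rule mult_right_mono) simp
      qed
      also have "\<dots> = e * norm (y - x) * (W / (W + 1))"
        by (simp add: W_def)
      also have "\<dots> \<le> e * norm (y - x)"
        using e W by (intro mult_left_le) (auto simp: field_simps)
      finally show ?thesis unfolding eq .
    qed
    then show "\<exists>d>0. \<forall>y. norm (y - x) < d \<longrightarrow>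
        norm (conv k w y - conv k w x - conv (\<lambda>z. ?D z (y - x)) w x) \<le> e * norm (y - x)"
      using d(1) by blast
  qed
qed

lemma frechet_derivative_conv:
  assumes "test_kernel k" "integrable lborel w"
  shows "frechet_derivative (conv k w) (at x) v = conv (\<lambda>z. frechet_derivative k (at z) v) w x"
  by (simp flip: frechet_derivative_at[OF conv_has_derivative[OF assms]])

lemma C_infinity_conv:
  assumes "test_kernel k" and w: "integrable lborel w"
  shows "C_infinity (conv k w)"
proof (rule C_infinity_coinduct[where P = "\<lambda>f. \<exists>k. test_kernel k \<and> f = conv k w"])
  fix f assume "\<exists>k. test_kernel k \<and> f = conv k w"
  then obtain k where k: "test_kernel k" and f: "f = conv k w" by auto
  show "\<exists>D. (\<forall>x. (f has_derivative D x) (at x)) \<and>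
      (\<forall>v. \<exists>k. test_kernel k \<and> (\<lambda>x. D x v) = conv k w)"
  proof (intro exI[where x = "\<lambda>x v. conv (\<lambda>z. frechet_derivative k (at z) v) w x"] conjI allI)
    show "(f has_derivative (\<lambda>v. conv (\<lambda>z. frechet_derivative k (at z) v) w x)) (at x)" for x
      unfolding f by (rule conv_has_derivative[OF k w])
    show "\<exists>k'. test_kernel k' \<and> (\<lambda>x. conv (\<lambda>z. frechet_derivative k (at z) v) w x) = conv k' w" for v
      by (rule exI[of _ "\<lambda>z. frechet_derivative k (at z) v"]) (simp add: test_kernel_frechet[OF k])
  qed
qed (use assms in auto)

lemma conv_nonzero_support:
  assumes "conv k w x \<noteq> 0"
  obtains y where "k (x - y) \<noteq> 0" "w y \<noteq> 0"
proof (rule ccontr)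
  assume "\<not> thesis"
  then have "k (x - y) = 0 \<or> w y = 0" for y using that by blast
  then have "(\<lambda>y. k (x - y) *\<^sub>R w y) = (\<lambda>y. 0)" by (simp add: fun_eq_iff)
  then show False using assms by (simp add: conv_def)
qed

lemma distr_lborel_reflect: "distr lborel borel (\<lambda>y. a - y) = (lborel :: 'a::euclidean_space measure)"
  using lborel_affine[of "-1" a] by (simp add: density_1 one_ennreal_def[symmetric])

lemma
  fixes f :: "'a::euclidean_space \<Rightarrow> 'b::{banach, second_countable_topology}"
  assumes [measurable]: "f \<in> borel_measurable borel"
  shows integral_lborel_reflect: "(LINT y | lborel. f (a - y)) = integral\<^sup>L lborel f"
    and integrable_lborel_reflect: "integrable lborel (\<lambda>y. f (a - y)) \<longleftrightarrow> integrable lborel f"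
proof -
  have "integral\<^sup>L lborel f = integral\<^sup>L (distr lborel borel (\<lambda>y. a - y)) f"
    by (simp add: distr_lborel_reflect)
  then show "(LINT y | lborel. f (a - y)) = integral\<^sup>L lborel f"
    by (simp add: integral_distr)
  have "integrable lborel f \<longleftrightarrow> integrable (distr lborel borel (\<lambda>y. a - y)) f"
    by (simp add: distr_lborel_reflect)
  then show "integrable lborel (\<lambda>y. f (a - y)) \<longleftrightarrow> integrable lborel f"
    by (simp add: integrable_distr_eq)
qed

lemma
  fixes f :: "'a::euclidean_space \<Rightarrow> 'b::{banach, second_countable_topology}"
  assumes [measurable]: "f \<in> borel_measurable borel"
  shows integral_lborel_translate: "(LINT y | lborel. f (y - a)) = integral\<^sup>L lborel f"
    and integrable_lborel_translate: "integrable lborel (\<lambda>y. f (y - a)) \<longleftrightarrow> integrable lborel f"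
proof -
  have eq: "distr lborel borel (\<lambda>y. y - a) = (lborel :: 'a measure)"
  proof -
    have "(\<lambda>y. y - a) = (+) (- a)" by (auto simp: fun_eq_iff)
    then show ?thesis using lborel_distr_plus[of "- a"] by simp
  qed
  have "integral\<^sup>L lborel f = integral\<^sup>L (distr lborel borel (\<lambda>y. y - a)) f"
    by (simp add: eq)
  then show "(LINT y | lborel. f (y - a)) = integral\<^sup>L lborel f"
    by (simp add: integral_distr)
  have "integrable lborel f \<longleftrightarrow> integrable (distr lborel borel (\<lambda>y. y - a)) f"
    by (simp add: eq)
  then show "integrable lborel (\<lambda>y. f (y - a)) \<longleftrightarrow> integrable lborel f"
    by (simp add: integrable_distr_eq)
qed

lemma integrable_lborel_compact_support:
  fixes f :: "'a::euclidean_space \<Rightarrow> 'b::euclidean_space"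
  assumes "continuous_on UNIV f" "\<And>z. norm z > R \<Longrightarrow> f z = 0"
  shows "integrable lborel f"
proof -
  have "integrable lborel (\<lambda>x. indicator (cball 0 R) x *\<^sub>R f x)"
    by (rule borel_integrable_compact) (auto intro: continuous_on_subset[OF assms(1)])
  moreover have "(\<lambda>x. indicator (cball 0 R) x *\<^sub>R f x) = f"
    using assms(2) by (auto simp: indicator_def fun_eq_iff not_le)
  ultimately show ?thesis by simp
qed

text \<open>
  The convolution of a test kernel with the indicator of a large ball is constant near the origin,
  so its derivative vanishes there.
\<close>

lemma integral_derivative_test_kernel:
  fixes k :: "'a::euclidean_space \<Rightarrow> real"
  assumes k: "test_kernel k"
  shows "(LINT x | lborel. frechet_derivative k (at x) v) = 0"
proof -
  let ?D = "\<lambda>z. frechet_derivative k (at z) v"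
  obtain R where R: "\<And>z. norm z > R \<Longrightarrow> k z = 0" and kC: "C_infinity k"
    using k by (auto simp: test_kernel_def)
  obtain R' where R': "\<And>z. norm z > R' \<Longrightarrow> ?D z = 0" and DC: "C_infinity ?D"
    using test_kernel_frechet[OF k, of v] by (auto simp: test_kernel_def)
  define w :: "'a \<Rightarrow> real" where "w = indicator (cball 0 (max R R' + 1))"
  have w: "integrable lborel w"
    unfolding w_def by (rule integrable_real_indicator) (auto simp: emeasure_lborel_cball_finite[unfolded infinity_ennreal_def])
  have const: "conv k w x = integral\<^sup>L lborel k" if "x \<in> ball 0 1" for x
  proof -
    have "conv k w x = (LINT y | lborel. k (x - y))"
      unfolding conv_def
    proof (rule Bochner_Integration.integral_cong[OF refl])
      fix y
      have "norm (x - y) > R" if "norm y > max R R' + 1"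
        using that \<open>x \<in> ball 0 1\<close> norm_triangle_ineq2[of y x] by (simp add: norm_minus_commute)
      then show "k (x - y) *\<^sub>R w y = k (x - y)"
        using R by (auto simp: w_def indicator_def not_le)
    qed
    then show ?thesis using kC by (simp add: integral_lborel_reflect C_infinity_borel)
  qed
  have "((\<lambda>x. integral\<^sup>L lborel k) has_derivative (\<lambda>v. 0)) (at (0::'a))" by simp
  then have "(conv k w has_derivative (\<lambda>v. 0)) (at 0)"
    by (rule has_derivative_transform_within_open[where s = "ball 0 1"]) (use const in auto)
  from frechet_derivative_at[OF this, symmetric] have "conv ?D w 0 = 0"
    using frechet_derivative_conv[OF k w, of 0 v] by simp
  moreover have "conv ?D w 0 = (LINT y | lborel. ?D (0 - y))"
    unfolding conv_def
    by (rule Bochner_Integration.integral_cong[OF refl])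
      (use R' in \<open>auto simp: w_def indicator_def not_le\<close>)
  ultimately show ?thesis
    using integral_lborel_reflect[OF C_infinity_borel[OF DC], of 0] by simp
qed


section \<open>Square-integrable functions\<close>

definition sq_integrable :: "'a measure \<Rightarrow> ('a \<Rightarrow> 'b::euclidean_space) \<Rightarrow> bool" where
  "sq_integrable M F \<longleftrightarrow> F \<in> borel_measurable M \<and> integrable M (\<lambda>x. (norm (F x))\<^sup>2)"

lemma sq_integrable_measurable [measurable_dest]: "sq_integrable M F \<Longrightarrow> F \<in> borel_measurable M"
  by (simp add: sq_integrable_def)

lemma sq_integrable_norm: "sq_integrable M F \<Longrightarrow> integrable M (\<lambda>x. (norm (F x))\<^sup>2)"
  by (simp add: sq_integrable_def)

lemma sq_integrable_bound:
  assumes G: "sq_integrable M G" and [measurable]: "F \<in> borel_measurable M"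
    and le: "AE x in M. norm (F x) \<le> c * norm (G x)"
  shows "sq_integrable M F"
  unfolding sq_integrable_def
proof
  show "integrable M (\<lambda>x. (norm (F x))\<^sup>2)"
  proof (rule Bochner_Integration.integrable_bound)
    show "integrable M (\<lambda>x. c\<^sup>2 * (norm (G x))\<^sup>2)"
      using sq_integrable_norm[OF G] by simp
    show "AE x in M. norm ((norm (F x))\<^sup>2) \<le> norm (c\<^sup>2 * (norm (G x))\<^sup>2)"
      using le
    proof eventually_elim
      case (elim x)
      then have "(norm (F x))\<^sup>2 \<le> (c * norm (G x))\<^sup>2" by (intro power_mono) auto
      then show ?case by (simp add: power_mult_distrib)
    qed
  qed measurable
qed measurable

lemma norm_add_power2_le: "(norm (a + b))\<^sup>2 \<le> 2 * (norm a)\<^sup>2 + 2 * (norm b)\<^sup>2"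
proof -
  have "(norm (a + b))\<^sup>2 \<le> (norm a + norm b)\<^sup>2"
    by (intro power_mono norm_triangle_ineq) auto
  also have "\<dots> \<le> 2 * (norm a)\<^sup>2 + 2 * (norm b)\<^sup>2"
    using sum_squares_bound[of "norm a" "norm b"] by (simp add: power2_sum)
  finally show ?thesis .
qed

lemma sq_integrable_add:
  assumes F: "sq_integrable M F" and G: "sq_integrable M G"
  shows "sq_integrable M (\<lambda>x. F x + G x)"
  unfolding sq_integrable_def
proof
  note [measurable] = F[THEN sq_integrable_measurable] G[THEN sq_integrable_measurable]
  show "(\<lambda>x. F x + G x) \<in> borel_measurable M" by measurable
  show "integrable M (\<lambda>x. (norm (F x + G x))\<^sup>2)"
  proof (rule Bochner_Integration.integrable_bound)
    show "integrable M (\<lambda>x. 2 * (norm (F x))\<^sup>2 + 2 * (norm (G x))\<^sup>2)"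
      using sq_integrable_norm[OF F] sq_integrable_norm[OF G] by simp
    show "AE x in M. norm ((norm (F x + G x))\<^sup>2) \<le> norm (2 * (norm (F x))\<^sup>2 + 2 * (norm (G x))\<^sup>2)"
      by (simp add: norm_add_power2_le)
  qed measurable
qed

lemma sq_integrable_uminus: "sq_integrable M F \<Longrightarrow> sq_integrable M (\<lambda>x. - F x)"
  by (simp add: sq_integrable_def)

lemma sq_integrable_diff:
  assumes "sq_integrable M F" "sq_integrable M G"
  shows "sq_integrable M (\<lambda>x. F x - G x)"
  using sq_integrable_add[OF assms(1) sq_integrable_uminus[OF assms(2)]] by simp

lemma sq_integrable_mult_norm:
  assumes F: "sq_integrable M F" and G: "sq_integrable M G"
  shows "integrable M (\<lambda>x. norm (F x) * norm (G x))"
proof (rule Bochner_Integration.integrable_bound)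
  note [measurable] = F[THEN sq_integrable_measurable] G[THEN sq_integrable_measurable]
  show "integrable M (\<lambda>x. (norm (F x))\<^sup>2 + (norm (G x))\<^sup>2)"
    using F G by (auto dest: sq_integrable_norm)
  show "AE x in M. norm (norm (F x) * norm (G x)) \<le> norm ((norm (F x))\<^sup>2 + (norm (G x))\<^sup>2)"
  proof (rule AE_I2)
    fix x
    have "2 * (norm (F x) * norm (G x)) \<le> (norm (F x))\<^sup>2 + (norm (G x))\<^sup>2"
      using sum_squares_bound[of "norm (F x)" "norm (G x)"] by (simp add: mult.assoc)
    moreover have "0 \<le> norm (F x) * norm (G x)" by simp
    ultimately have "norm (F x) * norm (G x) \<le> (norm (F x))\<^sup>2 + (norm (G x))\<^sup>2" by linarith
    then show "norm (norm (F x) * norm (G x)) \<le> norm ((norm (F x))\<^sup>2 + (norm (G x))\<^sup>2)"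
      by simp
  qed
  show "(\<lambda>x. norm (F x) * norm (G x)) \<in> borel_measurable M" by measurable
qed

lemma Cauchy_Schwarz_sq_integrable:
  assumes F: "sq_integrable M F" and G: "sq_integrable M G"
  shows "(LINT x|M. norm (F x) * norm (G x)) \<le>
    sqrt (LINT x|M. (norm (F x))\<^sup>2) * sqrt (LINT x|M. (norm (G x))\<^sup>2)"
proof -
  define a b I where "a = (LINT x|M. (norm (F x))\<^sup>2)" and "b = (LINT x|M. (norm (G x))\<^sup>2)"
    and "I = (LINT x|M. norm (F x) * norm (G x))"
  note int = sq_integrable_norm[OF F] sq_integrable_norm[OF G] sq_integrable_mult_norm[OF F G]
  have nonneg: "a \<ge> 0" "b \<ge> 0" "I \<ge> 0" by (simp_all add: a_def b_def I_def)
  have quad: "0 \<le> s\<^sup>2 * a - 2 * s * I + b" for s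
  proof -
    have "0 \<le> (LINT x|M. (s * norm (F x) - norm (G x))\<^sup>2)" by simp
    also have "\<dots> = (LINT x|M. s\<^sup>2 * (norm (F x))\<^sup>2 - 2 * s * (norm (F x) * norm (G x)) + (norm (G x))\<^sup>2)"
      by (intro Bochner_Integration.integral_cong refl) (simp add: power2_diff power_mult_distrib algebra_simps)
    also have "\<dots> = s\<^sup>2 * a - 2 * s * I + b"
      unfolding a_def b_def I_def using int by simp
    finally show ?thesis .
  qed
  have "I\<^sup>2 \<le> a * b"
  proof (cases "a = 0")
    case True
    have "I = 0"
    proof (rule ccontr)
      assume "I \<noteq> 0"
      then show False using quad[of "(b + 1) / (2 * I)"] True by (simp add: field_simps)
    qed
    then show ?thesis using True by simp
  next
    case False
    then have a: "a > 0" using nonneg by simp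
    then have "0 \<le> b - I\<^sup>2 / a"
      using quad[of "I / a"] by (simp add: power2_eq_square field_simps)
    then show ?thesis using a by (simp add: field_simps)
  qed
  then have "I \<le> sqrt (a * b)" using nonneg by (simp add: real_le_rsqrt)
  then show ?thesis by (simp add: a_def b_def I_def real_sqrt_mult)
qed

lemma sq_integrable_bilinear:
  fixes pr :: "'b::euclidean_space \<Rightarrow> 'c::euclidean_space \<Rightarrow> 'd::euclidean_space"
  assumes pr: "bounded_bilinear pr" and F: "sq_integrable M F" and G: "sq_integrable M G"
  shows "integrable M (\<lambda>x. pr (F x) (G x))"
proof -
  obtain C where C: "\<And>a b. norm (pr a b) \<le> norm a * norm b * C"
    using bounded_bilinear.bounded[OF pr] by blast
  note [measurable] = F[THEN sq_integrable_measurable] G[THEN sq_integrable_measurable]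
  have [measurable]: "(\<lambda>p. pr (fst p) (snd p)) \<in> borel_measurable borel"
    by (intro borel_measurable_continuous_onI bounded_bilinear.continuous_on[OF pr] continuous_intros)
  have meas: "(\<lambda>x. pr (F x) (G x)) \<in> borel_measurable M"
    using measurable_compose[of "\<lambda>x. (F x, G x)" M borel "\<lambda>p. pr (fst p) (snd p)" borel] by simp
  show ?thesis
  proof (rule Bochner_Integration.integrable_bound)
    show "integrable M (\<lambda>x. norm (F x) * norm (G x) * C)"
      using sq_integrable_mult_norm[OF F G] by simp
    show "AE x in M. norm (pr (F x) (G x)) \<le> norm (norm (F x) * norm (G x) * C)"
      using order_trans[OF C abs_ge_self] by simp
  qed (rule meas)
qed

lemma norm_integral_bilinear_le:
  fixes pr :: "'b::euclidean_space \<Rightarrow> 'c::euclidean_space \<Rightarrow> 'd::euclidean_space"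
  assumes pr: "bounded_bilinear pr" and F: "sq_integrable M F" and G: "sq_integrable M G"
    and C: "\<And>a b. norm (pr a b) \<le> norm a * norm b * C" "C \<ge> 0"
  shows "norm (LINT x|M. pr (F x) (G x)) \<le>
    sqrt (LINT x|M. (norm (F x))\<^sup>2) * sqrt (LINT x|M. (norm (G x))\<^sup>2) * C"
proof -
  have "norm (LINT x|M. pr (F x) (G x)) \<le> (LINT x|M. norm (pr (F x) (G x)))"
    by (rule integral_norm_bound)
  also have "\<dots> \<le> (LINT x|M. norm (F x) * norm (G x) * C)"
    using sq_integrable_bilinear[OF pr F G] sq_integrable_mult_norm[OF F G]
    by (intro integral_mono) (auto intro: C)
  also have "\<dots> = (LINT x|M. norm (F x) * norm (G x)) * C" by simp
  also have "\<dots> \<le> sqrt (LINT x|M. (norm (F x))\<^sup>2) * sqrt (LINT x|M. (norm (G x))\<^sup>2) * C"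
    by (intro mult_right_mono Cauchy_Schwarz_sq_integrable F G C)
  finally show ?thesis .
qed


section \<open>Continuity of translations and mollification\<close>

lemma sq_integrable_translate:
  assumes "sq_integrable lborel F"
  shows "sq_integrable lborel (\<lambda>x. F (x - z))"
    and "(LINT x|lborel. (norm (F (x - z)))\<^sup>2) = (LINT x|lborel. (norm (F x))\<^sup>2)"
proof -
  have [measurable]: "F \<in> borel_measurable borel" using assms by (simp add: sq_integrable_def)
  show "sq_integrable lborel (\<lambda>x. F (x - z))"
    using assms integrable_lborel_translate[of "\<lambda>x. (norm (F x))\<^sup>2" z] by (simp add: sq_integrable_def)
  show "(LINT x|lborel. (norm (F (x - z)))\<^sup>2) = (LINT x|lborel. (norm (F x))\<^sup>2)"
    using integral_lborel_translate[of "\<lambda>x. (norm (F x))\<^sup>2" z] by simp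
qed

text \<open>
  Truncating both the values and the support makes the function bounded with bounded support, at an
  arbitrarily small cost in \<open>L\<^sup>2\<close>.
\<close>

lemma sq_integrable_truncate:
  fixes F :: "'a::euclidean_space \<Rightarrow> 'b::euclidean_space"
  assumes F: "sq_integrable lborel F" and e: "e > 0"
  obtains n :: nat where
    "(LINT x|lborel. (norm (F x - (if norm (F x) \<le> n \<and> norm x \<le> n then F x else 0)))\<^sup>2) < e"
proof -
  have [measurable]: "F \<in> borel_measurable borel" using F by (simp add: sq_integrable_def)
  let ?T = "\<lambda>(n::nat) x. if norm (F x) \<le> n \<and> norm x \<le> n then F x else 0"
  have "(\<lambda>n. LINT x|lborel. (norm (F x - ?T n x))\<^sup>2) \<longlonglongrightarrow> (LINT x|(lborel::'a measure). 0)"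
  proof (rule integral_dominated_convergence)
    show "integrable lborel (\<lambda>x. (norm (F x))\<^sup>2)" using F by (simp add: sq_integrable_def)
    show "AE x in lborel. (\<lambda>n. (norm (F x - ?T n x))\<^sup>2) \<longlonglongrightarrow> 0"
    proof (rule AE_I2)
      fix x
      obtain N :: nat where N: "max (norm (F x)) (norm x) \<le> N" using real_arch_simple by blast
      have "(norm (F x - ?T n x))\<^sup>2 = 0" if "n \<ge> N" for n
        using N that by (auto simp: not_le)
      then show "(\<lambda>n. (norm (F x - ?T n x))\<^sup>2) \<longlonglongrightarrow> 0"
        by (intro tendsto_eventually eventually_sequentiallyI[of N])
    qed
  qed auto
  then have "eventually (\<lambda>n. (LINT x|lborel. (norm (F x - ?T n x))\<^sup>2) < e) sequentially"
    using e by (auto intro: order_tendstoD)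
  then show thesis using that by (auto simp: eventually_sequentially)
qed

text \<open>
  A bounded measurable function is the almost everywhere limit of continuous functions. Clamping
  their values and multiplying by a cut-off keeps the limit and makes dominated convergence
  applicable.
\<close>

lemma bounded_approximate_continuous:
  fixes F :: "'a::euclidean_space \<Rightarrow> 'b::euclidean_space"
  assumes [measurable]: "F \<in> borel_measurable borel" and c: "c > 0"
    and bdd: "\<And>x. norm (F x) \<le> c" and supp: "\<And>x. norm x > c \<Longrightarrow> F x = 0" and e: "e > 0"
  obtains g where "continuous_on UNIV g" "\<And>x. norm x > c + 1 \<Longrightarrow> g x = 0"
    "(LINT x|lborel. (norm (F x - g x))\<^sup>2) < e"
proof -
  have "F \<in> borel_measurable lebesgue" by (simp add: measurable_completion)
  then have "F measurable_on UNIV" by (rule lebesgue_measurable_imp_measurable_on) auto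
  then obtain N G where N: "negligible N" and G: "\<And>n. continuous_on UNIV (G n)"
    and lim: "\<And>x. x \<notin> N \<Longrightarrow> (\<lambda>n. G n x) \<longlonglongrightarrow> F x"
    by (auto simp: measurable_on_def)
  define g where "g n x = max 0 (min 1 (c + 1 - norm x)) *\<^sub>R ((c / max c (norm (G n x))) *\<^sub>R G n x)" for n x
  have g: "continuous_on UNIV (g n)" for n
    unfolding g_def using c by (intro continuous_intros G) auto
  have g0: "g n x = 0" if "norm x > c + 1" for n x
    using that by (simp add: g_def)
  have gc: "norm (g n x) \<le> c" for n x
  proof -
    have "norm (g n x) \<le> 1 * norm ((c / max c (norm (G n x))) *\<^sub>R G n x)"
      unfolding g_def norm_scaleR by (intro mult_right_mono) auto
    also have "\<dots> \<le> c" using c by (auto simp: field_simps max_def)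
    finally show ?thesis .
  qed
  have "(\<lambda>n. LINT x|lborel. (norm (F x - g n x))\<^sup>2) \<longlonglongrightarrow> (LINT x|(lborel::'a measure). 0)"
  proof (rule integral_dominated_convergence)
    show "(\<lambda>x. (norm (F x - g n x))\<^sup>2) \<in> borel_measurable lborel" for n
      using borel_measurable_continuous_onI[OF g[of n]] by measurable
    show "integrable lborel (\<lambda>x::'a. (2 * c)\<^sup>2 * indicator (cball 0 (c + 1)) x :: real)"
      by (intro integrable_mult_right integrable_real_indicator)
        (auto simp: emeasure_lborel_cball_finite[unfolded infinity_ennreal_def])
    have "AE x in lebesgue. x \<notin> N"
      using N by (simp add: AE_not_in negligible_iff_null_sets)
    then have "AE x in lborel. x \<notin> N" by (simp add: AE_completion_iff)
    then show "AE x in lborel. (\<lambda>n. (norm (F x - g n x))\<^sup>2) \<longlonglongrightarrow> 0"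
    proof eventually_elim
      case (elim x)
      have "(\<lambda>n. g n x) \<longlonglongrightarrow> max 0 (min 1 (c + 1 - norm x)) *\<^sub>R ((c / max c (norm (F x))) *\<^sub>R F x)"
        unfolding g_def using c by (intro tendsto_intros lim elim) auto
      also have "max 0 (min 1 (c + 1 - norm x)) *\<^sub>R ((c / max c (norm (F x))) *\<^sub>R F x) = F x"
        using bdd[of x] supp[of x] c by (cases "norm x > c") (auto simp: max_def min_def)
      finally have "(\<lambda>n. (norm (F x - g n x))\<^sup>2) \<longlonglongrightarrow> (norm (F x - F x))\<^sup>2"
        by (intro tendsto_intros)
      then show ?case by simp
    qed
    show "AE x in lborel. norm ((norm (F x - g n x))\<^sup>2) \<le> (2 * c)\<^sup>2 * indicator (cball 0 (c + 1)) x" for n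
    proof (rule AE_I2)
      fix x
      have "norm (F x - g n x) \<le> 2 * c"
        using norm_triangle_ineq4[of "F x" "g n x"] bdd[of x] gc[of n x] by linarith
      then have "(norm (F x - g n x))\<^sup>2 \<le> (2 * c)\<^sup>2" by (intro power_mono) auto
      then show "norm ((norm (F x - g n x))\<^sup>2) \<le> (2 * c)\<^sup>2 * indicator (cball 0 (c + 1)) x"
        using supp[of x] g0[of x n] c by (cases "norm x > c + 1") (auto simp: indicator_def)
    qed
  qed auto
  then have "eventually (\<lambda>n. (LINT x|lborel. (norm (F x - g n x))\<^sup>2) < e) sequentially"
    using e by (auto intro: order_tendstoD)
  then obtain n where "(LINT x|lborel. (norm (F x - g n x))\<^sup>2) < e"
    by (auto simp: eventually_sequentially)
  then show thesis using that g g0 by blast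
qed

lemma continuous_compact_sq_integrable:
  fixes g :: "'a::euclidean_space \<Rightarrow> 'b::euclidean_space"
  assumes "continuous_on UNIV g" "\<And>x. norm x > R \<Longrightarrow> g x = 0"
  shows "sq_integrable lborel g"
  unfolding sq_integrable_def
proof
  show "g \<in> borel_measurable lborel" using borel_measurable_continuous_onI[OF assms(1)] by simp
  show "integrable lborel (\<lambda>x. (norm (g x))\<^sup>2)"
    by (rule integrable_lborel_compact_support[of _ R]) (auto intro!: continuous_intros assms)
qed

lemma integral_norm_add_power2_le:
  assumes F: "sq_integrable M F" and G: "sq_integrable M G"
  shows "(LINT x|M. (norm (F x + G x))\<^sup>2) \<le>
    2 * (LINT x|M. (norm (F x))\<^sup>2) + 2 * (LINT x|M. (norm (G x))\<^sup>2)"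
proof -
  have "(LINT x|M. (norm (F x + G x))\<^sup>2) \<le> (LINT x|M. 2 * (norm (F x))\<^sup>2 + 2 * (norm (G x))\<^sup>2)"
    using sq_integrable_norm[OF F] sq_integrable_norm[OF G] sq_integrable_norm[OF sq_integrable_add[OF F G]]
    by (intro integral_mono) (auto intro: norm_add_power2_le)
  then show ?thesis using sq_integrable_norm[OF F] sq_integrable_norm[OF G] by simp
qed

lemma sq_integrable_approximate_continuous:
  fixes F :: "'a::euclidean_space \<Rightarrow> 'b::euclidean_space"
  assumes F: "sq_integrable lborel F" and e: "e > 0"
  obtains g R where "continuous_on UNIV g" "\<And>x. norm x > R \<Longrightarrow> g x = 0"
    "(LINT x|lborel. (norm (F x - g x))\<^sup>2) < e"
proof -
  have [measurable]: "F \<in> borel_measurable borel" using F by (simp add: sq_integrable_def)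
  obtain n :: nat where n:
    "(LINT x|lborel. (norm (F x - (if norm (F x) \<le> n \<and> norm x \<le> n then F x else 0)))\<^sup>2) < e / 4"
    using sq_integrable_truncate[OF F, of "e / 4"] e by auto
  define T where "T x = (if norm (F x) \<le> n \<and> norm x \<le> n then F x else 0)" for x
  have [measurable]: "T \<in> borel_measurable borel" unfolding T_def by measurable
  obtain g where g: "continuous_on UNIV g" "\<And>x. norm x > (real n + 1) + 1 \<Longrightarrow> g x = 0"
    and gT: "(LINT x|lborel. (norm (T x - g x))\<^sup>2) < e / 4"
    by (rule bounded_approximate_continuous[of T "real n + 1" "e / 4"]) (use e in \<open>auto simp: T_def\<close>)
  have T: "sq_integrable lborel T"
    by (rule sq_integrable_bound[OF F, of _ 1]) (auto simp: T_def)
  have "(LINT x|lborel. (norm ((F x - T x) + (T x - g x)))\<^sup>2) \<le>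
      2 * (LINT x|lborel. (norm (F x - T x))\<^sup>2) + 2 * (LINT x|lborel. (norm (T x - g x))\<^sup>2)"
    by (intro integral_norm_add_power2_le sq_integrable_diff F T continuous_compact_sq_integrable[OF g])
  then have "(LINT x|lborel. (norm (F x - g x))\<^sup>2) < e"
    using n gT by (simp add: T_def)
  then show thesis using that g by blast
qed

text \<open>
  For continuous functions with compact support this is uniform continuity. The general case follows
  by approximation, because translations preserve the \<open>L\<^sup>2\<close> norm.
\<close>

lemma translation_continuous:
  fixes F :: "'a::euclidean_space \<Rightarrow> 'b::euclidean_space"
  assumes F: "sq_integrable lborel F" and e: "e > 0"
  shows "\<exists>d>0. \<forall>z. norm z < d \<longrightarrow> (LINT x|lborel. (norm (F (x - z) - F x))\<^sup>2) < e"
proof -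
  \<comment> \<open>The two applications of \<open>(a + b)\<^sup>2 \<le> 2a\<^sup>2 + 2b\<^sup>2\<close> below add up to \<open>6 (e/12) + 4 (e/8) = e\<close>.\<close>
  obtain g R where g: "continuous_on UNIV g" and R: "\<And>x. norm x > R \<Longrightarrow> g x = 0"
    and gF: "(LINT x|lborel. (norm (F x - g x))\<^sup>2) < e / 12"
    using sq_integrable_approximate_continuous[OF F, of "e / 12"] e by auto
  have gS: "sq_integrable lborel g" by (rule continuous_compact_sq_integrable[OF g R])
  define V where "V = measure lborel (cball (0::'a) (R + 1))"
  have V: "V \<ge> 0" by (simp add: V_def)
  define s where "s = sqrt (e / (16 * (V + 1)))"
  have s: "s > 0" "s\<^sup>2 * V < e / 8"
  proof -
    have "e * V < e * (V * 2 + 2)" using e V by (intro mult_strict_left_mono) auto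
    then show "s > 0" "s\<^sup>2 * V < e / 8" using e V by (auto simp: s_def field_simps)
  qed
  obtain d where d: "d > 0" "\<And>x y. dist x y < d \<Longrightarrow> norm (g x - g y) < s"
    using compact_support_uniformly_continuous[OF g R] s(1)
    unfolding uniformly_continuous_on_def by (metis dist_norm UNIV_I)
  have "(LINT x|lborel. (norm (F (x - z) - F x))\<^sup>2) < e" if z: "norm z < min d 1" for z
  proof -
    let ?D = "\<lambda>x. F x - g x" and ?t = "\<lambda>x. g (x - z) - g x"
    have D: "sq_integrable lborel ?D" by (intro sq_integrable_diff F gS)
    note Dz = sq_integrable_translate[OF D, of z]
    have t: "sq_integrable lborel ?t" by (intro sq_integrable_diff sq_integrable_translate gS)
    have "(LINT x|lborel. (norm (?t x))\<^sup>2) \<le> (LINT x|lborel. s\<^sup>2 * indicator (cball (0::'a) (R + 1)) x)"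
    proof (intro integral_mono)
      show "integrable lborel (\<lambda>x. (norm (?t x))\<^sup>2)" by (rule sq_integrable_norm[OF t])
      show "integrable lborel (\<lambda>x. s\<^sup>2 * indicator (cball (0::'a) (R + 1)) x)"
        by (intro integrable_mult_right integrable_real_indicator)
          (auto simp: emeasure_lborel_cball_finite[unfolded infinity_ennreal_def])
      fix x
      show "(norm (?t x))\<^sup>2 \<le> s\<^sup>2 * indicator (cball 0 (R + 1)) x"
      proof (cases "norm x > R + 1")
        case True
        then have "norm (x - z) > R" using norm_triangle_ineq2[of x z] z by simp
        then show ?thesis using True R[of x] R[of "x - z"] by simp
      next
        case False
        have "norm (?t x) < s" using z by (intro d) (simp add: dist_norm)
        then have "(norm (?t x))\<^sup>2 \<le> s\<^sup>2" by (intro power_mono) auto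
        then show ?thesis using False by simp
      qed
    qed
    also have "\<dots> = s\<^sup>2 * V" by (simp add: V_def)
    finally have gt: "(LINT x|lborel. (norm (?t x))\<^sup>2) < e / 8" using s(2) by linarith
    have "(LINT x|lborel. (norm (?D (x - z) + (?t x - ?D x)))\<^sup>2)
        \<le> 2 * (LINT x|lborel. (norm (?D (x - z)))\<^sup>2) + 2 * (LINT x|lborel. (norm (?t x - ?D x))\<^sup>2)"
      by (intro integral_norm_add_power2_le Dz sq_integrable_diff[OF t D])
    moreover have "(LINT x|lborel. (norm (?t x + - ?D x))\<^sup>2)
        \<le> 2 * (LINT x|lborel. (norm (?t x))\<^sup>2) + 2 * (LINT x|lborel. (norm (- ?D x))\<^sup>2)"
      by (intro integral_norm_add_power2_le t sq_integrable_uminus D)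
    moreover have "?D (x - z) + (?t x - ?D x) = F (x - z) - F x" "?t x + - ?D x = ?t x - ?D x" for x
      by simp_all
    ultimately show ?thesis
      using gt gF Dz(2) unfolding norm_minus_cancel by simp
  qed
  then show ?thesis using d(1) by (intro exI[of _ "min d 1"]) auto
qed

definition mollifier :: "real \<Rightarrow> ('a::euclidean_space \<Rightarrow> real) \<Rightarrow> bool" where
  "mollifier d k \<longleftrightarrow> test_kernel k \<and> (\<forall>z. k z \<ge> 0) \<and> integral\<^sup>L lborel k = 1 \<and>
     (\<forall>z. k z \<noteq> 0 \<longrightarrow> norm z < d)"

text \<open>
  Only weak convergence of mollifications is needed, and it comes from Fubini's theorem: pairing
  the mollification of \<open>F\<close> with \<open>K\<close> averages, with weight \<open>k z\<close>, the pairings of the translates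
  \<open>F (\<cdot> - z)\<close> with \<open>K\<close>.
\<close>

lemma integral_conv_bilinear:
  fixes F :: "'a::euclidean_space \<Rightarrow> 'b::euclidean_space" and K :: "'a \<Rightarrow> 'c::euclidean_space"
    and pr :: "'b \<Rightarrow> 'c \<Rightarrow> 'd::euclidean_space"
  assumes pr: "bounded_bilinear pr" and k: "test_kernel k" and Fi: "integrable lborel F"
    and F: "sq_integrable lborel F" and K: "sq_integrable lborel K"
  shows "(LINT x|lborel. pr (conv k F x) (K x)) =
      (LINT z|lborel. k z *\<^sub>R (LINT x|lborel. pr (F (x - z)) (K x)))" (is ?eq)
    and "integrable lborel (\<lambda>z. k z *\<^sub>R (LINT x|lborel. pr (F (x - z)) (K x)))" (is ?int)
proof -
  have [measurable]: "F \<in> borel_measurable borel" "K \<in> borel_measurable borel"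
    using F K by (simp_all add: sq_integrable_def)
  obtain R where kC: "C_infinity k" and R: "\<And>z. norm z > R \<Longrightarrow> k z = 0"
    using k by (auto simp: test_kernel_def)
  have [measurable]: "k \<in> borel_measurable borel" by (rule C_infinity_borel[OF kC])
  have k_int: "integrable lborel k"
    by (rule integrable_lborel_compact_support[OF C_infinity_continuous_on[OF kC] R])
  obtain C where C: "C > 0" "\<And>a b. norm (pr a b) \<le> norm a * norm b * C"
    using bounded_bilinear.pos_bounded[OF pr] by blast
  have pr_borel [measurable]: "(\<lambda>p. pr (fst p) (snd p)) \<in> borel_measurable borel"
    by (intro borel_measurable_continuous_onI bounded_bilinear.continuous_on[OF pr] continuous_intros)
  have meas: "(\<lambda>p. k (fst p) *\<^sub>R pr (F (snd p - fst p)) (K (snd p))) \<in> borel_measurable (lborel \<Otimes>\<^sub>M lborel)"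
  proof (intro borel_measurable_scaleR)
    show "(\<lambda>p. pr (F (snd p - fst p)) (K (snd p))) \<in> borel_measurable (lborel \<Otimes>\<^sub>M lborel)"
      using measurable_compose[of "\<lambda>p. (F (snd p - fst p), K (snd p))" "lborel \<Otimes>\<^sub>M lborel" borel
          "\<lambda>p. pr (fst p) (snd p)" borel] by simp
  qed measurable
  define A where "A = sqrt (LINT x|lborel. (norm (F x))\<^sup>2) * sqrt (LINT x|lborel. (norm (K x))\<^sup>2) * C"
  note Fz = sq_integrable_translate[OF F]
  have pair: "integrable lborel (\<lambda>x. pr (F (x - z)) (K x))" for z
    by (rule sq_integrable_bilinear[OF pr Fz(1) K])
  have prod_int: "integrable (lborel \<Otimes>\<^sub>M lborel) (\<lambda>(z, x). k z *\<^sub>R pr (F (x - z)) (K x))"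
  proof (rule lborel_pair.Fubini_integrable)
    show "(\<lambda>(z, x). k z *\<^sub>R pr (F (x - z)) (K x)) \<in> borel_measurable (lborel \<Otimes>\<^sub>M lborel)"
      using meas by (simp add: case_prod_beta)
    show "integrable lborel (\<lambda>z. LINT x|lborel. norm (case (z, x) of (z, x) \<Rightarrow> k z *\<^sub>R pr (F (x - z)) (K x)))"
    proof (rule Bochner_Integration.integrable_bound)
      show "integrable lborel (\<lambda>z. \<bar>k z\<bar> * A)" using k_int by simp
      show "(\<lambda>z. LINT x|lborel. norm (case (z, x) of (z, x) \<Rightarrow> k z *\<^sub>R pr (F (x - z)) (K x))) \<in> borel_measurable lborel"
        using measurable_compose[OF meas borel_measurable_norm]
        by (intro lborel.borel_measurable_lebesgue_integral) (simp add: case_prod_beta)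
      show "AE z in lborel. norm (LINT x|lborel. norm (case (z, x) of (z, x) \<Rightarrow> k z *\<^sub>R pr (F (x - z)) (K x))) \<le> norm (\<bar>k z\<bar> * A)"
      proof (rule AE_I2)
        fix z
        have "(LINT x|lborel. norm (pr (F (x - z)) (K x))) \<le> (LINT x|lborel. norm (F (x - z)) * norm (K x) * C)"
          using pair[of z] sq_integrable_mult_norm[OF Fz(1) K] by (intro integral_mono) (auto intro: C)
        also have "\<dots> = (LINT x|lborel. norm (F (x - z)) * norm (K x)) * C" by simp
        also have "\<dots> \<le> A"
          unfolding A_def using C(1) Cauchy_Schwarz_sq_integrable[OF Fz(1) K, of z] Fz(2)[of z]
          by (intro mult_right_mono) auto
        finally have "(LINT x|lborel. norm (pr (F (x - z)) (K x))) \<le> A" .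
        moreover have "0 \<le> (LINT x|lborel. norm (pr (F (x - z)) (K x)))" by simp
        ultimately show "norm (LINT x|lborel. norm (case (z, x) of (z, x) \<Rightarrow> k z *\<^sub>R pr (F (x - z)) (K x))) \<le> norm (\<bar>k z\<bar> * A)"
          by (simp add: abs_mult mult_left_mono)
      qed
    qed
    show "AE z in lborel. integrable lborel (\<lambda>x. case (z, x) of (z, x) \<Rightarrow> k z *\<^sub>R pr (F (x - z)) (K x))"
      using pair by simp
  qed
  have "pr (conv k F x) (K x) = (LINT z|lborel. k z *\<^sub>R pr (F (x - z)) (K x))" for x
  proof -
    have int: "integrable lborel (\<lambda>z. k z *\<^sub>R F (x - z))"
      using integrable_conv_integrand[OF k Fi, of x]
        integrable_lborel_reflect[of "\<lambda>y. k (x - y) *\<^sub>R F y" x] by simp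
    have "conv k F x = (LINT z|lborel. k z *\<^sub>R F (x - z))"
      using integral_lborel_reflect[of "\<lambda>y. k (x - y) *\<^sub>R F y" x] by (simp add: conv_def)
    then have "pr (conv k F x) (K x) = (LINT z|lborel. pr (k z *\<^sub>R F (x - z)) (K x))"
      using integral_bounded_linear[OF bounded_bilinear.bounded_linear_left[OF pr] int] by simp
    then show ?thesis by (simp add: bounded_bilinear.scaleR_left[OF pr])
  qed
  then show ?eq
    using lborel_pair.Fubini_integral[OF prod_int] by simp
  show ?int
    using lborel_pair.integrable_fst'[OF prod_int] by simp
qed

lemma mollifier_pairing_tendsto:
  fixes F :: "'a::euclidean_space \<Rightarrow> 'b::euclidean_space" and K :: "'a \<Rightarrow> 'c::euclidean_space"
    and pr :: "'b \<Rightarrow> 'c \<Rightarrow> 'd::euclidean_space"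
  assumes pr: "bounded_bilinear pr" and Fi: "integrable lborel F"
    and F: "sq_integrable lborel F" and K: "sq_integrable lborel K" and e: "e > 0"
  shows "\<exists>d>0. \<forall>k. mollifier d k \<longrightarrow>
    norm ((LINT x|lborel. pr (conv k F x) (K x)) - (LINT x|lborel. pr (F x) (K x))) \<le> e"
proof -
  obtain C where C: "C > 0" "\<And>a b. norm (pr a b) \<le> norm a * norm b * C"
    using bounded_bilinear.pos_bounded[OF pr] by blast
  define B where "B = sqrt (LINT x|lborel. (norm (K x))\<^sup>2) * C + 1"
  have B: "B > 0" using C(1) by (auto simp: B_def intro!: add_nonneg_pos)
  obtain d where d: "d > 0" "\<And>z. norm z < d \<Longrightarrow> (LINT x|lborel. (norm (F (x - z) - F x))\<^sup>2) < (e / B)\<^sup>2"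
    using translation_continuous[OF F, of "(e / B)\<^sup>2"] e B by auto
  let ?\<psi> = "\<lambda>z. LINT x|lborel. pr (F (x - z)) (K x)"
  note Fz = sq_integrable_translate[OF F]
  have close: "norm (?\<psi> z - ?\<psi> 0) \<le> e" if z: "norm z < d" for z
  proof -
    have "?\<psi> z - ?\<psi> 0 = (LINT x|lborel. pr (F (x - z) - F x) (K x))"
      using sq_integrable_bilinear[OF pr Fz(1) K, of z] sq_integrable_bilinear[OF pr F K]
      by (simp add: bounded_bilinear.diff_left[OF pr])
    then have "norm (?\<psi> z - ?\<psi> 0) \<le>
        sqrt (LINT x|lborel. (norm (F (x - z) - F x))\<^sup>2) * sqrt (LINT x|lborel. (norm (K x))\<^sup>2) * C"
      using norm_integral_bilinear_le[OF pr sq_integrable_diff[OF Fz(1) F] K C(2)] C(1) by simp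
    also have "\<dots> \<le> (e / B) * B"
    proof -
      have "sqrt (LINT x|lborel. (norm (F (x - z) - F x))\<^sup>2) \<le> e / B"
        using d(2)[OF z] e B by (intro real_le_lsqrt) auto
      moreover have "sqrt (LINT x|lborel. (norm (K x))\<^sup>2) * C \<le> B" by (simp add: B_def)
      ultimately show ?thesis
        unfolding mult.assoc using C(1) e B by (intro mult_mono) auto
    qed
    finally show ?thesis using B by simp
  qed
  have "norm ((LINT x|lborel. pr (conv k F x) (K x)) - (LINT x|lborel. pr (F x) (K x))) \<le> e"
    if m: "mollifier d k" for k
  proof -
    have k: "test_kernel k" and k0: "\<And>z. k z \<ge> 0" and k1: "integral\<^sup>L lborel k = 1"
      and kd: "\<And>z. k z \<noteq> 0 \<Longrightarrow> norm z < d"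
      using m by (auto simp: mollifier_def)
    have k_int: "integrable lborel k"
      using k1 not_integrable_integral_eq by fastforce
    note conv = integral_conv_bilinear[OF pr k Fi F K]
    have "(LINT x|lborel. pr (conv k F x) (K x)) - ?\<psi> 0 = (LINT z|lborel. k z *\<^sub>R (?\<psi> z - ?\<psi> 0))"
      using k_int k1 conv(2) by (simp add: conv(1) scaleR_diff_right)
    also have "norm \<dots> \<le> (LINT z|lborel. k z * e)"
    proof (rule Bochner_Integration.integral_norm_bound_integral)
      show "integrable lborel (\<lambda>z. k z *\<^sub>R (?\<psi> z - ?\<psi> 0))"
        using k_int conv(2) by (simp add: scaleR_diff_right)
      show "integrable lborel (\<lambda>z. k z * e)" using k_int by simp
      fix z
      show "norm (k z *\<^sub>R (?\<psi> z - ?\<psi> 0)) \<le> k z * e"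
        using close[of z] kd[of z] k0[of z] by (cases "k z = 0") (auto intro!: mult_left_mono)
    qed
    finally show ?thesis using k1 by simp
  qed
  then show ?thesis using d(1) by blast
qed

text \<open>
  The support may be placed around any \<open>c\<close>: mollifying with an off-centre kernel translates by \<open>c\<close>
  at the same time.
\<close>

lemma mollifier_exists:
  fixes c :: "'a::euclidean_space"
  assumes "r > 0" "norm c + r \<le> d"
  obtains k where "mollifier d k" "\<And>z. k z \<noteq> 0 \<Longrightarrow> z \<in> ball c r"
proof -
  define J where "J = integral\<^sup>L lborel (bump c r)"
  have supp: "bump c r z \<noteq> 0 \<longleftrightarrow> z \<in> ball c r" for z using bump_eq_0_iff assms(1) by blast
  have supp0: "norm z < d" if "z \<in> ball c r" for z
  proof -
    have "norm z \<le> norm c + dist c z" using norm_triangle_sub[of z c] by (simp add: dist_norm norm_minus_commute)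
    then show ?thesis using that assms(2) by simp
  qed
  have tk: "test_kernel (bump c r)"
    unfolding test_kernel_def using C_infinity_bump supp supp0
    by (metis less_asym)
  have int: "integrable lborel (bump c r)"
    by (rule integrable_lborel_compact_support[OF C_infinity_continuous_on[OF C_infinity_bump], of d])
      (use supp supp0 in force)
  have "J > 0"
  proof -
    have "J \<noteq> 0"
    proof
      assume "J = 0"
      then have "AE x in lborel. bump c r x = 0"
        unfolding J_def using integral_nonneg_eq_0_iff_AE[OF int] bump_nonneg by auto
      then have "AE x in lborel. x \<notin> ball c r" by eventually_elim (use supp in blast)
      then have "emeasure lborel (ball c r) = 0"
        by (subst (asm) AE_iff_measurable[OF _ refl]) (auto simp: ball_def)
      then have "negligible (ball c r)"
        by (simp add: negligible_iff_null_sets null_sets_def)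
      then show False using assms(1) open_not_negligible[of "ball c r"] by auto
    qed
    moreover have "J \<ge> 0" unfolding J_def by (simp add: bump_nonneg)
    ultimately show ?thesis by simp
  qed
  have "test_kernel (\<lambda>z. inverse J * bump c r z)"
    using tk unfolding test_kernel_def
    by (auto intro!: C_infinity_mult)
  then have "mollifier d (\<lambda>z. inverse J * bump c r z)"
    using \<open>J > 0\<close> supp supp0 int bump_nonneg[of c r] by (auto simp: mollifier_def J_def[symmetric])
  then show thesis using supp that by force
qed


section \<open>Complex vector fields and the curl\<close>

lemma cdot_3: "cdot u v = u $ 1 * cnj (v $ 1) + u $ 2 * cnj (v $ 2) + u $ 3 * cnj (v $ 3)"
  by (simp add: cdot_def sum_3)

lemma norm_cdot_le: "cmod (cdot u v) \<le> norm u * norm v"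
proof -
  have "cmod (cdot u v) \<le> (\<Sum>i\<in>UNIV. \<bar>norm (u $ i)\<bar> * \<bar>norm (v $ i)\<bar>)"
    unfolding cdot_def by (rule order_trans[OF norm_sum]) (simp add: norm_mult)
  also have "\<dots> \<le> norm u * norm v"
    unfolding norm_vec_def by (rule L2_set_mult_ineq)
  finally show ?thesis .
qed

lemma cdot_self: "cdot u u = of_real ((norm u)\<^sup>2)"
proof -
  have "(norm u)\<^sup>2 = (\<Sum>i\<in>UNIV. (cmod (u $ i))\<^sup>2)"
    unfolding norm_vec_def L2_set_def by (simp add: sum_nonneg)
  then show ?thesis
    by (simp add: cdot_def complex_mult_cnj cmod_power2)
qed

lemma cdot_cnj: "cnj (cdot u v) = cdot v u"
  by (simp add: cdot_3 algebra_simps)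

lemma bounded_bilinear_cdot: "bounded_bilinear cdot"
proof
  show "\<exists>K. \<forall>a b. norm (cdot a b) \<le> norm a * norm b * K"
    by (intro exI[of _ 1]) (simp add: norm_cdot_le)
qed (simp_all add: cdot_3 algebra_simps scaleR_conv_of_real[where 'a = complex])

interpretation cdot: bounded_bilinear cdot
  by (rule bounded_bilinear_cdot)

text \<open>The cross product of a real with a complex vector.\<close>

definition rcross :: "real^3 \<Rightarrow> complex^3 \<Rightarrow> complex^3" where
  "rcross a u = vector [a $ 2 *\<^sub>R u $ 3 - a $ 3 *\<^sub>R u $ 2, a $ 3 *\<^sub>R u $ 1 - a $ 1 *\<^sub>R u $ 3,
     a $ 1 *\<^sub>R u $ 2 - a $ 2 *\<^sub>R u $ 1]"

lemma bounded_bilinear_rcross: "bounded_bilinear rcross"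
proof -
  have "bilinear rcross"
    unfolding bilinear_def
    by (auto intro!: linearI simp: rcross_def vec_eq_iff forall_3 algebra_simps)
  then show ?thesis by (simp add: bilinear_conv_bounded_bilinear)
qed

interpretation rcross: bounded_bilinear rcross
  by (rule bounded_bilinear_rcross)

lemma cdot_rcross: "cdot u (rcross a v) = - cdot (rcross a u) v"
  by (simp add: cdot_3 rcross_def scaleR_conv_of_real[where 'a = complex] algebra_simps)

definition grad :: "(real^3 \<Rightarrow> real) \<Rightarrow> real^3 \<Rightarrow> real^3" where
  "grad \<eta> x = (\<chi> j. frechet_derivative \<eta> (at x) (axis j 1))"

lemma classical_curl_scaleR:
  assumes "C_infinity \<eta>" "C_infinity \<phi>"
  shows "classical_curl (\<lambda>x. \<eta> x *\<^sub>R \<phi> x) x = \<eta> x *\<^sub>R classical_curl \<phi> x + rcross (grad \<eta> x) (\<phi> x)"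
proof -
  have "((\<lambda>x. \<eta> x *\<^sub>R \<phi> x) has_derivative
      (\<lambda>v. \<eta> x *\<^sub>R frechet_derivative \<phi> (at x) v + frechet_derivative \<eta> (at x) v *\<^sub>R \<phi> x)) (at x)"
    by (intro has_derivative_scaleR C_infinity_has_derivative assms)
  from frechet_derivative_at[OF this, symmetric]
  have "partial j (\<lambda>x. \<eta> x *\<^sub>R \<phi> x) x = \<eta> x *\<^sub>R partial j \<phi> x + grad \<eta> x $ j *\<^sub>R \<phi> x" for j
    by (simp add: partial_def grad_def)
  then show ?thesis
    by (simp add: vec_eq_iff forall_3 classical_curl_def rcross_def algebra_simps)
qed

lemma classical_curl_eq_sum: "classical_curl \<phi> x = (\<Sum>j\<in>UNIV. rcross (axis j 1) (partial j \<phi> x))"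
  by (simp add: vec_eq_iff forall_3 classical_curl_def rcross_def sum_3 axis_def)

lemma C_infinity_classical_curl:
  assumes "C_infinity \<phi>"
  shows "C_infinity (classical_curl \<phi>)"
proof -
  have "C_infinity (\<lambda>x. rcross (axis j 1) (partial j \<phi> x))" for j
    unfolding partial_def
    by (rule C_infinity_bilinear[OF bounded_bilinear_rcross C_infinity_const C_infinity_frechet[OF assms]])
  then have "C_infinity (\<lambda>x. \<Sum>j\<in>UNIV. rcross (axis j 1) (partial j \<phi> x))"
    by (rule C_infinity_sum)
  then show ?thesis by (simp add: classical_curl_eq_sum[abs_def])
qed

lemma
  fixes f :: "'a::euclidean_space \<Rightarrow> complex"
  assumes f: "C_infinity f" and R: "\<And>z. norm z > R \<Longrightarrow> f z = 0"
  shows integral_derivative_compact_support: "(LINT x|lborel. frechet_derivative f (at x) v) = 0"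
    and integrable_derivative_compact_support: "integrable lborel (\<lambda>x. frechet_derivative f (at x) v)"
proof -
  have part: "test_kernel (\<lambda>x. h (f x)) \<and>
      frechet_derivative (\<lambda>x. h (f x)) (at x) v = h (frechet_derivative f (at x) v)"
    if h: "bounded_linear h" for h :: "complex \<Rightarrow> real" and x
  proof
    show "test_kernel (\<lambda>x. h (f x))"
      using C_infinity_linear_image[OF h f] R linear_0[OF bounded_linear.linear[OF h]]
      unfolding test_kernel_def by metis
    show "frechet_derivative (\<lambda>x. h (f x)) (at x) v = h (frechet_derivative f (at x) v)"
      using frechet_derivative_at[OF bounded_linear.has_derivative[OF h C_infinity_has_derivative[OF f]]]
      by metis
  qed
  note re = part[OF bounded_linear_Re] and im = part[OF bounded_linear_Im]
  have int: "integrable lborel (\<lambda>x. frechet_derivative k (at x) v)" if k: "test_kernel k" for k :: "'a \<Rightarrow> real"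
  proof -
    obtain R where "C_infinity (\<lambda>x. frechet_derivative k (at x) v)"
      "\<And>z. norm z > R \<Longrightarrow> frechet_derivative k (at z) v = 0"
      using test_kernel_frechet[OF k, of v] by (auto simp: test_kernel_def)
    then show ?thesis by (intro integrable_lborel_compact_support[of _ R] C_infinity_continuous_on)
  qed
  have intRe: "integrable lborel (\<lambda>x. Re (frechet_derivative f (at x) v))"
    and intIm: "integrable lborel (\<lambda>x. Im (frechet_derivative f (at x) v))"
    using int[OF conjunct1[OF re]] int[OF conjunct1[OF im]]
    by (simp_all add: conjunct2[OF re] conjunct2[OF im])
  show i: "integrable lborel (\<lambda>x. frechet_derivative f (at x) v)"
  proof -
    have "integrable lborel (\<lambda>x. of_real (Re (frechet_derivative f (at x) v)) +
        \<i> * of_real (Im (frechet_derivative f (at x) v)))"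
      by (intro Bochner_Integration.integrable_add integrable_mult_right integrable_of_real intRe intIm)
    then show ?thesis by (simp add: complex_eq[symmetric])
  qed
  have "(LINT x|lborel. Re (frechet_derivative f (at x) v)) = 0"
    "(LINT x|lborel. Im (frechet_derivative f (at x) v)) = 0"
    using integral_derivative_test_kernel[OF conjunct1[OF re], of v]
      integral_derivative_test_kernel[OF conjunct1[OF im], of v]
    by (simp_all add: conjunct2[OF re] conjunct2[OF im])
  then show "(LINT x|lborel. frechet_derivative f (at x) v) = 0"
    using integral_bounded_linear[OF bounded_linear_Re i] integral_bounded_linear[OF bounded_linear_Im i]
    by (simp add: complex_eq_iff)
qed

text \<open>
  The difference of the two integrands is the divergence of \<open>\<phi> \<times> cnj \<psi>\<close>.
\<close>

lemma integral_curl_by_parts: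
  assumes \<phi>: "C_infinity \<phi>" and R: "\<And>z. norm z > R \<Longrightarrow> \<phi> z = 0" and \<psi>: "C_infinity \<psi>"
  shows "(LINT x|lborel. cdot (classical_curl \<phi> x) (\<psi> x)) = (LINT x|lborel. cdot (\<phi> x) (classical_curl \<psi> x))"
proof -
  let ?f = "\<lambda>j x. cdot (rcross (axis j 1) (\<phi> x)) (\<psi> x)"
  let ?g = "\<lambda>j x. frechet_derivative (?f j) (at x) (axis j 1)"
  have C: "C_infinity (?f j)" for j
    by (intro C_infinity_bilinear[OF bounded_bilinear_cdot] C_infinity_bilinear[OF bounded_bilinear_rcross]
        C_infinity_const \<phi> \<psi>)
  have f0: "?f j z = 0" if "norm z > R" for j z
    using R[OF that] by (simp add: cdot.zero_left
        rcross.zero_right)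
  note int = integrable_derivative_compact_support[OF C f0] integral_derivative_compact_support[OF C f0]
  have g: "?g j x = cdot (rcross (axis j 1) (\<phi> x)) (partial j \<psi> x) + cdot (rcross (axis j 1) (partial j \<phi> x)) (\<psi> x)"
    for j x
  proof -
    have "((\<lambda>x. rcross (axis j 1) (\<phi> x)) has_derivative
        (\<lambda>v. rcross (axis j 1) (frechet_derivative \<phi> (at x) v))) (at x)"
      by (intro bounded_linear.has_derivative[OF rcross.bounded_linear_right]
          C_infinity_has_derivative \<phi>)
    from cdot.FDERIV[OF this C_infinity_has_derivative[OF \<psi>]]
    have "(?f j has_derivative (\<lambda>v. cdot (rcross (axis j 1) (\<phi> x)) (frechet_derivative \<psi> (at x) v) +
        cdot (rcross (axis j 1) (frechet_derivative \<phi> (at x) v)) (\<psi> x))) (at x)" .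
    from frechet_derivative_at[OF this, symmetric] show ?thesis by (simp add: partial_def)
  qed
  have eq: "cdot (classical_curl \<phi> x) (\<psi> x) - cdot (\<phi> x) (classical_curl \<psi> x) = (\<Sum>j\<in>UNIV. ?g j x)" for x
    unfolding g classical_curl_eq_sum
    by (simp add: cdot.sum_left
        cdot.sum_right cdot_rcross[of "\<phi> x"] sum.distrib sum_negf)
  have int1: "integrable lborel (\<lambda>x. cdot (\<phi> x) (classical_curl \<psi> x))"
    by (rule integrable_lborel_compact_support[of _ R])
      (simp_all add: R cdot.zero_left
        C_infinity_continuous_on C_infinity_bilinear[OF bounded_bilinear_cdot] C_infinity_classical_curl \<phi> \<psi>)
  have "(LINT x|lborel. cdot (classical_curl \<phi> x) (\<psi> x)) =
      (LINT x|lborel. cdot (\<phi> x) (classical_curl \<psi> x) + (\<Sum>j\<in>UNIV. ?g j x))"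
    by (intro Bochner_Integration.integral_cong refl) (simp add: eq[symmetric])
  also have "\<dots> = (LINT x|lborel. cdot (\<phi> x) (classical_curl \<psi> x)) + (\<Sum>j\<in>UNIV. LINT x|lborel. ?g j x)"
    using int1 int(1) by (subst Bochner_Integration.integral_add) auto
  finally show ?thesis by (simp add: int(2))
qed

text \<open>
  The test fields are smooth on the whole space and need not vanish anywhere. So if \<open>F\<close> and \<open>G\<close> are
  extensions by zero from \<open>\<Omega>\<close>, then \<open>G\<close> is not only the weak curl of \<open>F\<close> in \<open>\<Omega>\<close>: the tangential
  trace of \<open>F\<close> vanishes as well.
\<close>

definition global_curl :: "field3 \<Rightarrow> field3 \<Rightarrow> bool" where
  "global_curl F G \<longleftrightarrow>
     (\<forall>\<phi>. C_infinity \<phi> \<longrightarrow> (LINT x|lborel. cdot (F x) (classical_curl \<phi> x)) = (LINT x|lborel. cdot (G x) (\<phi> x)))"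

text \<open>
  At a fixed point \<open>x\<close> both sides are integrals of \<open>F\<close> and \<open>G\<close> against multiples of \<open>k (x - y)\<close> and its
  derivatives, and the test fields \<open>y \<mapsto> k (x - y) a\<close> identify them.
\<close>

lemma classical_curl_conv:
  assumes k: "test_kernel k" and F: "integrable lborel F" and G: "integrable lborel G"
    and FG: "global_curl F G"
  shows "classical_curl (conv k F) x = conv k G x"
proof -
  let ?D = "\<lambda>j z. frechet_derivative k (at z) (axis j 1)"
  have kC: "C_infinity k" using k by (simp add: test_kernel_def)
  note intD = integrable_conv_integrand[OF test_kernel_frechet[OF k] F]
  have curl: "classical_curl (conv k F) x = (\<Sum>j\<in>UNIV. rcross (axis j 1) (conv (?D j) F x))"
    by (simp add: classical_curl_eq_sum partial_def frechet_derivative_conv[OF k F])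
  have "cdot (classical_curl (conv k F) x) a = cdot (conv k G x) a" for a
  proof -
    define \<phi> where "\<phi> y = k (x - y) *\<^sub>R a" for y
    have kx: "C_infinity (\<lambda>y. k (x - y))" by (rule C_infinity_minus_arg[OF kC])
    have \<phi>: "C_infinity \<phi>" unfolding \<phi>_def by (intro C_infinity_scaleR kx C_infinity_const)
    have grad_kx: "grad (\<lambda>y. k (x - y)) y = - grad k (x - y)" for y
    proof -
      have "((\<lambda>y. x - y) has_derivative (\<lambda>v. - v)) (at y)" by (auto intro!: derivative_eq_intros)
      from has_derivative_compose[OF this C_infinity_has_derivative[OF kC]]
      have D: "((\<lambda>y. k (x - y)) has_derivative (\<lambda>v. frechet_derivative k (at (x - y)) (- v))) (at y)" .
      have "linear (frechet_derivative k (at (x - y)))"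
        using has_derivative_linear[OF C_infinity_has_derivative[OF kC]] .
      then show ?thesis
        using frechet_derivative_at[OF D, symmetric] by (simp add: grad_def vec_eq_iff linear_neg)
    qed
    have "partial j (\<lambda>y. a) y = 0" for j y by (simp add: partial_def)
    then have curl_a: "classical_curl (\<lambda>y. a) y = 0" for y
      by (simp add: classical_curl_eq_sum rcross.zero_right)
    have grad_sum: "rcross (grad k z) u = (\<Sum>j\<in>UNIV. rcross (axis j 1) (?D j z *\<^sub>R u))" for z u
      by (simp add: grad_def rcross_def vec_eq_iff forall_3 sum_3 axis_def)
    have "cdot (F y) (classical_curl \<phi> y) = (\<Sum>j\<in>UNIV. cdot (rcross (axis j 1) (?D j (x - y) *\<^sub>R F y)) a)" for y
    proof -
      have "classical_curl \<phi> y = rcross (- grad k (x - y)) a"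
        unfolding \<phi>_def classical_curl_scaleR[OF kx C_infinity_const] grad_kx curl_a by simp
      then have "cdot (F y) (classical_curl \<phi> y) = cdot (rcross (grad k (x - y)) (F y)) a"
        by (simp add: cdot_rcross rcross.minus_left
            cdot.minus_right cdot.minus_left)
      then show ?thesis by (simp add: grad_sum cdot.sum_left)
    qed
    then have "(LINT y|lborel. cdot (F y) (classical_curl \<phi> y)) =
        (LINT y|lborel. (\<Sum>j\<in>UNIV. cdot (rcross (axis j 1) (?D j (x - y) *\<^sub>R F y)) a))" by simp
    also have "\<dots> = (\<Sum>j\<in>UNIV. cdot (rcross (axis j 1) (conv (?D j) F x)) a)"
    proof -
      have bl: "bounded_linear (\<lambda>u. cdot (rcross (axis j 1) u) a)" for j
        by (intro bounded_linear_compose[OF cdot.bounded_linear_left]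
            rcross.bounded_linear_right)
      show ?thesis
        unfolding conv_def
        using integral_bounded_linear[OF bl intD] integrable_bounded_linear[OF bl intD]
        by (subst Bochner_Integration.integral_sum) auto
    qed
    also have "\<dots> = cdot (classical_curl (conv k F) x) a"
      by (simp add: curl cdot.sum_left)
    finally have 1: "(LINT y|lborel. cdot (F y) (classical_curl \<phi> y)) = cdot (classical_curl (conv k F) x) a" .
    have "(LINT y|lborel. cdot (G y) (\<phi> y)) = (LINT y|lborel. cdot (k (x - y) *\<^sub>R G y) a)"
      by (simp add: \<phi>_def cdot.scaleR_left
          cdot.scaleR_right)
    also have "\<dots> = cdot (conv k G x) a"
      unfolding conv_def
      by (rule integral_bounded_linear[OF cdot.bounded_linear_left
            integrable_conv_integrand[OF k G]])
    finally show ?thesis using FG \<phi> 1 by (simp add: global_curl_def)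
  qed
  then have "cdot (classical_curl (conv k F) x - conv k G x) (classical_curl (conv k F) x - conv k G x) = 0"
    by (simp add: cdot.diff_left)
  then show ?thesis by (simp add: cdot_self)
qed


section \<open>Extension by zero\<close>

text \<open>Fubini's theorem requires Borel functions, so the extension also passes to a Borel representative.\<close>

definition zero_ext :: "(real^3) set \<Rightarrow> field3 \<Rightarrow> field3 \<Rightarrow> bool" where
  "zero_ext \<Omega> F F' \<longleftrightarrow> sq_integrable lborel F' \<and> (\<forall>x. x \<notin> \<Omega> \<longrightarrow> F' x = 0) \<and>
     (AE x in lborel. x \<in> \<Omega> \<longrightarrow> F x = F' x)"

lemma L2_iff_sq_integrable: "E \<in> L2 \<Omega> \<longleftrightarrow> sq_integrable (lebesgue_on \<Omega>) E"
  by (simp add: L2_def sq_integrable_def)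

lemma integrable_lebesgue_on_iff_lborel:
  fixes f f' :: "real^3 \<Rightarrow> 'b::euclidean_space"
  assumes \<Omega>: "open \<Omega>" and f: "f \<in> borel_measurable (lebesgue_on \<Omega>)" and f' [measurable]: "f' \<in> borel_measurable borel"
    and ae: "AE x in lborel. x \<in> \<Omega> \<longrightarrow> f x = f' x" and out: "\<And>x. x \<notin> \<Omega> \<Longrightarrow> f' x = 0"
  shows "integral\<^sup>L (lebesgue_on \<Omega>) f = integral\<^sup>L lborel f'"
    and "integrable (lebesgue_on \<Omega>) f \<longleftrightarrow> integrable lborel f'"
proof -
  have S: "\<Omega> \<inter> space lebesgue \<in> sets lebesgue" using \<Omega> by simp
  have m: "(\<lambda>x. indicator \<Omega> x *\<^sub>R f x) \<in> borel_measurable lebesgue"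
    using f borel_measurable_restrict_space_iff[OF S] by blast
  have m': "f' \<in> borel_measurable lebesgue" by (simp add: measurable_completion)
  have "AE x in lebesgue. x \<in> \<Omega> \<longrightarrow> f x = f' x" using ae by (simp add: AE_completion_iff)
  then have AE: "AE x in lebesgue. indicator \<Omega> x *\<^sub>R f x = f' x"
    by eventually_elim (auto simp: indicator_def out)
  show "integral\<^sup>L (lebesgue_on \<Omega>) f = integral\<^sup>L lborel f'"
    using integral_restrict_space[OF S, of f] integral_cong_AE[OF m m' AE] by (simp add: integral_completion)
  show "integrable (lebesgue_on \<Omega>) f \<longleftrightarrow> integrable lborel f'"
    using integrable_restrict_space[OF S, of f] integrable_cong_AE[OF m m' AE] by (simp add: integrable_completion)
qed

lemma zero_ext_exists:
  assumes \<Omega>: "open \<Omega>" and F: "F \<in> L2 \<Omega>"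
  obtains F' where "zero_ext \<Omega> F F'"
proof -
  have S: "\<Omega> \<inter> space lebesgue \<in> sets lebesgue" using \<Omega> by simp
  have Fm: "F \<in> borel_measurable (lebesgue_on \<Omega>)" using F by (simp add: L2_def)
  then have m: "(\<lambda>x. indicator \<Omega> x *\<^sub>R F x) \<in> borel_measurable lebesgue"
    using borel_measurable_restrict_space_iff[OF S] by blast
  have "\<exists>g. g \<in> borel_measurable lborel \<and> (AE x in lborel. (indicator \<Omega> x *\<^sub>R F x) \<bullet> b = g x)" for b
  proof -
    have "(\<lambda>x. (indicator \<Omega> x *\<^sub>R F x) \<bullet> b) \<in> borel_measurable lebesgue"
      by (intro borel_measurable_inner m borel_measurable_const)
    from completion_ex_borel_measurable_real[OF this] show ?thesis by blast
  qed
  then have "\<exists>g. \<forall>b. g b \<in> borel_measurable lborel \<and> (AE x in lborel. (indicator \<Omega> x *\<^sub>R F x) \<bullet> b = g b x)"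
    by (intro choice allI)
  then obtain g where g: "\<And>b. g b \<in> borel_measurable lborel"
    and ae: "\<And>b. AE x in lborel. (indicator \<Omega> x *\<^sub>R F x) \<bullet> b = g b x" by blast
  define F' where "F' x = indicator \<Omega> x *\<^sub>R (\<Sum>b\<in>Basis. g b x *\<^sub>R b)" for x
  have [measurable]: "\<Omega> \<in> sets borel" using \<Omega> by simp
  have [measurable]: "g b \<in> borel_measurable borel" for b using g[of b] by simp
  have F'm [measurable]: "F' \<in> borel_measurable borel" unfolding F'_def by measurable
  have out: "F' x = 0" if "x \<notin> \<Omega>" for x using that by (simp add: F'_def)
  have "AE x in lborel. \<forall>b\<in>Basis. (indicator \<Omega> x *\<^sub>R F x) \<bullet> b = g b x"
    using ae by (intro AE_finite_allI) auto
  then have AE: "AE x in lborel. x \<in> \<Omega> \<longrightarrow> F x = F' x"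
  proof eventually_elim
    case (elim x)
    then show ?case
      using euclidean_representation[of "F x"] by (auto simp: F'_def)
  qed
  have "integrable (lebesgue_on \<Omega>) (\<lambda>x. (norm (F x))\<^sup>2) \<longleftrightarrow> integrable lborel (\<lambda>x. (norm (F' x))\<^sup>2)"
  proof (rule integrable_lebesgue_on_iff_lborel(2)[OF \<Omega>])
    show "(\<lambda>x. (norm (F x))\<^sup>2) \<in> borel_measurable (lebesgue_on \<Omega>)" using Fm by measurable
    show "AE x in lborel. x \<in> \<Omega> \<longrightarrow> (norm (F x))\<^sup>2 = (norm (F' x))\<^sup>2"
      using AE by eventually_elim simp
  qed (simp_all add: out)
  then have "sq_integrable lborel F'"
    using F by (simp add: L2_def sq_integrable_def)
  then show thesis by (intro that[of F']) (simp add: zero_ext_def AE out)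
qed

lemma L2_inner_zero_ext:
  assumes \<Omega>: "open \<Omega>" and F: "F \<in> L2 \<Omega>" and F': "zero_ext \<Omega> F F'"
    and K: "K \<in> borel_measurable (lebesgue_on \<Omega>)" and K': "K' \<in> borel_measurable borel"
    and KK': "AE x in lborel. x \<in> \<Omega> \<longrightarrow> K x = K' x"
  shows "L2_inner \<Omega> F K = (LINT x|lborel. cdot (F' x) (K' x))"
  unfolding L2_inner_def
proof (rule integrable_lebesgue_on_iff_lborel(1)[OF \<Omega>])
  have bm: "(\<lambda>x. cdot (f x) (h x)) \<in> borel_measurable M"
    if f[measurable]: "f \<in> borel_measurable M" and h[measurable]: "h \<in> borel_measurable M" for f h and M :: "(real^3) measure"
  proof -
    have [measurable]: "(\<lambda>p. cdot (fst p) (snd p)) \<in> borel_measurable borel"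
      by (intro borel_measurable_continuous_onI cdot.continuous_on continuous_intros)
    show ?thesis
      using measurable_compose[of "\<lambda>x. (f x, h x)" M borel "\<lambda>p. cdot (fst p) (snd p)" borel] by simp
  qed
  show "(\<lambda>x. cdot (F x) (K x)) \<in> borel_measurable (lebesgue_on \<Omega>)"
    using F K by (intro bm) (auto simp: L2_def)
  show "(\<lambda>x. cdot (F' x) (K' x)) \<in> borel_measurable borel"
    using F' K' by (intro bm) (auto simp: zero_ext_def sq_integrable_def)
  show "AE x in lborel. x \<in> \<Omega> \<longrightarrow> cdot (F x) (K x) = cdot (F' x) (K' x)"
    using F' KK' unfolding zero_ext_def by (auto elim: eventually_elim2)
  show "cdot (F' x) (K' x) = 0" if "x \<notin> \<Omega>" for x
    using F' that by (simp add: zero_ext_def cdot_3)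
qed

lemma continuous_borel_lebesgue_on:
  assumes "continuous_on UNIV (f :: 'a::euclidean_space \<Rightarrow> 'b::euclidean_space)"
  shows "f \<in> borel_measurable (lebesgue_on \<Omega>)"
proof -
  have "f \<in> borel_measurable borel" using assms by (rule borel_measurable_continuous_onI)
  then show ?thesis by (intro measurable_restrict_space1) (simp add: measurable_completion)
qed

lemma L2_inner_zero_ext_smooth:
  assumes "open \<Omega>" "F \<in> L2 \<Omega>" "zero_ext \<Omega> F F'" and \<phi>: "C_infinity \<phi>"
  shows "L2_inner \<Omega> F \<phi> = (LINT x|lborel. cdot (F' x) (\<phi> x))"
proof (rule L2_inner_zero_ext[OF assms(1-3)])
  show "\<phi> \<in> borel_measurable (lebesgue_on \<Omega>)"
    by (rule continuous_borel_lebesgue_on[OF C_infinity_continuous_on[OF \<phi>]])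
qed (use C_infinity_borel[OF \<phi>] in simp_all)

lemma sq_integrable_bounded_support_integrable:
  fixes F :: "'a::euclidean_space \<Rightarrow> 'b::euclidean_space"
  assumes F: "sq_integrable lborel F" and "bounded \<Omega>" and out: "\<And>x. x \<notin> \<Omega> \<Longrightarrow> F x = 0"
  shows "integrable lborel F"
proof -
  obtain R where R: "\<Omega> \<subseteq> cball 0 R" 
    using bounded_subset_ballD[OF \<open>bounded \<Omega>\<close>] ball_subset_cball by blast
  show ?thesis
  proof (rule Bochner_Integration.integrable_bound)
    show "integrable lborel (\<lambda>x. (norm (F x))\<^sup>2 + indicator (cball 0 R) x)"
      using F by (intro Bochner_Integration.integrable_add integrable_real_indicator)
        (auto simp: sq_integrable_def emeasure_lborel_cball_finite[unfolded infinity_ennreal_def])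
    show "AE x in lborel. norm (F x) \<le> norm ((norm (F x))\<^sup>2 + indicator (cball 0 R) x :: real)"
    proof (rule AE_I2)
      fix x
      have "2 * norm (F x) \<le> (norm (F x))\<^sup>2 + 1"
        using sum_squares_bound[of "norm (F x)" 1] by simp
      then have "norm (F x) \<le> (norm (F x))\<^sup>2 + 1"
        using norm_ge_zero[of "F x"] by linarith
      then show "norm (F x) \<le> norm ((norm (F x))\<^sup>2 + indicator (cball 0 R) x :: real)"
        using out[of x] R by (cases "x \<in> \<Omega>") (auto simp: indicator_def subset_iff)
    qed
    show "F \<in> borel_measurable lborel" using F by (simp add: sq_integrable_def)
  qed
qed

lemma sq_integrable_continuous_mult:
  fixes F :: "'a::euclidean_space \<Rightarrow> 'b::euclidean_space"
    and pr :: "'c::euclidean_space \<Rightarrow> 'b \<Rightarrow> 'd::euclidean_space"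
  assumes pr: "bounded_bilinear pr" and a: "continuous_on UNIV a"
    and F: "sq_integrable lborel F" and "bounded \<Omega>" and out: "\<And>x. x \<notin> \<Omega> \<Longrightarrow> F x = 0"
  shows "sq_integrable lborel (\<lambda>x. pr (a x) (F x))"
proof -
  obtain C where C: "C > 0" "\<And>a b. norm (pr a b) \<le> norm a * norm b * C"
    using bounded_bilinear.pos_bounded[OF pr] by blast
  have "compact (a ` closure \<Omega>)"
    using \<open>bounded \<Omega>\<close> a by (intro compact_continuous_image) (auto intro: continuous_on_subset)
  then have "bounded (a ` closure \<Omega>)" by (rule compact_imp_bounded)
  then obtain B where "\<forall>y\<in>a ` closure \<Omega>. norm y \<le> B" unfolding bounded_iff by blast
  then have B: "norm (a x) \<le> B" if "x \<in> \<Omega>" for x using that closure_subset by blast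
  have [measurable]: "F \<in> borel_measurable borel" "a \<in> borel_measurable borel"
    using F borel_measurable_continuous_onI[OF a] by (auto simp: sq_integrable_def)
  have [measurable]: "(\<lambda>p. pr (fst p) (snd p)) \<in> borel_measurable borel"
    by (intro borel_measurable_continuous_onI bounded_bilinear.continuous_on[OF pr] continuous_intros)
  show ?thesis
  proof (rule sq_integrable_bound[OF F, of _ "B * C"])
    show "(\<lambda>x. pr (a x) (F x)) \<in> borel_measurable lborel"
      using measurable_compose[of "\<lambda>x. (a x, F x)" lborel borel "\<lambda>p. pr (fst p) (snd p)" borel] by simp
    show "AE x in lborel. norm (pr (a x) (F x)) \<le> B * C * norm (F x)"
    proof (rule AE_I2)
      fix x
      show "norm (pr (a x) (F x)) \<le> B * C * norm (F x)"
      proof (cases "x \<in> \<Omega>")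
        case True
        have "norm (pr (a x) (F x)) \<le> norm (a x) * (norm (F x) * C)" using C(2) by (simp add: mult.assoc)
        also have "\<dots> \<le> B * (norm (F x) * C)" using B[OF True] C(1) by (intro mult_right_mono) auto
        finally show ?thesis by (simp add: ac_simps)
      next
        case False
        then show ?thesis by (simp add: out bounded_bilinear.zero_right[OF pr])
      qed
    qed
  qed
qed


section \<open>Test fields and uniqueness of the weak curl\<close>

lemma conv_in_test_fields:
  assumes k: "test_kernel k" and F: "integrable lborel F"
    and supp: "\<And>y. F y \<noteq> 0 \<Longrightarrow> y \<in> S" and ks: "\<And>z. k z \<noteq> 0 \<Longrightarrow> z \<in> cball w s"
    and S: "compact S" and sub: "(\<Union>y\<in>S. cball (y + w) s) \<subseteq> \<Omega>"
  shows "conv k F \<in> test_fields \<Omega>"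
proof -
  have eq: "(\<Union>y\<in>S. cball (y + w) s) = {x + y |x y. x \<in> S \<and> y \<in> cball w s}"
  proof safe
    fix x y assume "y \<in> S" "x \<in> cball (y + w) s"
    then have "x = y + (x - y)" "x - y \<in> cball w s"
      by (simp_all add: dist_norm algebra_simps)
    then show "\<exists>a b. x = a + b \<and> a \<in> S \<and> b \<in> cball w s" using \<open>y \<in> S\<close> by blast
  next
    fix x y assume "x \<in> S" "y \<in> cball w s"
    then show "x + y \<in> (\<Union>y\<in>S. cball (y + w) s)"
      by (auto intro!: bexI[of _ x] simp: dist_norm)
  qed
  have comp: "compact (\<Union>y\<in>S. cball (y + w) s)"
    unfolding eq by (intro compact_sums S) simp
  have "x \<in> (\<Union>y\<in>S. cball (y + w) s)" if ne: "conv k F x \<noteq> 0" for x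
  proof -
    obtain y where "k (x - y) \<noteq> 0" "F y \<noteq> 0" by (rule conv_nonzero_support[OF ne])
    then have "x - y \<in> cball w s" "y \<in> S" using ks supp by auto
    then show ?thesis by (auto intro!: bexI[of _ y] simp: dist_norm algebra_simps)
  qed
  then have "closure {x. conv k F x \<noteq> 0} \<subseteq> (\<Union>y\<in>S. cball (y + w) s)"
    by (intro closure_minimal compact_imp_closed[OF comp] subsetI) simp
  moreover from this have "compact (closure {x. conv k F x \<noteq> 0})"
    using bounded_subset[OF compact_imp_bounded[OF comp]] by (simp add: compact_eq_bounded_closed)
  ultimately show ?thesis
    using C_infinity_conv[OF k F] sub by (auto simp: test_fields_def)
qed

text \<open>
  Cutting \<open>G\<close> off outside a compact set \<open>S\<close> and mollifying gives test fields whose inner products with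
  \<open>G\<close> converge to the integral of \<open>|G|\<^sup>2\<close> over \<open>S\<close>.
\<close>

lemma L2_zero_if_orthogonal_to_test_fields:
  assumes \<Omega>: "open \<Omega>" and G: "G \<in> L2 \<Omega>" and orth: "\<And>\<phi>. \<phi> \<in> test_fields \<Omega> \<Longrightarrow> L2_inner \<Omega> G \<phi> = 0"
  shows "AE x in lebesgue_on \<Omega>. G x = 0"
proof -
  obtain G' where G': "zero_ext \<Omega> G G'" using zero_ext_exists[OF \<Omega> G] by blast
  have G's: "sq_integrable lborel G'" using G' by (simp add: zero_ext_def)
  have [measurable]: "G' \<in> borel_measurable borel" using G's by (simp add: sq_integrable_def)
  have loc: "AE x in lborel. x \<in> S \<longrightarrow> G' x = 0" if S: "compact S" "S \<subseteq> \<Omega>" for S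
  proof -
    define K where "K x = indicator S x *\<^sub>R G' x" for x
    have [measurable]: "S \<in> sets borel" using S(1) by (simp add: borel_compact)
    have [measurable]: "K \<in> borel_measurable borel" unfolding K_def by measurable
    have K: "sq_integrable lborel K"
      by (rule sq_integrable_bound[OF G's, of _ 1]) (auto simp: K_def indicator_def)
    have Ki: "integrable lborel K"
      by (rule sq_integrable_bounded_support_integrable[OF K compact_imp_bounded[OF S(1)]])
        (simp add: K_def)
    have supp: "y \<in> S" if "K y \<noteq> 0" for y
      using that by (cases "y \<in> S") (auto simp: K_def)
    obtain s where s: "s > 0" "(\<Union>x\<in>S. cball x s) \<subseteq> \<Omega>"
      using compact_subset_open_imp_cball_epsilon_subset[OF S(1) \<Omega> S(2)] by blast
    let ?p = "\<lambda>u v. cdot v u"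
    have pr: "bounded_bilinear ?p"
      using cdot.flip by simp
    have "norm (LINT x|lborel. cdot (G' x) (K x)) \<le> e" if e: "e > 0" for e
    proof -
      from mollifier_pairing_tendsto[OF pr Ki K G's e]
      obtain d where d: "d > 0" and lim: "\<forall>k. mollifier d k \<longrightarrow>
          norm ((LINT x|lborel. cdot (G' x) (conv k K x)) - (LINT x|lborel. cdot (G' x) (K x))) \<le> e"
        by (elim exE conjE)
      have "min s d > 0" "norm (0::real^3) + min s d \<le> d" using s(1) d by auto
      from mollifier_exists[OF this]
      obtain k :: "real^3 \<Rightarrow> real" where k: "mollifier d k" "\<And>z. k z \<noteq> 0 \<Longrightarrow> z \<in> ball 0 (min s d)" by blast
      have \<phi>: "conv k K \<in> test_fields \<Omega>"
      proof (rule conv_in_test_fields[where k = k and F = K and S = S and w = 0 and s = s])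
        show "test_kernel k" using k(1) by (simp add: mollifier_def)
        show "y \<in> S" if "K y \<noteq> 0" for y using supp[OF that] .
        show "z \<in> cball 0 s" if "k z \<noteq> 0" for z using k(2)[OF that] by simp
        show "(\<Union>y\<in>S. cball (y + 0) s) \<subseteq> \<Omega>" using s(2) by simp
      qed (rule Ki S(1))+
      then have "C_infinity (conv k K)" by (simp add: test_fields_def)
      from L2_inner_zero_ext_smooth[OF \<Omega> G G' this] orth[OF \<phi>]
      have "(LINT x|lborel. cdot (G' x) (conv k K x)) = 0" by simp
      then show ?thesis using lim[rule_format, OF k(1)] by simp
    qed
    then have "(LINT x|lborel. cdot (G' x) (K x)) = 0"
      using field_le_epsilon[of "norm (LINT x|lborel. cdot (G' x) (K x))" 0] by simp
    moreover have "cdot (G' x) (K x) = of_real ((norm (K x))\<^sup>2)" for x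
      by (cases "x \<in> S") (simp_all add: K_def cdot_self cdot.zero_right)
    ultimately have "(LINT x|lborel. (norm (K x))\<^sup>2) = 0" by (simp del: of_real_power)
    then have "AE x in lborel. (norm (K x))\<^sup>2 = 0"
      using integral_nonneg_eq_0_iff_AE[OF sq_integrable_norm[OF K]] by simp
    then show ?thesis by eventually_elim (auto simp: K_def)
  qed
  obtain C :: "nat \<Rightarrow> (real^3) set" where C: "\<And>n. compact (C n)" "\<And>n. C n \<subseteq> \<Omega>" "\<Union>(range C) = \<Omega>"
    using open_Union_compact_subsets[OF \<Omega>] by metis
  have "AE x in lborel. \<forall>n::nat. x \<in> C n \<longrightarrow> G' x = 0"
    unfolding AE_all_countable using loc C by blast
  moreover have "AE x in lborel. x \<in> \<Omega> \<longrightarrow> G x = G' x" using G' by (simp add: zero_ext_def)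
  ultimately have "AE x in lborel. x \<in> \<Omega> \<longrightarrow> G x = 0"
  proof eventually_elim
    case (elim x)
    show ?case
    proof
      assume "x \<in> \<Omega>"
      then obtain n where "x \<in> C n" using C(3) by blast
      then show "G x = 0" using elim \<open>x \<in> \<Omega>\<close> by metis
    qed
  qed
  then have "AE x in lebesgue. x \<in> \<Omega> \<longrightarrow> G x = 0" by (simp add: AE_completion_iff)
  then show ?thesis using \<Omega> by (simp add: AE_restrict_space_iff)
qed


section \<open>Green's formula on Lipschitz domains\<close>

text \<open>
  Near a boundary point the domain lies above a continuous graph, so translating upwards pushes
  its closure into it.
\<close>

lemma lipschitz_boundary_inward_translation:
  assumes \<Omega>: "open \<Omega>" and lip: "lipschitz_boundary \<Omega>" and p: "p \<in> closure \<Omega>"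
  shows "\<exists>r>0. \<forall>\<delta>>0. \<exists>w. norm w < \<delta> \<and> (\<forall>y\<in>closure \<Omega> \<inter> cball p r. y + w \<in> \<Omega>)"
proof (cases "p \<in> \<Omega>")
  case True
  then obtain r where "r > 0" "cball p r \<subseteq> \<Omega>" using \<Omega> open_contains_cball by blast
  then show ?thesis by (intro exI[of _ r]) (auto intro!: exI[of _ 0])
next
  case False
  then have "p \<in> frontier \<Omega>" using p \<Omega> by (simp add: frontier_def interior_open)
  then obtain r v L g where r: "r > 0" and v: "norm v = 1" and g: "L-lipschitz_on {y. y \<bullet> v = 0} g"
    and graph: "\<Omega> \<inter> ball p r = {x \<in> ball p r. g (x - (x \<bullet> v) *\<^sub>R v) < x \<bullet> v}"
    using lip unfolding lipschitz_boundary_def by blast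
  let ?P = "\<lambda>x. x - (x \<bullet> v) *\<^sub>R v"
  have vv: "v \<bullet> v = 1" using v by (simp add: dot_square_norm)
  have "continuous_on UNIV (\<lambda>x. g (?P x))"
    by (rule continuous_on_compose2[OF lipschitz_on_continuous_on[OF g]])
      (auto intro!: continuous_intros simp: inner_diff_left vv)
  then have "closed {x. g (?P x) \<le> x \<bullet> v}"
    by (intro closed_Collect_le continuous_intros)
  moreover have "\<Omega> \<inter> ball p r \<subseteq> {x. g (?P x) \<le> x \<bullet> v}" using graph by auto
  ultimately have cl: "closure (\<Omega> \<inter> ball p r) \<subseteq> {x. g (?P x) \<le> x \<bullet> v}" by (rule closure_minimal[rotated])
  have "\<exists>w. norm w < \<delta> \<and> (\<forall>y\<in>closure \<Omega> \<inter> cball p (r / 2). y + w \<in> \<Omega>)" if \<delta>: "\<delta> > 0" for \<delta>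
  proof -
    define t where "t = min (\<delta> / 2) (r / 4)"
    have t: "t > 0" "t < \<delta>" "t \<le> r / 4" using \<delta> r by (auto simp: t_def)
    have "y + t *\<^sub>R v \<in> \<Omega>" if y: "y \<in> closure \<Omega>" "y \<in> cball p (r / 2)" for y
    proof -
      have "y \<in> ball p r" using y r by simp
      then have "y \<in> closure (\<Omega> \<inter> ball p r)"
        using y(1) open_Int_closure_subset[of "ball p r" \<Omega>] by (auto simp: Int_commute)
      then have "g (?P y) \<le> y \<bullet> v" using cl by blast
      moreover have "?P (y + t *\<^sub>R v) = ?P y" by (simp add: inner_add_left vv algebra_simps)
      ultimately have "g (?P (y + t *\<^sub>R v)) < (y + t *\<^sub>R v) \<bullet> v"
        using t(1) by (simp only: inner_add_left inner_scaleR_left vv)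
      moreover have "y + t *\<^sub>R v \<in> ball p r"
      proof -
        have "dist p (y + t *\<^sub>R v) \<le> dist p y + t"
          using dist_triangle[of p "y + t *\<^sub>R v" y] t(1) v by (simp add: dist_norm)
        then show ?thesis using y t r by simp
      qed
      ultimately show ?thesis using graph by blast
    qed
    then show ?thesis using t v by (intro exI[of _ "t *\<^sub>R v"]) auto
  qed
  then show ?thesis using r by (intro exI[of _ "r / 2"]) auto
qed

text \<open>
  Mollifying \<open>F\<close> with a kernel centred at an inward translation \<open>w\<close> gives a field with compact support
  in \<open>\<Omega>\<close>, which may be used to test the weak curl of \<open>H\<close>; its classical curl is the mollification of
  \<open>G\<close>. Both sides of the resulting identity converge as the kernels concentrate at the origin.
\<close>

lemma green_local:
  assumes \<Omega>: "open \<Omega>" "bounded \<Omega>" and H: "H \<in> L2 \<Omega>" "is_weak_curl \<Omega> H C"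
    and H': "zero_ext \<Omega> H H'" and C': "zero_ext \<Omega> C C'"
    and F: "sq_integrable lborel F" and G: "sq_integrable lborel G" and FG: "global_curl F G"
    and suppF: "\<And>x. F x \<noteq> 0 \<Longrightarrow> x \<in> \<Omega> \<inter> cball p r" and suppG: "\<And>x. G x \<noteq> 0 \<Longrightarrow> x \<in> \<Omega>"
    and inward: "\<And>\<delta>. \<delta> > 0 \<Longrightarrow> \<exists>w. norm w < \<delta> \<and> (\<forall>y\<in>closure \<Omega> \<inter> cball p r. y + w \<in> \<Omega>)"
  shows "(LINT x|lborel. cdot (H' x) (G x)) = (LINT x|lborel. cdot (C' x) (F x))"
proof -
  have Fi: "integrable lborel F" and Gi: "integrable lborel G"
    using sq_integrable_bounded_support_integrable[OF F \<Omega>(2)] sq_integrable_bounded_support_integrable[OF G \<Omega>(2)]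
      suppF suppG by blast+
  have H's: "sq_integrable lborel H'" and C's: "sq_integrable lborel C'"
    using H' C' by (simp_all add: zero_ext_def)
  have C: "C \<in> L2 \<Omega>" using H(2) by (simp add: is_weak_curl_def)
  have pr: "bounded_bilinear (\<lambda>u v. cdot v u)"
    using cdot.flip by simp
  have "norm ((LINT x|lborel. cdot (H' x) (G x)) - (LINT x|lborel. cdot (C' x) (F x))) \<le> e + e" if e: "e > 0" for e
  proof -
    obtain d1 where d1: "d1 > 0" "\<And>k. mollifier d1 k \<Longrightarrow>
        norm ((LINT x|lborel. cdot (H' x) (conv k G x)) - (LINT x|lborel. cdot (H' x) (G x))) \<le> e"
      using mollifier_pairing_tendsto[OF pr Gi G H's e] by blast
    obtain d2 where d2: "d2 > 0" "\<And>k. mollifier d2 k \<Longrightarrow>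
        norm ((LINT x|lborel. cdot (C' x) (conv k F x)) - (LINT x|lborel. cdot (C' x) (F x))) \<le> e"
      using mollifier_pairing_tendsto[OF pr Fi F C's e] by blast
    define d where "d = min d1 d2"
    have d: "d > 0" using d1(1) d2(1) by (simp add: d_def)
    obtain w where w: "norm w < d / 2" "\<And>y. y \<in> closure \<Omega> \<inter> cball p r \<Longrightarrow> y + w \<in> \<Omega>"
      using inward[of "d / 2"] d by auto
    let ?S = "closure \<Omega> \<inter> cball p r"
    have S: "compact ?S" using \<Omega>(2) by (simp add: compact_Int)
    have "compact ((\<lambda>y. y + w) ` ?S)" by (intro compact_continuous_image S continuous_intros)
    then obtain s where s: "s > 0" "(\<Union>x\<in>(\<lambda>y. y + w) ` ?S. cball x s) \<subseteq> \<Omega>"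
      using compact_subset_open_imp_cball_epsilon_subset[OF _ \<Omega>(1)] w(2) by (metis image_subsetI)
    have "min s (d / 2) > 0" "norm w + min s (d / 2) \<le> d" using s(1) d w(1) by auto
    from mollifier_exists[OF this]
    obtain k where k: "mollifier d k" "\<And>z. k z \<noteq> 0 \<Longrightarrow> z \<in> ball w (min s (d / 2))" by blast
    have tk: "test_kernel k" using k(1) by (simp add: mollifier_def)
    have \<phi>: "conv k F \<in> test_fields \<Omega>"
    proof (rule conv_in_test_fields[OF tk Fi _ _ S, where w = w and s = s])
      show "y \<in> ?S" if "F y \<noteq> 0" for y using suppF[OF that] closure_subset by blast
      show "z \<in> cball w s" if "k z \<noteq> 0" for z using k(2)[OF that] by simp
    qed (use s(2) in simp)
    then have \<phi>C: "C_infinity (conv k F)" by (simp add: test_fields_def)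
    have "L2_inner \<Omega> H (classical_curl (conv k F)) = L2_inner \<Omega> C (conv k F)"
      using H(2) \<phi> by (simp add: is_weak_curl_def)
    then have "(LINT x|lborel. cdot (H' x) (conv k G x)) = (LINT x|lborel. cdot (C' x) (conv k F x))"
      using L2_inner_zero_ext_smooth[OF \<Omega>(1) H(1) H' C_infinity_classical_curl[OF \<phi>C]]
        L2_inner_zero_ext_smooth[OF \<Omega>(1) C C' \<phi>C]
      by (simp add: classical_curl_conv[OF tk Fi Gi FG])
    moreover have "mollifier d1 k" "mollifier d2 k"
      using k(1) by (auto simp: mollifier_def d_def)
    ultimately show ?thesis
      using d1(2)[of k] d2(2)[of k]
        norm_triangle_ineq[of "(LINT x|lborel. cdot (H' x) (G x)) - (LINT x|lborel. cdot (H' x) (conv k G x))"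
          "(LINT x|lborel. cdot (C' x) (conv k F x)) - (LINT x|lborel. cdot (C' x) (F x))"]
      by (simp add: norm_minus_commute)
  qed
  note small = this
  have "norm ((LINT x|lborel. cdot (H' x) (G x)) - (LINT x|lborel. cdot (C' x) (F x))) \<le> 0 + e" if "e > 0" for e
    using small[of "e / 2"] that by simp
  then have "norm ((LINT x|lborel. cdot (H' x) (G x)) - (LINT x|lborel. cdot (C' x) (F x))) \<le> 0"
    by (rule field_le_epsilon)
  then show ?thesis by simp
qed

text \<open>
  The bumps divided by their sum, where the sum is first modified away from \<open>S\<close>, since it may vanish
  there.
\<close>

lemma smooth_partition_of_unity:
  fixes S :: "'a::euclidean_space set"
  assumes S: "compact S" and r: "\<And>p. p \<in> S \<Longrightarrow> r p > 0"
  obtains P \<eta> where "finite P" "P \<subseteq> S" "\<And>p. C_infinity (\<eta> p)"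
    "\<And>p x. p \<in> P \<Longrightarrow> \<eta> p x \<noteq> 0 \<Longrightarrow> x \<in> cball p (r p)" "\<And>x. x \<in> S \<Longrightarrow> (\<Sum>p\<in>P. \<eta> p x) = (1::real)"
proof -
  obtain P where P: "finite P" "P \<subseteq> S" "S \<subseteq> (\<Union>p\<in>P. ball p (r p))"
  proof (rule compactE_image[OF S, of S "\<lambda>p. ball p (r p)"])
    show "S \<subseteq> (\<Union>p\<in>S. ball p (r p))" using r by auto
  qed auto
  define s where "s x = (\<Sum>p\<in>P. bump p (r p) x)" for x
  have sC: "C_infinity s" unfolding s_def by (intro C_infinity_sum C_infinity_bump)
  have s_nonneg: "s x \<ge> 0" for x by (simp add: s_def sum_nonneg bump_nonneg)
  have s_pos: "s x > 0" if "x \<in> S" for x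
  proof -
    obtain p where p: "p \<in> P" "x \<in> ball p (r p)" using P(3) \<open>x \<in> S\<close> by blast
    then have "bump p (r p) x > 0" using bump_pos_iff r P(2) by blast
    then show ?thesis unfolding s_def using p(1) P(1) by (intro sum_pos2) (auto simp: bump_nonneg)
  qed
  obtain m where m: "m > 0" "\<And>x. x \<in> S \<Longrightarrow> s x \<ge> m"
  proof (cases "S = {}")
    case False
    then obtain x where "x \<in> S" "\<And>y. y \<in> S \<Longrightarrow> s x \<le> s y"
      using continuous_attains_inf[OF S False C_infinity_continuous_on[OF sC]] by blast
    then show thesis using that s_pos by blast
  qed (use that[of 1] in auto)
  \<comment> \<open>\<open>q\<close> is positive everywhere and agrees with \<open>s\<close> on \<open>S\<close>.\<close>
  define q where "q x = s x + flat 1 (m - s x)" for x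
  have q_pos: "q x > 0" for x
  proof (cases "s x > 0")
    case True
    then show ?thesis by (simp add: q_def add_pos_nonneg flat_1_nonneg)
  next
    case False
    then show ?thesis using s_nonneg[of x] m(1) by (simp add: q_def flat_1_pos_iff add_nonneg_pos)
  qed
  have "C_infinity (\<lambda>x. m + (-1) * s x)"
    by (intro C_infinity_add C_infinity_mult C_infinity_const sC)
  then have "C_infinity (\<lambda>x. m - s x)" by simp
  then have qC: "C_infinity q" unfolding q_def by (intro C_infinity_add sC C_infinity_flat_compose)
  show thesis
  proof (rule that[of P "\<lambda>p x. bump p (r p) x * inverse (q x)"])
    show "C_infinity (\<lambda>x. bump p (r p) x * inverse (q x))" for p
      using q_pos by (intro C_infinity_mult C_infinity_bump C_infinity_inverse qC) (simp add: less_imp_neq[THEN not_sym])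
    show "x \<in> cball p (r p)" if "p \<in> P" "bump p (r p) x * inverse (q x) \<noteq> 0" for p x
      using that bump_eq_0_iff[of "r p" p x] r P(2) by auto
    show "(\<Sum>p\<in>P. bump p (r p) x * inverse (q x)) = 1" if "x \<in> S" for x
    proof -
      have "q x = s x" using m(2)[OF that] by (simp add: q_def flat_def)
      then show ?thesis using s_pos[OF that] by (simp add: sum_distrib_right[symmetric] s_def[symmetric])
    qed
  qed (use P in auto)
qed

lemma global_curl_scaleR:
  assumes \<eta>: "C_infinity \<eta>" and "bounded \<Omega>"
    and F: "sq_integrable lborel F" "\<And>x. x \<notin> \<Omega> \<Longrightarrow> F x = 0"
    and G: "sq_integrable lborel G" "\<And>x. x \<notin> \<Omega> \<Longrightarrow> G x = 0" and FG: "global_curl F G"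
  shows "global_curl (\<lambda>x. \<eta> x *\<^sub>R F x) (\<lambda>x. \<eta> x *\<^sub>R G x + rcross (grad \<eta> x) (F x))"
  unfolding global_curl_def
proof (intro allI impI)
  fix \<phi> :: field3 assume \<phi>: "C_infinity \<phi>"
  have \<eta>\<phi>: "C_infinity (\<lambda>x. \<eta> x *\<^sub>R \<phi> x)" by (rule C_infinity_scaleR[OF \<eta> \<phi>])
  have grad_cont: "continuous_on UNIV (grad \<eta>)"
    unfolding grad_def by (intro continuous_on_vec_lambda C_infinity_continuous_on C_infinity_frechet \<eta>)
  have pr: "bounded_bilinear (\<lambda>u v. cdot v u)"
    using cdot.flip by simp
  have int: "integrable lborel (\<lambda>x. cdot (K x) (\<psi> x))"
    if K: "sq_integrable lborel K" "\<And>x. x \<notin> \<Omega> \<Longrightarrow> K x = 0" and \<psi>: "C_infinity \<psi>" for K and \<psi> :: field3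
    by (rule sq_integrable_bounded_support_integrable[OF
          sq_integrable_continuous_mult[OF pr C_infinity_continuous_on[OF \<psi>] K(1) \<open>bounded \<Omega>\<close> K(2)] \<open>bounded \<Omega>\<close>])
      (simp_all add: K(2) cdot.zero_left)
  have R: "sq_integrable lborel (\<lambda>x. rcross (grad \<eta> x) (F x))"
    by (rule sq_integrable_continuous_mult[OF bounded_bilinear_rcross grad_cont F(1) \<open>bounded \<Omega>\<close> F(2)])
  have R0: "rcross (grad \<eta> x) (F x) = 0" if "x \<notin> \<Omega>" for x
    using F(2)[OF that] by (simp add: rcross.zero_right)
  have "(LINT x|lborel. cdot (\<eta> x *\<^sub>R F x) (classical_curl \<phi> x)) =
      (LINT x|lborel. cdot (F x) (classical_curl (\<lambda>x. \<eta> x *\<^sub>R \<phi> x) x) + cdot (rcross (grad \<eta> x) (F x)) (\<phi> x))"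
    by (intro Bochner_Integration.integral_cong refl)
      (simp add: classical_curl_scaleR[OF \<eta> \<phi>] cdot.add_right cdot_rcross
        cdot.scaleR_left cdot.scaleR_right)
  also have "\<dots> = (LINT x|lborel. cdot (F x) (classical_curl (\<lambda>x. \<eta> x *\<^sub>R \<phi> x) x)) +
      (LINT x|lborel. cdot (rcross (grad \<eta> x) (F x)) (\<phi> x))"
    by (intro Bochner_Integration.integral_add int F R R0 C_infinity_classical_curl \<eta>\<phi> \<phi>)
  also have "(LINT x|lborel. cdot (F x) (classical_curl (\<lambda>x. \<eta> x *\<^sub>R \<phi> x) x)) = (LINT x|lborel. cdot (G x) (\<eta> x *\<^sub>R \<phi> x))"
    using FG \<eta>\<phi> by (simp add: global_curl_def)
  also have "\<dots> + (LINT x|lborel. cdot (rcross (grad \<eta> x) (F x)) (\<phi> x)) =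
      (LINT x|lborel. cdot (G x) (\<eta> x *\<^sub>R \<phi> x) + cdot (rcross (grad \<eta> x) (F x)) (\<phi> x))"
    by (intro Bochner_Integration.integral_add[symmetric] int G R R0 \<eta>\<phi> \<phi>)
  also have "\<dots> = (LINT x|lborel. cdot (\<eta> x *\<^sub>R G x + rcross (grad \<eta> x) (F x)) (\<phi> x))"
    by (simp add: cdot.add_left
        cdot.scaleR_left cdot.scaleR_right)
  finally show "(LINT x|lborel. cdot (\<eta> x *\<^sub>R F x) (classical_curl \<phi> x)) =
      (LINT x|lborel. cdot (\<eta> x *\<^sub>R G x + rcross (grad \<eta> x) (F x)) (\<phi> x))" .
qed

lemma is_weak_curl_curl: "E \<in> Hcurl \<Omega> \<Longrightarrow> is_weak_curl \<Omega> E (curl \<Omega> E)"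
  unfolding curl_def Hcurl_def using someI_ex[of "is_weak_curl \<Omega> E"] by blast

lemma curl_in_L2: "E \<in> Hcurl \<Omega> \<Longrightarrow> curl \<Omega> E \<in> L2 \<Omega>"
  using is_weak_curl_curl by (auto simp: is_weak_curl_def)

text \<open>
  A field with vanishing tangential trace, extended by zero, has a curl on the whole space. Multiplying
  it by a partition of unity localises it to sets on which some small translation points into the
  domain. In the sum the gradients of the cut-off functions cancel, as these add up to one on \<open>\<Omega>\<close>.
\<close>

theorem green_Hcurl0:
  assumes \<Omega>: "open \<Omega>" "bounded \<Omega>" "lipschitz_boundary \<Omega>" and E: "E \<in> Hcurl0 \<Omega>" and H: "H \<in> Hcurl \<Omega>"
  shows "L2_inner \<Omega> (curl \<Omega> E) H = L2_inner \<Omega> E (curl \<Omega> H)"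
proof -
  have EL: "E \<in> L2 \<Omega>" "curl \<Omega> E \<in> L2 \<Omega>" and HL: "H \<in> L2 \<Omega>" "curl \<Omega> H \<in> L2 \<Omega>"
    using E H by (auto simp: Hcurl0_def Hcurl_def curl_in_L2)
  obtain F G H' C' where F: "zero_ext \<Omega> E F" and G: "zero_ext \<Omega> (curl \<Omega> E) G"
    and H': "zero_ext \<Omega> H H'" and C': "zero_ext \<Omega> (curl \<Omega> H) C'"
    using zero_ext_exists[OF \<Omega>(1)] EL HL by metis
  have FG: "global_curl F G"
    unfolding global_curl_def
  proof (intro allI impI)
    fix \<phi> :: field3 assume \<phi>: "C_infinity \<phi>"
    then have "L2_inner \<Omega> (curl \<Omega> E) \<phi> = L2_inner \<Omega> E (classical_curl \<phi>)"
      using E by (simp add: Hcurl0_def tangential_trace_def)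
    then show "(LINT x|lborel. cdot (F x) (classical_curl \<phi> x)) = (LINT x|lborel. cdot (G x) (\<phi> x))"
      using L2_inner_zero_ext_smooth[OF \<Omega>(1) EL(1) F C_infinity_classical_curl[OF \<phi>]]
        L2_inner_zero_ext_smooth[OF \<Omega>(1) EL(2) G \<phi>] by simp
  qed
  have Fs: "sq_integrable lborel F" "\<And>x. x \<notin> \<Omega> \<Longrightarrow> F x = 0"
    and Gs: "sq_integrable lborel G" "\<And>x. x \<notin> \<Omega> \<Longrightarrow> G x = 0"
    and H's: "sq_integrable lborel H'" and C's: "sq_integrable lborel C'"
    using F G H' C' by (auto simp: zero_ext_def)
  obtain r where r: "\<And>p. p \<in> closure \<Omega> \<Longrightarrow> r p > 0"
    and inward: "\<And>p \<delta>. p \<in> closure \<Omega> \<Longrightarrow> \<delta> > 0 \<Longrightarrow>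
      \<exists>w. norm w < \<delta> \<and> (\<forall>y\<in>closure \<Omega> \<inter> cball p (r p). y + w \<in> \<Omega>)"
    using lipschitz_boundary_inward_translation[OF \<Omega>(1,3)] by metis
  have "compact (closure \<Omega>)" using \<Omega>(2) by simp
  then obtain P \<eta> where P: "finite P" "P \<subseteq> closure \<Omega>" and \<eta>: "\<And>p. C_infinity (\<eta> p)"
    and \<eta>_supp: "\<And>p x. p \<in> P \<Longrightarrow> \<eta> p x \<noteq> 0 \<Longrightarrow> x \<in> cball p (r p)"
    and \<eta>_sum: "\<And>x. x \<in> closure \<Omega> \<Longrightarrow> (\<Sum>p\<in>P. \<eta> p x) = (1::real)"
    using smooth_partition_of_unity[of "closure \<Omega>" r] r by metis
  define Gp where "Gp p x = \<eta> p x *\<^sub>R G x + rcross (grad (\<eta> p) x) (F x)" for p x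
  have grad_cont: "continuous_on UNIV (grad (\<eta> p))" for p
    unfolding grad_def by (intro continuous_on_vec_lambda C_infinity_continuous_on C_infinity_frechet \<eta>)
  have Fp: "sq_integrable lborel (\<lambda>x. \<eta> p x *\<^sub>R F x)" for p
    by (rule sq_integrable_continuous_mult[OF bounded_bilinear_scaleR C_infinity_continuous_on[OF \<eta>] Fs(1) \<Omega>(2) Fs(2)])
  have Gps: "sq_integrable lborel (Gp p)" for p
    unfolding Gp_def
    by (intro sq_integrable_add
        sq_integrable_continuous_mult[OF bounded_bilinear_scaleR C_infinity_continuous_on[OF \<eta>] Gs(1) \<Omega>(2) Gs(2)]
        sq_integrable_continuous_mult[OF bounded_bilinear_rcross grad_cont Fs(1) \<Omega>(2) Fs(2)])
  have "(LINT x|lborel. cdot (H' x) (Gp p x)) = (LINT x|lborel. cdot (C' x) (\<eta> p x *\<^sub>R F x))" if p: "p \<in> P" for p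
  proof (rule green_local[OF \<Omega>(1,2) HL(1) is_weak_curl_curl[OF H] H' C' Fp Gps])
    show "global_curl (\<lambda>x. \<eta> p x *\<^sub>R F x) (Gp p)"
      unfolding Gp_def by (rule global_curl_scaleR[OF \<eta> \<Omega>(2) Fs Gs FG])
    show "x \<in> \<Omega> \<inter> cball p (r p)" if "\<eta> p x *\<^sub>R F x \<noteq> 0" for x
      using that \<eta>_supp[OF p, of x] Fs(2)[of x] by auto
    show "x \<in> \<Omega>" if "Gp p x \<noteq> 0" for x
      using that Fs(2)[of x] Gs(2)[of x] by (cases "x \<in> \<Omega>") (auto simp: Gp_def rcross.zero_right)
  qed (use inward p P(2) in blast)
  then have "(\<Sum>p\<in>P. LINT x|lborel. cdot (H' x) (Gp p x)) = (\<Sum>p\<in>P. LINT x|lborel. cdot (C' x) (\<eta> p x *\<^sub>R F x))"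
    by (rule sum.cong[OF refl])
  moreover have "(\<Sum>p\<in>P. LINT x|lborel. cdot (H' x) (Gp p x)) = (LINT x|lborel. cdot (H' x) (G x))"
  proof -
    have "(\<Sum>p\<in>P. Gp p x) = G x" for x
    proof (cases "x \<in> \<Omega>")
      case True
      have "((\<lambda>y. \<Sum>p\<in>P. \<eta> p y) has_derivative (\<lambda>v. \<Sum>p\<in>P. frechet_derivative (\<eta> p) (at x) v)) (at x)"
        by (intro has_derivative_sum C_infinity_has_derivative \<eta>)
      moreover have "((\<lambda>y. \<Sum>p\<in>P. \<eta> p y) has_derivative (\<lambda>v. 0)) (at x)"
        by (rule has_derivative_transform_within_open[OF has_derivative_const[of 1] \<Omega>(1) True])
          (use \<eta>_sum closure_subset in \<open>auto simp: subset_iff\<close>)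
      ultimately have "(\<Sum>p\<in>P. frechet_derivative (\<eta> p) (at x) v) = 0" for v
        using has_derivative_unique by (metis (no_types, lifting))
      then have grad0: "(\<Sum>p\<in>P. grad (\<eta> p) x) = 0" by (simp add: grad_def vec_eq_iff)
      have "(\<Sum>p\<in>P. Gp p x) = (\<Sum>p\<in>P. \<eta> p x) *\<^sub>R G x + rcross (\<Sum>p\<in>P. grad (\<eta> p) x) (F x)"
        by (simp add: Gp_def sum.distrib scaleR_sum_left rcross.sum_left)
      then show ?thesis
        using \<eta>_sum[of x] True closure_subset[of \<Omega>]
        by (auto simp: grad0 rcross.zero_left)
    next
      case False
      then show ?thesis
        by (simp add: Gp_def Fs(2) Gs(2) rcross.zero_right)
    qed
    then show ?thesis
      by (subst Bochner_Integration.integral_sum[symmetric])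
        (simp_all add: sq_integrable_bilinear[OF bounded_bilinear_cdot H's Gps]
          cdot.sum_right[symmetric])
  qed
  moreover have "(\<Sum>p\<in>P. LINT x|lborel. cdot (C' x) (\<eta> p x *\<^sub>R F x)) = (LINT x|lborel. cdot (C' x) (F x))"
  proof -
    have "(\<Sum>p\<in>P. \<eta> p x *\<^sub>R F x) = F x" for x
      using \<eta>_sum[of x] Fs(2)[of x] closure_subset[of \<Omega>] by (cases "x \<in> \<Omega>") (auto simp: scaleR_sum_left[symmetric])
    then show ?thesis
      by (subst Bochner_Integration.integral_sum[symmetric])
        (simp_all add: sq_integrable_bilinear[OF bounded_bilinear_cdot C's Fp]
          cdot.sum_right[symmetric])
  qed
  ultimately have eq: "(LINT x|lborel. cdot (H' x) (G x)) = (LINT x|lborel. cdot (C' x) (F x))" by simp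
  have pair: "L2_inner \<Omega> A B = cnj (LINT x|lborel. cdot (B' x) (A' x))"
    if "A \<in> L2 \<Omega>" "B \<in> L2 \<Omega>" "zero_ext \<Omega> A A'" "zero_ext \<Omega> B B'" for A B A' B'
  proof -
    have "L2_inner \<Omega> A B = (LINT x|lborel. cdot (A' x) (B' x))"
      by (rule L2_inner_zero_ext[OF \<Omega>(1) that(1,3)])
        (use that in \<open>auto simp: L2_def zero_ext_def sq_integrable_def\<close>)
    also have "\<dots> = (LINT x|lborel. cnj (cdot (B' x) (A' x)))" by (simp add: cdot_cnj)
    finally show ?thesis by simp
  qed
  show ?thesis
    using eq by (simp add: pair[OF EL(2) HL(1) G H'] pair[OF EL(1) HL(2) F C'])
qed


section \<open>The algebra of square-integrable fields\<close>

lemma norm_vector_scalar_mult: "norm (c *s u) = cmod c * norm (u :: complex^3)"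
  by (simp add: norm_vec_def L2_set_def norm_mult power_mult_distrib sum_distrib_left[symmetric]
      real_sqrt_mult)

lemma scaleR_conv_scalar_mult: "a *\<^sub>R u = complex_of_real a *s (u :: complex^3)"
  by (simp add: vec_eq_iff scaleR_conv_of_real[where 'a = complex])

lemma cdot_scalar_left: "cdot (c *s u) v = c * cdot u v"
  by (simp add: cdot_3 algebra_simps)

lemma cdot_scalar_right: "cdot u (c *s v) = cnj c * cdot u v"
  by (simp add: cdot_3 algebra_simps)

lemma L2_add: "F \<in> L2 \<Omega> \<Longrightarrow> G \<in> L2 \<Omega> \<Longrightarrow> (\<lambda>x. F x + G x) \<in> L2 \<Omega>"
  by (simp add: L2_iff_sq_integrable sq_integrable_add)

lemma L2_diff: "F \<in> L2 \<Omega> \<Longrightarrow> G \<in> L2 \<Omega> \<Longrightarrow> (\<lambda>x. F x - G x) \<in> L2 \<Omega>"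
  by (simp add: L2_iff_sq_integrable sq_integrable_diff)

lemma L2_zero: "(\<lambda>x. 0) \<in> L2 \<Omega>"
  by (simp add: L2_def)

lemma L2_norm_nonneg: "L2_norm \<Omega> F \<ge> 0"
  by (simp add: L2_norm_def)

lemma L2_inner_integrable:
  assumes "F \<in> L2 \<Omega>" "G \<in> L2 \<Omega>"
  shows "integrable (lebesgue_on \<Omega>) (\<lambda>x. cdot (F x) (G x))"
  by (rule sq_integrable_bilinear[OF bounded_bilinear_cdot]) (use assms in \<open>simp_all add: L2_iff_sq_integrable\<close>)

lemma L2_inner_add_left:
  assumes "F \<in> L2 \<Omega>" "G \<in> L2 \<Omega>" "K \<in> L2 \<Omega>"
  shows "L2_inner \<Omega> (\<lambda>x. F x + G x) K = L2_inner \<Omega> F K + L2_inner \<Omega> G K"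
  using assms by (simp add: L2_inner_def cdot.add_left L2_inner_integrable)

lemma L2_inner_diff_left:
  assumes "F \<in> L2 \<Omega>" "G \<in> L2 \<Omega>" "K \<in> L2 \<Omega>"
  shows "L2_inner \<Omega> (\<lambda>x. F x - G x) K = L2_inner \<Omega> F K - L2_inner \<Omega> G K"
  using assms by (simp add: L2_inner_def cdot.diff_left L2_inner_integrable)

lemma L2_inner_cnj: "L2_inner \<Omega> F G = cnj (L2_inner \<Omega> G F)"
proof -
  have "L2_inner \<Omega> F G = (LINT x|lebesgue_on \<Omega>. cnj (cdot (G x) (F x)))"
    by (simp add: L2_inner_def cdot_cnj)
  then show ?thesis by (simp add: L2_inner_def)
qed

lemma L2_inner_add_right:
  assumes "F \<in> L2 \<Omega>" "G \<in> L2 \<Omega>" "K \<in> L2 \<Omega>"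
  shows "L2_inner \<Omega> K (\<lambda>x. F x + G x) = L2_inner \<Omega> K F + L2_inner \<Omega> K G"
  using assms by (simp add: L2_inner_def cdot.add_right L2_inner_integrable)

lemma L2_inner_diff_right:
  assumes "F \<in> L2 \<Omega>" "G \<in> L2 \<Omega>" "K \<in> L2 \<Omega>"
  shows "L2_inner \<Omega> K (\<lambda>x. F x - G x) = L2_inner \<Omega> K F - L2_inner \<Omega> K G"
  using assms by (simp add: L2_inner_def cdot.diff_right L2_inner_integrable)

lemma L2_inner_scalar_left: "L2_inner \<Omega> (\<lambda>x. c *s F x) G = c * L2_inner \<Omega> F G"
  by (simp add: L2_inner_def cdot_scalar_left)

lemma L2_inner_scalar_right: "L2_inner \<Omega> F (\<lambda>x. c *s G x) = cnj c * L2_inner \<Omega> F G"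
  by (simp add: L2_inner_def cdot_scalar_right)

lemma L2_inner_coeff: "L2_inner \<Omega> (\<lambda>x. c x *s F x) G = L2_inner \<Omega> F (\<lambda>x. cnj (c x) *s G x)"
  by (simp add: L2_inner_def cdot_scalar_left cdot_scalar_right)

lemma L2_inner_self: "L2_inner \<Omega> F F = of_real ((L2_norm \<Omega> F)\<^sup>2)"
proof -
  have "L2_inner \<Omega> F F = of_real (LINT x|lebesgue_on \<Omega>. (norm (F x))\<^sup>2)"
    by (simp add: L2_inner_def cdot_self del: of_real_power)
  then show ?thesis by (simp add: L2_norm_def)
qed

lemma L2_inner_bound:
  assumes "F \<in> L2 \<Omega>" "G \<in> L2 \<Omega>"
  shows "cmod (L2_inner \<Omega> F G) \<le> L2_norm \<Omega> F * L2_norm \<Omega> G"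
proof -
  have "sq_integrable (lebesgue_on \<Omega>) F" "sq_integrable (lebesgue_on \<Omega>) G"
    using assms by (simp_all add: L2_iff_sq_integrable)
  from norm_integral_bilinear_le[OF bounded_bilinear_cdot this, of 1] show ?thesis
    by (simp add: L2_inner_def L2_norm_def norm_cdot_le)
qed

lemma L2_inner_null_right:
  assumes "F \<in> L2 \<Omega>" "G \<in> L2 \<Omega>" "L2_norm \<Omega> G = 0"
  shows "L2_inner \<Omega> F G = 0"
  using L2_inner_bound[OF assms(1,2)] assms(3) by simp

lemma L2_norm_cong_AE:
  assumes "F \<in> L2 \<Omega>" "G \<in> L2 \<Omega>" "AE x in lebesgue_on \<Omega>. F x = G x"
  shows "L2_norm \<Omega> F = L2_norm \<Omega> G"
proof -
  have [measurable]: "F \<in> borel_measurable (lebesgue_on \<Omega>)" "G \<in> borel_measurable (lebesgue_on \<Omega>)"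
    using assms by (simp_all add: L2_def)
  have "(LINT x|lebesgue_on \<Omega>. (norm (F x))\<^sup>2) = (LINT x|lebesgue_on \<Omega>. (norm (G x))\<^sup>2)"
    by (rule integral_cong_AE) (use assms(3) in \<open>auto elim!: eventually_mono\<close>)
  then show ?thesis by (simp add: L2_norm_def)
qed

lemma L2_inner_cong_AE_left:
  assumes "F \<in> L2 \<Omega>" "G \<in> L2 \<Omega>" "K \<in> L2 \<Omega>" "AE x in lebesgue_on \<Omega>. F x = G x"
  shows "L2_inner \<Omega> F K = L2_inner \<Omega> G K"
  unfolding L2_inner_def
proof (rule integral_cong_AE)
  show "AE x in lebesgue_on \<Omega>. cdot (F x) (K x) = cdot (G x) (K x)"
    using assms(4) by eventually_elim simp
qed (use L2_inner_integrable[THEN borel_measurable_integrable] assms in blast)+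

lemma L2_inner_cong_AE_right:
  assumes "F \<in> L2 \<Omega>" "G \<in> L2 \<Omega>" "K \<in> L2 \<Omega>" "AE x in lebesgue_on \<Omega>. F x = G x"
  shows "L2_inner \<Omega> K F = L2_inner \<Omega> K G"
  using L2_inner_cong_AE_left[OF assms] by (simp add: L2_inner_cnj[of \<Omega> K])

lemma L2_norm_triangle:
  assumes "F \<in> L2 \<Omega>" "G \<in> L2 \<Omega>"
  shows "L2_norm \<Omega> (\<lambda>x. F x + G x) \<le> L2_norm \<Omega> F + L2_norm \<Omega> G"
proof -
  have "(L2_norm \<Omega> (\<lambda>x. F x + G x))\<^sup>2 =
      Re (L2_inner \<Omega> (\<lambda>x. F x + G x) (\<lambda>x. F x + G x))" by (simp add: L2_inner_self)
  also have "\<dots> = Re (L2_inner \<Omega> F F) + Re (L2_inner \<Omega> F G) + Re (L2_inner \<Omega> G F) + Re (L2_inner \<Omega> G G)"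
    using assms by (simp add: L2_inner_add_left L2_inner_add_right L2_add)
  also have "\<dots> \<le> (L2_norm \<Omega> F)\<^sup>2 + L2_norm \<Omega> F * L2_norm \<Omega> G + L2_norm \<Omega> G * L2_norm \<Omega> F + (L2_norm \<Omega> G)\<^sup>2"
    using order_trans[OF complex_Re_le_cmod L2_inner_bound[OF assms]]
      order_trans[OF complex_Re_le_cmod L2_inner_bound[OF assms(2,1)]]
    by (simp add: L2_inner_self mult.commute[of "L2_norm \<Omega> G"])
  also have "\<dots> = (L2_norm \<Omega> F + L2_norm \<Omega> G)\<^sup>2" by (simp add: power2_eq_square algebra_simps)
  finally show ?thesis
    by (rule power2_le_imp_le) (simp add: L2_norm_nonneg)
qed

lemma L2_norm_minus: "L2_norm \<Omega> (\<lambda>x. - F x) = L2_norm \<Omega> F"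
  by (simp add: L2_norm_def)

lemma L2_uminus: "F \<in> L2 \<Omega> \<Longrightarrow> (\<lambda>x. - F x) \<in> L2 \<Omega>"
  by (simp add: L2_def)

lemma L2_norm_triangle_diff:
  assumes "F \<in> L2 \<Omega>" "G \<in> L2 \<Omega>"
  shows "L2_norm \<Omega> (\<lambda>x. F x - G x) \<le> L2_norm \<Omega> F + L2_norm \<Omega> G"
  using L2_norm_triangle[OF assms(1) L2_uminus[OF assms(2)]] by (simp add: L2_norm_minus)

text \<open>An essentially bounded multiplier; \<open>B\<close> is then a bound for its operator norm on \<open>L\<^sup>2\<close>.\<close>

definition bounded_coeff :: "(real^3) set \<Rightarrow> real \<Rightarrow> (real^3 \<Rightarrow> complex) \<Rightarrow> bool" where
  "bounded_coeff \<Omega> B c \<longleftrightarrow> c \<in> borel_measurable (lebesgue_on \<Omega>) \<and> (AE x in lebesgue_on \<Omega>. cmod (c x) \<le> B)"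

lemma borel_measurable_scalar_mult:
  assumes [measurable]: "c \<in> borel_measurable M" "F \<in> borel_measurable M"
  shows "(\<lambda>x. c x *s (F x :: complex^3)) \<in> borel_measurable M"
proof -
  have "bilinear ((*s) :: complex \<Rightarrow> complex^3 \<Rightarrow> complex^3)"
    unfolding bilinear_def by (auto intro!: linearI simp: vec_eq_iff algebra_simps)
  then have pr: "bounded_bilinear ((*s) :: complex \<Rightarrow> complex^3 \<Rightarrow> complex^3)"
    by (simp add: bilinear_conv_bounded_bilinear)
  have [measurable]: "(\<lambda>p. fst p *s (snd p :: complex^3)) \<in> borel_measurable borel"
    by (intro borel_measurable_continuous_onI bounded_bilinear.continuous_on[OF pr] continuous_intros)
  show ?thesis
    using measurable_compose[of "\<lambda>x. (c x, F x)" M borel "\<lambda>p. fst p *s (snd p :: complex^3)" borel] by simp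
qed

lemma
  assumes c: "bounded_coeff \<Omega> B c" and F: "F \<in> L2 \<Omega>"
  shows L2_coeff: "(\<lambda>x. c x *s F x) \<in> L2 \<Omega>"
    and L2_norm_coeff_le: "B \<ge> 0 \<Longrightarrow> L2_norm \<Omega> (\<lambda>x. c x *s F x) \<le> B * L2_norm \<Omega> F"
proof -
  have le: "AE x in lebesgue_on \<Omega>. norm (c x *s F x) \<le> B * norm (F x)"
    using c unfolding bounded_coeff_def norm_vector_scalar_mult
    by (auto elim!: eventually_mono intro: mult_right_mono)
  show L2: "(\<lambda>x. c x *s F x) \<in> L2 \<Omega>"
    unfolding L2_iff_sq_integrable
    by (rule sq_integrable_bound[OF _ _ le])
      (use c F in \<open>auto simp: L2_iff_sq_integrable bounded_coeff_def sq_integrable_def intro: borel_measurable_scalar_mult\<close>)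
  assume B: "B \<ge> 0"
  have "(LINT x|lebesgue_on \<Omega>. (norm (c x *s F x))\<^sup>2) \<le> (LINT x|lebesgue_on \<Omega>. B\<^sup>2 * (norm (F x))\<^sup>2)"
  proof (rule integral_mono_AE)
    show "AE x in lebesgue_on \<Omega>. (norm (c x *s F x))\<^sup>2 \<le> B\<^sup>2 * (norm (F x))\<^sup>2"
      using le by eventually_elim (metis norm_ge_zero power_mono power_mult_distrib)
  qed (use L2 F in \<open>auto simp: L2_def\<close>)
  then have "sqrt (LINT x|lebesgue_on \<Omega>. (norm (c x *s F x))\<^sup>2) \<le> sqrt (B\<^sup>2 * (LINT x|lebesgue_on \<Omega>. (norm (F x))\<^sup>2))"
    by simp
  then show "L2_norm \<Omega> (\<lambda>x. c x *s F x) \<le> B * L2_norm \<Omega> F"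
    using B by (simp add: L2_norm_def real_sqrt_mult)
qed

lemma bounded_coeff_const: "bounded_coeff \<Omega> (cmod c) (\<lambda>x. c)"
  by (simp add: bounded_coeff_def)

lemma bounded_coeff_mult_const:
  assumes "bounded_coeff \<Omega> B f"
  shows "bounded_coeff \<Omega> (cmod c * B) (\<lambda>x. c * f x)"
  unfolding bounded_coeff_def
proof
  show "(\<lambda>x. c * f x) \<in> borel_measurable (lebesgue_on \<Omega>)"
    using assms borel_measurable_times[OF borel_measurable_const] by (auto simp: bounded_coeff_def)
  have "AE x in lebesgue_on \<Omega>. cmod (f x) \<le> B" using assms by (simp add: bounded_coeff_def)
  then show "AE x in lebesgue_on \<Omega>. cmod (c * f x) \<le> cmod c * B"
    by eventually_elim (simp add: norm_mult mult_left_mono)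
qed

lemma L2_scalar: "F \<in> L2 \<Omega> \<Longrightarrow> (\<lambda>x. c *s F x) \<in> L2 \<Omega>"
  by (rule L2_coeff[OF bounded_coeff_const])


section \<open>The weak curl as a linear operator\<close>

lemma sq_integrable_lborel_imp_L2:
  assumes "open \<Omega>" and F: "sq_integrable lborel F"
  shows "F \<in> L2 \<Omega>"
proof -
  have "F \<in> borel_measurable borel" "integrable lborel (\<lambda>x. (norm (F x))\<^sup>2)"
    using F by (simp_all add: sq_integrable_def)
  then have "F \<in> borel_measurable lebesgue" "integrable lebesgue (\<lambda>x. (norm (F x))\<^sup>2)"
    by (simp_all add: measurable_completion integrable_completion)
  moreover from this have "integrable lebesgue (\<lambda>x. indicator \<Omega> x *\<^sub>R (norm (F x))\<^sup>2)"
    using \<open>open \<Omega>\<close> by (intro integrable_mult_indicator) auto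
  ultimately show ?thesis
    using \<open>open \<Omega>\<close> integrable_restrict_space[of \<Omega> lebesgue "\<lambda>x. (norm (F x))\<^sup>2"]
    by (simp add: L2_def measurable_restrict_space1)
qed

lemma continuous_imp_L2:
  assumes "open \<Omega>" "bounded \<Omega>" and \<phi>: "continuous_on UNIV \<phi>"
  shows "\<phi> \<in> L2 \<Omega>"
proof -
  obtain R where R: "\<Omega> \<subseteq> ball 0 R"
    using bounded_subset_ballD[OF \<open>bounded \<Omega>\<close>] by blast
  define g where "g x = max 0 (min 1 (R + 1 - norm x)) *\<^sub>R \<phi> x" for x
  have "sq_integrable lborel g"
  proof (rule continuous_compact_sq_integrable[of g "R + 1"])
    show "continuous_on UNIV g" unfolding g_def by (intro continuous_intros \<phi>)
    show "g x = 0" if "norm x > R + 1" for x using that by (simp add: g_def)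
  qed
  then have "integrable (lebesgue_on \<Omega>) (\<lambda>x. (norm (g x))\<^sup>2)"
    using sq_integrable_lborel_imp_L2[OF \<open>open \<Omega>\<close>] by (simp add: L2_def)
  also have "?this \<longleftrightarrow> integrable (lebesgue_on \<Omega>) (\<lambda>x. (norm (\<phi> x))\<^sup>2)"
    using R by (intro Bochner_Integration.integrable_cong refl) (auto simp: g_def subset_iff)
  finally show ?thesis
    using continuous_borel_lebesgue_on[OF \<phi>] by (simp add: L2_def)
qed

lemma test_field_support:
  assumes "\<phi> \<in> test_fields \<Omega>"
  obtains R where "C_infinity \<phi>" "\<And>x. norm x > R \<Longrightarrow> \<phi> x = 0" "\<And>x. x \<notin> \<Omega> \<Longrightarrow> \<phi> x = 0"
proof -
  have "bounded (closure {x. \<phi> x \<noteq> 0})"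
    using assms by (auto simp: test_fields_def intro: compact_imp_bounded)
  from bounded_subset_ballD[OF this, of 0] obtain R where R: "closure {x. \<phi> x \<noteq> 0} \<subseteq> ball 0 R"
    by blast
  have sub: "x \<in> closure {x. \<phi> x \<noteq> 0}" if "\<phi> x \<noteq> 0" for x
    using that closure_subset[of "{x. \<phi> x \<noteq> 0}"] by blast
  show thesis
  proof (rule that)
    show "C_infinity \<phi>" using assms by (simp add: test_fields_def)
    show "\<phi> x = 0" if "norm x > R" for x
    proof (rule ccontr)
      assume "\<phi> x \<noteq> 0"
      then have "x \<in> ball 0 R" using sub R by blast
      then show False using that by simp
    qed
    show "\<phi> x = 0" if "x \<notin> \<Omega>" for x
      using that sub[of x] assms by (auto simp: test_fields_def)
  qed
qed

lemma test_field_L2: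
  assumes "open \<Omega>" "\<phi> \<in> test_fields \<Omega>"
  shows "\<phi> \<in> L2 \<Omega>" "zero_ext \<Omega> \<phi> \<phi>"
proof -
  obtain R where \<phi>: "C_infinity \<phi>" "\<And>x. norm x > R \<Longrightarrow> \<phi> x = 0" "\<And>x. x \<notin> \<Omega> \<Longrightarrow> \<phi> x = 0"
    using test_field_support[OF assms(2)] by blast
  have "sq_integrable lborel \<phi>"
    by (rule continuous_compact_sq_integrable[OF C_infinity_continuous_on[OF \<phi>(1)] \<phi>(2)])
  then show "\<phi> \<in> L2 \<Omega>" "zero_ext \<Omega> \<phi> \<phi>"
    using sq_integrable_lborel_imp_L2[OF assms(1)] \<phi>(3) by (auto simp: zero_ext_def)
qed

lemma classical_curl_test_field:
  assumes "\<phi> \<in> test_fields \<Omega>"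
  shows "classical_curl \<phi> \<in> test_fields \<Omega>"
proof -
  have "classical_curl \<phi> x = 0" if x: "x \<notin> closure {x. \<phi> x \<noteq> 0}" for x
  proof -
    have "frechet_derivative (\<lambda>x. 0) (at x) = frechet_derivative \<phi> (at x)"
      using x closure_subset[of "{x. \<phi> x \<noteq> 0}"]
      by (intro frechet_derivative_transform_within_open[where X = "- closure {x. \<phi> x \<noteq> 0}"]) auto
    then have "partial j \<phi> x = 0" for j
      by (metis frechet_derivative_const partial_def)
    then show ?thesis
      by (simp add: classical_curl_eq_sum rcross.zero_right)
  qed
  then have sub: "closure {x. classical_curl \<phi> x \<noteq> 0} \<subseteq> closure {x. \<phi> x \<noteq> 0}"
    by (intro closure_minimal closed_closure) blast
  moreover have comp: "compact (closure {x. \<phi> x \<noteq> 0})" using assms by (simp add: test_fields_def)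
  ultimately have "compact (closure {x. classical_curl \<phi> x \<noteq> 0})"
    using bounded_subset[OF compact_imp_bounded[OF comp] sub] by (simp add: compact_eq_bounded_closed)
  then show ?thesis
    using assms sub C_infinity_classical_curl by (auto simp: test_fields_def)
qed

lemma weak_curl_unique:
  assumes \<Omega>: "open \<Omega>" and G: "is_weak_curl \<Omega> E G" and G': "is_weak_curl \<Omega> E G'"
  shows "AE x in lebesgue_on \<Omega>. G x = G' x"
proof -
  have L2: "G \<in> L2 \<Omega>" "G' \<in> L2 \<Omega>" using G G' by (auto simp: is_weak_curl_def)
  have "AE x in lebesgue_on \<Omega>. G x - G' x = 0"
  proof (rule L2_zero_if_orthogonal_to_test_fields[OF \<Omega> L2_diff[OF L2]])
    fix \<phi> assume \<phi>: "\<phi> \<in> test_fields \<Omega>"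
    then show "L2_inner \<Omega> (\<lambda>x. G x - G' x) \<phi> = 0"
      using G G' by (simp add: L2_inner_diff_left L2 test_field_L2(1)[OF \<Omega>] is_weak_curl_def)
  qed
  then show ?thesis by eventually_elim simp
qed

lemma curl_eq_weak_curl:
  assumes "open \<Omega>" "E \<in> L2 \<Omega>" "is_weak_curl \<Omega> E G"
  shows "E \<in> Hcurl \<Omega>" "AE x in lebesgue_on \<Omega>. curl \<Omega> E x = G x"
proof -
  show E: "E \<in> Hcurl \<Omega>" using assms by (auto simp: Hcurl_def)
  show "AE x in lebesgue_on \<Omega>. curl \<Omega> E x = G x"
    by (rule weak_curl_unique[OF assms(1) is_weak_curl_curl[OF E] assms(3)])
qed

lemma Hcurl_L2: "E \<in> Hcurl \<Omega> \<Longrightarrow> E \<in> L2 \<Omega>"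
  by (simp add: Hcurl_def)

lemma Hcurl0_Hcurl: "E \<in> Hcurl0 \<Omega> \<Longrightarrow> E \<in> Hcurl \<Omega>"
  by (simp add: Hcurl0_def)

lemma
  assumes \<Omega>: "open \<Omega>" and E: "E \<in> Hcurl \<Omega>" and F: "F \<in> Hcurl \<Omega>"
  shows Hcurl_add: "(\<lambda>x. E x + F x) \<in> Hcurl \<Omega>"
    and curl_add: "AE x in lebesgue_on \<Omega>. curl \<Omega> (\<lambda>x. E x + F x) x = curl \<Omega> E x + curl \<Omega> F x"
proof -
  note L = Hcurl_L2[OF E] Hcurl_L2[OF F] curl_in_L2[OF E] curl_in_L2[OF F]
  have "is_weak_curl \<Omega> (\<lambda>x. E x + F x) (\<lambda>x. curl \<Omega> E x + curl \<Omega> F x)"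
    unfolding is_weak_curl_def
  proof (intro conjI ballI L2_add L)
    fix \<phi> assume \<phi>: "\<phi> \<in> test_fields \<Omega>"
    note L' = test_field_L2(1)[OF \<Omega> \<phi>] test_field_L2(1)[OF \<Omega> classical_curl_test_field[OF \<phi>]]
    show "L2_inner \<Omega> (\<lambda>x. E x + F x) (classical_curl \<phi>) = L2_inner \<Omega> (\<lambda>x. curl \<Omega> E x + curl \<Omega> F x) \<phi>"
      using is_weak_curl_curl[OF E] is_weak_curl_curl[OF F] \<phi>
      by (simp add: L2_inner_add_left L L' is_weak_curl_def)
  qed
  from curl_eq_weak_curl[OF \<Omega> L2_add[OF L(1,2)] this]
  show "(\<lambda>x. E x + F x) \<in> Hcurl \<Omega>"
    "AE x in lebesgue_on \<Omega>. curl \<Omega> (\<lambda>x. E x + F x) x = curl \<Omega> E x + curl \<Omega> F x" by auto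
qed

lemma
  assumes \<Omega>: "open \<Omega>" and E: "E \<in> Hcurl \<Omega>"
  shows Hcurl_scalar: "(\<lambda>x. c *s E x) \<in> Hcurl \<Omega>"
    and curl_scalar: "AE x in lebesgue_on \<Omega>. curl \<Omega> (\<lambda>x. c *s E x) x = c *s curl \<Omega> E x"
proof -
  note L = Hcurl_L2[OF E] curl_in_L2[OF E]
  have "is_weak_curl \<Omega> (\<lambda>x. c *s E x) (\<lambda>x. c *s curl \<Omega> E x)"
    using is_weak_curl_curl[OF E] L2_scalar[OF L(2)] by (simp add: is_weak_curl_def L2_inner_scalar_left)
  from curl_eq_weak_curl[OF \<Omega> L2_scalar[OF L(1)] this]
  show "(\<lambda>x. c *s E x) \<in> Hcurl \<Omega>"
    "AE x in lebesgue_on \<Omega>. curl \<Omega> (\<lambda>x. c *s E x) x = c *s curl \<Omega> E x" by auto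
qed

lemma
  assumes \<Omega>: "open \<Omega>" "bounded \<Omega>" and \<phi>: "\<phi> \<in> test_fields \<Omega>"
  shows test_field_Hcurl0: "\<phi> \<in> Hcurl0 \<Omega>"
    and curl_test_field: "AE x in lebesgue_on \<Omega>. curl \<Omega> \<phi> x = classical_curl \<phi> x"
proof -
  obtain R where C: "C_infinity \<phi>" and R: "\<And>x. norm x > R \<Longrightarrow> \<phi> x = 0"
    and "\<And>x. x \<notin> \<Omega> \<Longrightarrow> \<phi> x = 0"
    using test_field_support[OF \<phi>] by blast
  note L = test_field_L2[OF \<Omega>(1) \<phi>] and L' = test_field_L2[OF \<Omega>(1) classical_curl_test_field[OF \<phi>]]
  have green: "L2_inner \<Omega> (classical_curl \<phi>) \<psi> = L2_inner \<Omega> \<phi> (classical_curl \<psi>)" if \<psi>: "C_infinity \<psi>" for \<psi>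
    using integral_curl_by_parts[OF C R \<psi>] L2_inner_zero_ext_smooth[OF \<Omega>(1) L' \<psi>]
      L2_inner_zero_ext_smooth[OF \<Omega>(1) L C_infinity_classical_curl[OF \<psi>]] by simp
  have "is_weak_curl \<Omega> \<phi> (classical_curl \<phi>)"
    unfolding is_weak_curl_def using L'(1) green by (auto simp: test_fields_def)
  note curl = curl_eq_weak_curl[OF \<Omega>(1) L(1) this]
  show "AE x in lebesgue_on \<Omega>. curl \<Omega> \<phi> x = classical_curl \<phi> x" by (rule curl(2))
  have "tangential_trace \<Omega> \<phi> \<psi> = 0" if \<psi>: "C_infinity \<psi>" for \<psi>
    using L2_inner_cong_AE_left[OF curl_in_L2[OF curl(1)] L'(1)
        continuous_imp_L2[OF \<Omega> C_infinity_continuous_on[OF \<psi>]] curl(2)] green[OF \<psi>]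
    by (simp add: tangential_trace_def)
  then show "\<phi> \<in> Hcurl0 \<Omega>" using curl(1) by (simp add: Hcurl0_def)
qed

lemma nonzero_test_field:
  assumes \<Omega>: "open \<Omega>" "\<Omega> \<noteq> {}"
  obtains \<phi> where "\<phi> \<in> test_fields \<Omega>" "L2_norm \<Omega> \<phi> \<noteq> 0"
proof -
  obtain c r where r: "r > 0" "cball c r \<subseteq> \<Omega>"
    using \<Omega> by (meson ex_in_conv open_contains_cball)
  from mollifier_exists[OF r(1) order_refl, of c] obtain k :: "real^3 \<Rightarrow> real"
    where k: "mollifier (norm c + r) k" "\<And>z. k z \<noteq> 0 \<Longrightarrow> z \<in> ball c r" by blast
  define \<phi> :: field3 where "\<phi> x = k x *\<^sub>R axis 1 1" for x
  have kC: "C_infinity k" using k(1) by (simp add: mollifier_def test_kernel_def)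
  have sub: "closure {x. \<phi> x \<noteq> 0} \<subseteq> cball c r"
  proof (intro closure_minimal closed_cball subsetI)
    fix x assume "x \<in> {x. \<phi> x \<noteq> 0}"
    then have "k x \<noteq> 0" by (simp add: \<phi>_def)
    from k(2)[OF this] show "x \<in> cball c r" by simp
  qed
  have "bounded (closure {x. \<phi> x \<noteq> 0})" using sub bounded_subset bounded_cball by blast
  then have \<phi>: "\<phi> \<in> test_fields \<Omega>"
    using sub r(2) C_infinity_scaleR[OF kC C_infinity_const, of "axis 1 1 :: complex^3"]
    by (auto simp: test_fields_def \<phi>_def[abs_def] compact_eq_bounded_closed)
  have norm_\<phi>: "norm (\<phi> x) = \<bar>k x\<bar>" for x by (simp add: \<phi>_def)
  have "L2_norm \<Omega> \<phi> \<noteq> 0"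
  proof
    assume "L2_norm \<Omega> \<phi> = 0"
    then have "L2_inner \<Omega> \<phi> \<phi> = 0" by (simp add: L2_inner_self)
    then have "(LINT x|lborel. cdot (\<phi> x) (\<phi> x)) = 0"
      using L2_inner_zero_ext_smooth[OF \<Omega>(1) test_field_L2[OF \<Omega>(1) \<phi>], of \<phi>] \<phi> by (simp add: test_fields_def)
    then have "(LINT x|lborel. (k x)\<^sup>2) = 0" by (simp add: cdot_self norm_\<phi> del: of_real_power)
    moreover have "integrable lborel (\<lambda>x. (norm (\<phi> x))\<^sup>2)"
      using test_field_L2(2)[OF \<Omega>(1) \<phi>] by (simp add: zero_ext_def sq_integrable_def)
    ultimately have "AE x in lborel. (k x)\<^sup>2 = 0"
      using integral_nonneg_eq_0_iff_AE[of lborel "\<lambda>x. (k x)\<^sup>2"] by (simp add: norm_\<phi>)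
    then have "AE x in lborel. k x = 0" by eventually_elim simp
    then have "integral\<^sup>L lborel k = 0" by (rule integral_eq_zero_AE)
    then show False using k(1) by (simp add: mollifier_def)
  qed
  then show thesis using \<phi> that by blast
qed


section \<open>Piecewise constant coefficients\<close>

text \<open>
  The frontier of a simplex is a null set, so almost every point of \<open>\<Omega>\<close> lies in the interior of an
  element, and in only one. Measurability follows because Lebesgue measure is complete.
\<close>

lemma piecewise_constant_bounds:
  assumes \<Omega>: "open \<Omega>" "\<Omega> \<noteq> {}" and mesh: "tetrahedral_mesh \<T> \<Omega>" and pc: "piecewise_constant_pos \<T> \<mu>"
  shows "\<mu> \<in> borel_measurable (lebesgue_on \<Omega>)"
    and "\<exists>m>0. \<exists>B. AE x in lebesgue_on \<Omega>. m \<le> \<mu> x \<and> \<mu> x \<le> B"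
proof -
  have fin: "finite \<T>" and simplex: "\<And>K. K \<in> \<T> \<Longrightarrow> 3 simplex K"
    and disj: "pairwise (\<lambda>K K'. interior K \<inter> interior K' = {}) \<T>" and cover: "\<Union>\<T> = closure \<Omega>"
    using mesh by (auto simp: tetrahedral_mesh_def)
  obtain c where c: "\<And>K. K \<in> \<T> \<Longrightarrow> c K > 0" "\<And>K x. K \<in> \<T> \<Longrightarrow> x \<in> interior K \<Longrightarrow> \<mu> x = c K"
    using pc unfolding piecewise_constant_pos_def by metis
  have S: "\<Omega> \<inter> space lebesgue \<in> sets lebesgue" using \<Omega> by simp
  have "negligible (\<Union>K\<in>\<T>. frontier K)"
    using fin simplex by (intro negligible_Union) (auto intro!: negligible_convex_frontier convex_simplex)
  then have "AE x in lebesgue. x \<notin> (\<Union>K\<in>\<T>. frontier K)"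
    by (intro AE_not_in) (simp add: negligible_iff_null_sets)
  then have cell: "AE x in lebesgue. x \<in> \<Omega> \<longrightarrow> (\<exists>K\<in>\<T>. x \<in> interior K)"
  proof eventually_elim
    case (elim x)
    show ?case
    proof
      assume "x \<in> \<Omega>"
      then obtain K where K: "K \<in> \<T>" "x \<in> K" using cover closure_subset by blast
      then have "x \<in> interior K" using elim closure_subset[of K] by (auto simp: frontier_def)
      then show "\<exists>K\<in>\<T>. x \<in> interior K" using K by blast
    qed
  qed
  define \<nu> where "\<nu> x = (\<Sum>K\<in>\<T>. indicator (interior K) x * c K)" for x
  have \<nu>: "\<nu> x = \<mu> x" if "K \<in> \<T>" "x \<in> interior K" for K x
  proof -
    have "\<nu> x = (\<Sum>K'\<in>\<T>. if K' = K then c K else 0)"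
      unfolding \<nu>_def
    proof (rule sum.cong[OF refl])
      fix K' assume "K' \<in> \<T>"
      then have "x \<notin> interior K'" if "K' \<noteq> K"
        using disj \<open>K \<in> \<T>\<close> \<open>x \<in> interior K\<close> that unfolding pairwise_def by blast
      then show "indicator (interior K') x * c K' = (if K' = K then c K else 0)"
        using \<open>x \<in> interior K\<close> by auto
    qed
    then show ?thesis using that c(2) fin by simp
  qed
  have "AE x in lebesgue. indicator \<Omega> x * \<nu> x = indicator \<Omega> x * \<mu> x"
    using cell by eventually_elim (auto simp: \<nu> indicator_def)
  moreover have "(\<lambda>x. indicator \<Omega> x * \<nu> x) \<in> borel_measurable lebesgue"
  proof -
    have [measurable]: "\<Omega> \<in> sets borel" using \<Omega> by simp
    have "(\<lambda>x. indicator \<Omega> x * \<nu> x) \<in> borel_measurable borel" unfolding \<nu>_def by measurable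
    then show ?thesis by (simp add: measurable_completion)
  qed
  ultimately have "(\<lambda>x. indicator \<Omega> x *\<^sub>R \<mu> x) \<in> borel_measurable lebesgue"
    using borel_measurable_AE[of "\<lambda>x. indicator \<Omega> x * \<nu> x" "\<lambda>x. indicator \<Omega> x * \<mu> x"] by simp
  then show "\<mu> \<in> borel_measurable (lebesgue_on \<Omega>)"
    using borel_measurable_restrict_space_iff[OF S] by blast
  have "\<T> \<noteq> {}" using cover \<Omega>(2) closure_subset by blast
  have "AE x in lebesgue. x \<in> \<Omega> \<longrightarrow> Min (c ` \<T>) \<le> \<mu> x \<and> \<mu> x \<le> Max (c ` \<T>)"
    using cell by eventually_elim (use c(2) fin in auto)
  then have "AE x in lebesgue_on \<Omega>. Min (c ` \<T>) \<le> \<mu> x \<and> \<mu> x \<le> Max (c ` \<T>)"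
    by (subst AE_restrict_space_iff) (use S in auto)
  moreover have "Min (c ` \<T>) > 0" using fin \<open>\<T> \<noteq> {}\<close> c(1) by simp
  ultimately show "\<exists>m>0. \<exists>B. AE x in lebesgue_on \<Omega>. m \<le> \<mu> x \<and> \<mu> x \<le> B" by blast
qed


section \<open>Inf-sup conditions as a priori estimates\<close>

text \<open>
  An inf-sup condition is an a priori estimate: the norm of \<open>x\<close> is at most a constant times any bound
  \<open>M\<close> for the dual norm of the functional \<open>b x\<close>. In this form no suprema have to be handled.
\<close>

lemma inf_sup_imp_estimate:
  assumes "inf_sup X nX Y nY b" and nonneg: "\<And>y. nY y \<ge> 0"
  obtains K where "K > 0"
    "\<And>x M. x \<in> X \<Longrightarrow> (\<And>y. y \<in> Y \<Longrightarrow> cmod (b x y) \<le> M * nY y) \<Longrightarrow> nX x \<le> K * M"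
proof -
  obtain c where c: "c > 0"
    "\<And>x. x \<in> X \<Longrightarrow> ereal (c * nX x) \<le> (SUP y\<in>{y \<in> Y. nY y \<noteq> 0}. ereal (cmod (b x y) / nY y))"
    using assms(1) by (auto simp: inf_sup_def)
  have "nX x \<le> inverse c * M" if x: "x \<in> X" and M: "\<And>y. y \<in> Y \<Longrightarrow> cmod (b x y) \<le> M * nY y" for x M
  proof -
    have "(SUP y\<in>{y \<in> Y. nY y \<noteq> 0}. ereal (cmod (b x y) / nY y)) \<le> ereal M"
    proof (rule SUP_least)
      fix y assume "y \<in> {y \<in> Y. nY y \<noteq> 0}"
      then show "ereal (cmod (b x y) / nY y) \<le> ereal M"
        using M[of y] nonneg[of y] by (simp add: divide_le_eq)
    qed
    then have "c * nX x \<le> M" using order_trans[OF c(2)[OF x]] by fastforce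
    then show ?thesis using c(1) by (simp add: field_simps)
  qed
  then show thesis using that[of "inverse c"] c(1) by simp
qed

text \<open>
  The supremum ignores representatives of zero, hence the assumption \<open>null\<close>; the element \<open>y0\<close> keeps it
  from being a supremum over the empty set, which is \<open>-\<infinity>\<close>.
\<close>

lemma estimate_imp_inf_sup:
  assumes K: "K > 0" and nonneg: "\<And>y. nY y \<ge> 0" and y0: "y0 \<in> Y" "nY y0 \<noteq> 0"
    and null: "\<And>x y. x \<in> X \<Longrightarrow> y \<in> Y \<Longrightarrow> nY y = 0 \<Longrightarrow> b x y = 0"
    and est: "\<And>x M. x \<in> X \<Longrightarrow> M \<ge> 0 \<Longrightarrow> (\<And>y. y \<in> Y \<Longrightarrow> cmod (b x y) \<le> M * nY y) \<Longrightarrow> nX x \<le> K * M"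
  shows "inf_sup X nX Y nY b"
  unfolding inf_sup_def
proof (intro exI[of _ "inverse K"] conjI ballI)
  show "inverse K > 0" using K by simp
  fix x assume x: "x \<in> X"
  define s where "s = (SUP y\<in>{y \<in> Y. nY y \<noteq> 0}. ereal (cmod (b x y) / nY y))"
  have upper: "ereal (cmod (b x y) / nY y) \<le> s" if "y \<in> Y" "nY y \<noteq> 0" for y
    unfolding s_def by (rule SUP_upper) (use that in simp)
  have s0: "0 \<le> s"
    using order_trans[OF _ upper[OF y0], of 0] nonneg[of y0] by simp
  show "ereal (inverse K * nX x) \<le> s"
  proof (cases s)
    case (real M)
    have "nX x \<le> K * M"
    proof (rule est[OF x])
      show "M \<ge> 0" using s0 real by simp
      show "cmod (b x y) \<le> M * nY y" if "y \<in> Y" for y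
      proof (cases "nY y = 0")
        case True
        then show ?thesis using null[OF x that] by simp
      next
        case False
        then have "nY y > 0" using nonneg[of y] by simp
        then show ?thesis using upper[OF that False] real by (simp add: divide_le_eq)
      qed
    qed
    then show ?thesis using K real by (simp add: field_simps)
  qed (use s0 in auto)
qed

lemma Hcurl_norm_nonneg: "Hcurl_norm \<Omega> E \<ge> 0"
  by (simp add: Hcurl_norm_def)

lemma L2_norm_le_Hcurl_norm: "L2_norm \<Omega> E \<le> Hcurl_norm \<Omega> E"
  by (simp add: Hcurl_norm_def L2_norm_nonneg real_le_rsqrt)

lemma L2_norm_curl_le_Hcurl_norm: "L2_norm \<Omega> (curl \<Omega> E) \<le> Hcurl_norm \<Omega> E"
  by (simp add: Hcurl_norm_def L2_norm_nonneg real_le_rsqrt)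

lemma Hcurl_norm_0D:
  assumes "Hcurl_norm \<Omega> F = 0"
  shows "L2_norm \<Omega> F = 0" "L2_norm \<Omega> (curl \<Omega> F) = 0"
  using assms L2_norm_le_Hcurl_norm[of \<Omega> F] L2_norm_curl_le_Hcurl_norm[of \<Omega> F]
    L2_norm_nonneg[of \<Omega> F] L2_norm_nonneg[of \<Omega> "curl \<Omega> F"] by simp_all

lemma Hcurl_norm_le: "Hcurl_norm \<Omega> E \<le> L2_norm \<Omega> E + L2_norm \<Omega> (curl \<Omega> E)"
  unfolding Hcurl_norm_def by (rule sqrt_sum_squares_le_sum) (simp_all add: L2_norm_nonneg)

lemma prod_norm_nonneg: "prod_norm n m p \<ge> 0"
  by (simp add: prod_norm_def split: prod.split)

lemma fst_le_prod_norm: "n u \<le> prod_norm n m (u, v)"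
  by (simp add: prod_norm_def real_le_rsqrt)

lemma snd_le_prod_norm: "m v \<le> prod_norm n m (u, v)"
  by (simp add: prod_norm_def real_le_rsqrt)

lemma prod_norm_le: "n u \<ge> 0 \<Longrightarrow> m v \<ge> 0 \<Longrightarrow> prod_norm n m (u, v) \<le> n u + m v"
  by (simp add: prod_norm_def sqrt_sum_squares_le_sum)

lemma prod_norm_mono:
  "0 \<le> n u \<Longrightarrow> n u \<le> n' u \<Longrightarrow> 0 \<le> m v \<Longrightarrow> m v \<le> m' v \<Longrightarrow> prod_norm n m (u, v) \<le> prod_norm n' m' (u, v)"
  by (simp add: prod_norm_def add_mono power_mono)

lemma prod_norm_zero_left: "n u = 0 \<Longrightarrow> m v \<ge> 0 \<Longrightarrow> prod_norm n m (u, v) = m v"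
  by (simp add: prod_norm_def)

lemma prod_norm_zero_right: "m v = 0 \<Longrightarrow> n u \<ge> 0 \<Longrightarrow> prod_norm n m (u, v) = n u"
  by (simp add: prod_norm_def)

lemma prod_norm_eq_0_iff: "prod_norm n m (u, v) = 0 \<longleftrightarrow> n u = 0 \<and> m v = 0"
  by (simp add: prod_norm_def)

lemma L2_norm_le_of_self_bound:
  assumes "cmod (L2_inner \<Omega> F F) \<le> M * L2_norm \<Omega> F" "M \<ge> 0"
  shows "L2_norm \<Omega> F \<le> M"
proof (cases "L2_norm \<Omega> F = 0")
  case False
  then have "L2_norm \<Omega> F > 0" using L2_norm_nonneg[of \<Omega> F] by simp
  moreover have "cmod (L2_inner \<Omega> F F) = L2_norm \<Omega> F * L2_norm \<Omega> F"
    unfolding L2_inner_self norm_of_real by (simp add: power2_eq_square)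
  ultimately show ?thesis using assms(1) by simp
qed (use assms in simp)

lemma L2_inner_zero_left: "L2_inner \<Omega> (\<lambda>x. 0) F = 0"
  by (simp add: L2_inner_def cdot_3)

lemma L2_inner_zero_right: "L2_inner \<Omega> F (\<lambda>x. 0) = 0"
  by (simp add: L2_inner_def cdot_3)

lemma L2_norm_zero: "L2_norm \<Omega> (\<lambda>x. 0) = 0"
  by (simp add: L2_norm_def)

lemma zero_Hcurl0:
  assumes "open \<Omega>" "bounded \<Omega>"
  shows "(\<lambda>x. 0) \<in> Hcurl0 \<Omega>" "Hcurl_norm \<Omega> (\<lambda>x. 0) = 0"
proof -
  have 0: "(\<lambda>x. 0) \<in> test_fields \<Omega>" by (simp add: test_fields_def)
  show *: "(\<lambda>x. 0) \<in> Hcurl0 \<Omega>" by (rule test_field_Hcurl0[OF assms 0])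
  have "is_weak_curl \<Omega> (\<lambda>x. 0) (\<lambda>x. 0)" by (simp add: is_weak_curl_def L2_zero L2_inner_zero_left)
  note c = curl_eq_weak_curl[OF assms(1) L2_zero this]
  have "L2_norm \<Omega> (curl \<Omega> (\<lambda>x. 0)) = 0"
    using L2_norm_cong_AE[OF curl_in_L2[OF c(1)] L2_zero c(2)] by (simp add: L2_norm_zero)
  then show "Hcurl_norm \<Omega> (\<lambda>x. 0) = 0" by (simp add: Hcurl_norm_def L2_norm_zero)
qed


section \<open>Maxwell operators with bounded coefficients\<close>

text \<open>
  The sign of \<open>\<omega>\<close> is left open, because exchanging the two fields reverses it. One constant \<open>B\<close> bounds
  both coefficients and their reciprocals.
\<close>

locale maxwell =
  fixes \<Omega> :: "(real^3) set" and \<mu> \<epsilon> :: "real^3 \<Rightarrow> real" and \<omega> B :: real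
  assumes \<Omega>: "open \<Omega>" "bounded \<Omega>" and \<omega>: "\<omega> \<noteq> 0" and B: "B \<ge> 0"
    and \<mu>_bound: "bounded_coeff \<Omega> B (\<lambda>x. of_real (\<mu> x))" "bounded_coeff \<Omega> B (\<lambda>x. of_real (inverse (\<mu> x)))"
    and \<epsilon>_bound: "bounded_coeff \<Omega> B (\<lambda>x. of_real (\<epsilon> x))" "bounded_coeff \<Omega> B (\<lambda>x. of_real (inverse (\<epsilon> x)))"
    and nonzero: "AE x in lebesgue_on \<Omega>. \<mu> x \<noteq> 0" "AE x in lebesgue_on \<Omega>. \<epsilon> x \<noteq> 0"
begin

abbreviation i\<mu> :: "field3 \<Rightarrow> field3" where
  "i\<mu> F \<equiv> \<lambda>x. (\<i> * of_real \<omega> * of_real (\<mu> x)) *s F x"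

abbreviation i\<epsilon> :: "field3 \<Rightarrow> field3" where
  "i\<epsilon> F \<equiv> \<lambda>x. (\<i> * of_real \<omega> * of_real (\<epsilon> x)) *s F x"

lemma
  assumes F: "F \<in> L2 \<Omega>"
  shows L2_i\<mu>: "i\<mu> F \<in> L2 \<Omega>"
    and L2_i\<epsilon>: "i\<epsilon> F \<in> L2 \<Omega>"
    and norm_i\<mu>: "L2_norm \<Omega> (i\<mu> F) \<le> \<bar>\<omega>\<bar> * B * L2_norm \<Omega> F"
    and norm_i\<epsilon>: "L2_norm \<Omega> (i\<epsilon> F) \<le> \<bar>\<omega>\<bar> * B * L2_norm \<Omega> F"
    and L2_inv_\<mu>: "(\<lambda>x. inverse (\<mu> x) *\<^sub>R F x) \<in> L2 \<Omega>"
    and norm_inv_\<mu>: "L2_norm \<Omega> (\<lambda>x. inverse (\<mu> x) *\<^sub>R F x) \<le> B * L2_norm \<Omega> F"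
    and L2_\<epsilon>: "(\<lambda>x. \<epsilon> x *\<^sub>R F x) \<in> L2 \<Omega>"
  unfolding scaleR_conv_scalar_mult
  using L2_coeff[OF bounded_coeff_mult_const[OF \<mu>_bound(1), of "\<i> * of_real \<omega>"] F]
    L2_coeff[OF bounded_coeff_mult_const[OF \<epsilon>_bound(1), of "\<i> * of_real \<omega>"] F]
    L2_norm_coeff_le[OF bounded_coeff_mult_const[OF \<mu>_bound(1), of "\<i> * of_real \<omega>"] F]
    L2_norm_coeff_le[OF bounded_coeff_mult_const[OF \<epsilon>_bound(1), of "\<i> * of_real \<omega>"] F]
    L2_coeff[OF \<mu>_bound(2) F] L2_norm_coeff_le[OF \<mu>_bound(2) F]
    L2_coeff[OF \<epsilon>_bound(1) F] B
  by (simp_all add: norm_mult)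

text \<open>The residuals of Faraday's and Ampere's law in the first-order system.\<close>

definition faraday :: "field3 \<Rightarrow> field3 \<Rightarrow> field3" where
  "faraday H E = (\<lambda>x. (\<i> * of_real \<omega> * of_real (\<mu> x)) *s H x - curl \<Omega> E x)"

definition ampere :: "field3 \<Rightarrow> field3 \<Rightarrow> field3" where
  "ampere H E = (\<lambda>x. (\<i> * of_real \<omega> * of_real (\<epsilon> x)) *s E x + curl \<Omega> H x)"

lemma L2_faraday: "H \<in> L2 \<Omega> \<Longrightarrow> E \<in> Hcurl \<Omega> \<Longrightarrow> faraday H E \<in> L2 \<Omega>"
  unfolding faraday_def by (intro L2_diff L2_i\<mu> curl_in_L2)

lemma L2_ampere: "H \<in> Hcurl \<Omega> \<Longrightarrow> E \<in> L2 \<Omega> \<Longrightarrow> ampere H E \<in> L2 \<Omega>"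
  unfolding ampere_def by (intro L2_add L2_i\<epsilon> curl_in_L2)

text \<open>
  Express \<open>curl E\<close> through Faraday's law and \<open>\<epsilon> E\<close> through Ampere's law. The terms containing \<open>H\<close> cancel
  by Green's formula.
\<close>

lemma primal_form_residuals:
  assumes E: "E \<in> Hcurl \<Omega>" and H: "H \<in> Hcurl \<Omega>" and F: "F \<in> Hcurl \<Omega>"
    and green: "L2_inner \<Omega> (curl \<Omega> H) F = L2_inner \<Omega> H (curl \<Omega> F)"
  shows "b_E \<Omega> \<mu> \<epsilon> \<omega> E F =
    \<i> * of_real \<omega> * L2_inner \<Omega> (ampere H E) F - L2_inner \<Omega> (\<lambda>x. inverse (\<mu> x) *\<^sub>R faraday H E x) (curl \<Omega> F)"
proof -
  note L = Hcurl_L2[OF E] Hcurl_L2[OF H] Hcurl_L2[OF F] curl_in_L2[OF E] curl_in_L2[OF H] curl_in_L2[OF F]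
  note Lr = L2_faraday[OF L(2) E] L2_ampere[OF H L(1)]
  have "AE x in lebesgue_on \<Omega>. inverse (\<mu> x) *\<^sub>R curl \<Omega> E x =
      (\<i> * of_real \<omega>) *s H x - inverse (\<mu> x) *\<^sub>R faraday H E x"
    using nonzero(1)
    by eventually_elim (simp add: faraday_def scaleR_conv_scalar_mult vec_eq_iff field_simps)
  then have "L2_inner \<Omega> (\<lambda>x. inverse (\<mu> x) *\<^sub>R curl \<Omega> E x) (curl \<Omega> F) =
      L2_inner \<Omega> (\<lambda>x. (\<i> * of_real \<omega>) *s H x - inverse (\<mu> x) *\<^sub>R faraday H E x) (curl \<Omega> F)"
    by (intro L2_inner_cong_AE_left L2_inv_\<mu> L2_diff L2_scalar L Lr)
  also have "\<dots> = \<i> * of_real \<omega> * L2_inner \<Omega> H (curl \<Omega> F) -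
      L2_inner \<Omega> (\<lambda>x. inverse (\<mu> x) *\<^sub>R faraday H E x) (curl \<Omega> F)"
    by (simp add: L2_inner_diff_left L2_inner_scalar_left L2_scalar L2_inv_\<mu> L Lr)
  finally have 1: "L2_inner \<Omega> (\<lambda>x. inverse (\<mu> x) *\<^sub>R curl \<Omega> E x) (curl \<Omega> F) = \<dots>" .
  have eqE: "(\<lambda>x. \<epsilon> x *\<^sub>R E x) = (\<lambda>x. inverse (\<i> * of_real \<omega>) *s (ampere H E x - curl \<Omega> H x))"
    using \<omega> by (simp add: fun_eq_iff ampere_def scaleR_conv_scalar_mult vec_eq_iff field_simps)
  have 2: "L2_inner \<Omega> (\<lambda>x. \<epsilon> x *\<^sub>R E x) F =
      inverse (\<i> * of_real \<omega>) * (L2_inner \<Omega> (ampere H E) F - L2_inner \<Omega> H (curl \<Omega> F))"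
    unfolding eqE L2_inner_scalar_left by (simp only: L2_inner_diff_left[OF Lr(2) L(5) L(3)] green)
  have "complex_of_real (\<omega>\<^sup>2) * inverse (\<i> * of_real \<omega>) = - (\<i> * of_real \<omega>)"
    using \<omega> by (simp add: power2_eq_square)
  then show ?thesis
    unfolding b_E_def 1 2 mult.assoc[symmetric] by (simp add: algebra_simps)
qed

text \<open>
  The primal form tested against \<open>F\<close> only sees the two residuals of the first-order system, so a
  stable primal form controls \<open>E\<close> by the residuals; the equations themselves then control \<open>H\<close>.
\<close>

lemma primal_estimate_imp_strong_estimate:
  assumes P: "P \<subseteq> Hcurl \<Omega>" and Q: "Q \<subseteq> Hcurl \<Omega>"
    and green: "\<And>H F. H \<in> Q \<Longrightarrow> F \<in> P \<Longrightarrow> L2_inner \<Omega> (curl \<Omega> H) F = L2_inner \<Omega> H (curl \<Omega> F)"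
    and K1: "K1 > 0"
    and est: "\<And>E M. E \<in> P \<Longrightarrow> (\<And>F. F \<in> P \<Longrightarrow> cmod (b_E \<Omega> \<mu> \<epsilon> \<omega> E F) \<le> M * Hcurl_norm \<Omega> F) \<Longrightarrow>
      Hcurl_norm \<Omega> E \<le> K1 * M"
  obtains K where "K > 0" "\<And>E H. E \<in> P \<Longrightarrow> H \<in> Q \<Longrightarrow>
    Hcurl_norm \<Omega> H + Hcurl_norm \<Omega> E \<le> K * (L2_norm \<Omega> (faraday H E) + L2_norm \<Omega> (ampere H E))"
proof -
  \<comment> \<open>\<open>K2\<close> bounds \<open>E\<close>; the other two summands of \<open>K\<close> bound \<open>H\<close> and its curl.\<close>
  define K2 where "K2 = K1 * (\<bar>\<omega>\<bar> + B)"
  define K where "K = K2 + (B / \<bar>\<omega>\<bar>) * (1 + K2) + (1 + \<bar>\<omega>\<bar> * B * K2)"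
  have K2: "K2 \<ge> 0" using K1 B by (simp add: K2_def)
  have "(B / \<bar>\<omega>\<bar>) * (1 + K2) \<ge> 0" "\<bar>\<omega>\<bar> * B * K2 \<ge> 0" using K2 B by simp_all
  then have "K > 0" using K2 unfolding K_def by linarith
  moreover have "Hcurl_norm \<Omega> H + Hcurl_norm \<Omega> E \<le> K * (L2_norm \<Omega> (faraday H E) + L2_norm \<Omega> (ampere H E))"
    if EP: "E \<in> P" and HQ: "H \<in> Q" for E H
  proof -
    let ?r = "L2_norm \<Omega> (faraday H E)" and ?s = "L2_norm \<Omega> (ampere H E)"
    have E: "E \<in> Hcurl \<Omega>" and H: "H \<in> Hcurl \<Omega>" using EP HQ P Q by auto
    note L = Hcurl_L2[OF E] Hcurl_L2[OF H] curl_in_L2[OF E] curl_in_L2[OF H]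
    note Lr = L2_faraday[OF L(2) E] L2_ampere[OF H L(1)]
    have nn: "?r \<ge> 0" "?s \<ge> 0" by (simp_all add: L2_norm_nonneg)
    have "cmod (b_E \<Omega> \<mu> \<epsilon> \<omega> E F) \<le> ((\<bar>\<omega>\<bar> + B) * (?r + ?s)) * Hcurl_norm \<Omega> F" if FP: "F \<in> P" for F
    proof -
      have F: "F \<in> Hcurl \<Omega>" using FP P by auto
      have "cmod (b_E \<Omega> \<mu> \<epsilon> \<omega> E F) \<le> cmod (\<i> * of_real \<omega> * L2_inner \<Omega> (ampere H E) F) +
          cmod (L2_inner \<Omega> (\<lambda>x. inverse (\<mu> x) *\<^sub>R faraday H E x) (curl \<Omega> F))"
        unfolding primal_form_residuals[OF E H F green[OF HQ FP]] by (rule norm_triangle_ineq4)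
      also have "\<dots> \<le> \<bar>\<omega>\<bar> * (?s * Hcurl_norm \<Omega> F) + (B * ?r) * Hcurl_norm \<Omega> F"
      proof (rule add_mono)
        have "cmod (L2_inner \<Omega> (ampere H E) F) \<le> ?s * L2_norm \<Omega> F"
          by (rule L2_inner_bound[OF Lr(2) Hcurl_L2[OF F]])
        also have "\<dots> \<le> ?s * Hcurl_norm \<Omega> F" by (intro mult_left_mono L2_norm_le_Hcurl_norm nn)
        finally show "cmod (\<i> * of_real \<omega> * L2_inner \<Omega> (ampere H E) F) \<le> \<bar>\<omega>\<bar> * (?s * Hcurl_norm \<Omega> F)"
          by (simp add: norm_mult mult_left_mono)
        have "cmod (L2_inner \<Omega> (\<lambda>x. inverse (\<mu> x) *\<^sub>R faraday H E x) (curl \<Omega> F)) \<le>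
            L2_norm \<Omega> (\<lambda>x. inverse (\<mu> x) *\<^sub>R faraday H E x) * L2_norm \<Omega> (curl \<Omega> F)"
          by (rule L2_inner_bound[OF L2_inv_\<mu>[OF Lr(1)] curl_in_L2[OF F]])
        also have "\<dots> \<le> (B * ?r) * Hcurl_norm \<Omega> F"
          using nn B by (intro mult_mono norm_inv_\<mu>[OF Lr(1)] L2_norm_curl_le_Hcurl_norm) (auto simp: L2_norm_nonneg)
        finally show "cmod (L2_inner \<Omega> (\<lambda>x. inverse (\<mu> x) *\<^sub>R faraday H E x) (curl \<Omega> F)) \<le> (B * ?r) * Hcurl_norm \<Omega> F" .
      qed
      also have "\<dots> = (\<bar>\<omega>\<bar> * ?s + B * ?r) * Hcurl_norm \<Omega> F" by (simp add: algebra_simps)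
      also have "\<dots> \<le> ((\<bar>\<omega>\<bar> + B) * (?r + ?s)) * Hcurl_norm \<Omega> F"
        using nn B by (intro mult_right_mono Hcurl_norm_nonneg) (simp add: algebra_simps)
      finally show ?thesis .
    qed
    from est[OF EP this] have HE: "Hcurl_norm \<Omega> E \<le> K2 * (?r + ?s)" by (simp add: K2_def mult.assoc)
    have eqH: "AE x in lebesgue_on \<Omega>. H x =
        inverse (\<i> * of_real \<omega>) *s (inverse (\<mu> x) *\<^sub>R (faraday H E x + curl \<Omega> E x))"
      using nonzero(1)
      by eventually_elim (simp add: faraday_def scaleR_conv_scalar_mult vec_eq_iff field_simps \<omega>)
    have "L2_norm \<Omega> H = L2_norm \<Omega> (\<lambda>x. inverse (\<i> * of_real \<omega>) *s (inverse (\<mu> x) *\<^sub>R (faraday H E x + curl \<Omega> E x)))"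
      by (rule L2_norm_cong_AE[OF L(2) _ eqH]) (intro L2_scalar L2_inv_\<mu> L2_add L Lr)
    also have "\<dots> \<le> cmod (inverse (\<i> * of_real \<omega>)) * L2_norm \<Omega> (\<lambda>x. inverse (\<mu> x) *\<^sub>R (faraday H E x + curl \<Omega> E x))"
      by (intro L2_norm_coeff_le[OF bounded_coeff_const] L2_inv_\<mu> L2_add L Lr) simp
    also have "\<dots> \<le> cmod (inverse (\<i> * of_real \<omega>)) * (B * L2_norm \<Omega> (\<lambda>x. faraday H E x + curl \<Omega> E x))"
      by (intro mult_left_mono norm_inv_\<mu> L2_add L Lr) simp
    also have "\<dots> \<le> cmod (inverse (\<i> * of_real \<omega>)) * (B * (?r + Hcurl_norm \<Omega> E))"
      using B by (intro mult_left_mono order_trans[OF L2_norm_triangle[OF Lr(1) L(3)]] add_left_mono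
          L2_norm_curl_le_Hcurl_norm) auto
    also have "\<dots> = (B / \<bar>\<omega>\<bar>) * (?r + Hcurl_norm \<Omega> E)"
    proof -
      have "cmod (inverse (\<i> * of_real \<omega>)) = inverse \<bar>\<omega>\<bar>" by (simp add: norm_inverse norm_mult)
      then show ?thesis by (simp only:) (simp add: field_simps)
    qed
    also have "\<dots> \<le> (B / \<bar>\<omega>\<bar>) * ((1 + K2) * (?r + ?s))"
      using HE nn B by (intro mult_left_mono) (auto simp: algebra_simps)
    finally have h1: "L2_norm \<Omega> H \<le> (B / \<bar>\<omega>\<bar>) * (1 + K2) * (?r + ?s)" by (simp add: mult.assoc)
    have "curl \<Omega> H = (\<lambda>x. ampere H E x - (\<i> * of_real \<omega> * of_real (\<epsilon> x)) *s E x)"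
      by (simp add: ampere_def)
    then have "L2_norm \<Omega> (curl \<Omega> H) \<le> ?s + L2_norm \<Omega> (i\<epsilon> E)"
      using L2_norm_triangle_diff[OF Lr(2) L2_i\<epsilon>[OF L(1)]] by metis
    also have "\<dots> \<le> ?s + \<bar>\<omega>\<bar> * B * Hcurl_norm \<Omega> E"
      using B by (intro add_left_mono order_trans[OF norm_i\<epsilon>[OF L(1)]] mult_left_mono L2_norm_le_Hcurl_norm) auto
    also have "\<dots> \<le> (?r + ?s) + \<bar>\<omega>\<bar> * B * (K2 * (?r + ?s))"
      using HE nn B by (intro add_mono mult_left_mono) auto
    finally have h2: "L2_norm \<Omega> (curl \<Omega> H) \<le> (1 + \<bar>\<omega>\<bar> * B * K2) * (?r + ?s)" by (simp add: algebra_simps)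
    have "Hcurl_norm \<Omega> H + Hcurl_norm \<Omega> E \<le>
        (B / \<bar>\<omega>\<bar>) * (1 + K2) * (?r + ?s) + (1 + \<bar>\<omega>\<bar> * B * K2) * (?r + ?s) + K2 * (?r + ?s)"
      using Hcurl_norm_le[of \<Omega> H] h1 h2 HE by linarith
    also have "\<dots> = K * (?r + ?s)" by (simp add: K_def algebra_simps)
    finally show ?thesis .
  qed
  ultimately show thesis by (rule that)
qed

lemma b_S_residuals:
  "b_S \<Omega> \<mu> \<epsilon> \<omega> (H, E) (R, S) = L2_inner \<Omega> (faraday H E) R + L2_inner \<Omega> (ampere H E) S"
  by (simp add: b_S_def faraday_def ampere_def)

lemma b_U_residuals:
  "b_U \<Omega> \<mu> \<epsilon> \<omega> (H, E) (R, S) = - L2_inner \<Omega> H (faraday R S) - L2_inner \<Omega> E (ampere R S)"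
proof -
  have 1: "(\<lambda>x. (- \<i> * of_real \<omega> * of_real (\<mu> x)) *s R x + curl \<Omega> S x) = (\<lambda>x. (-1) *s faraday R S x)"
    by (simp add: faraday_def fun_eq_iff vec_eq_iff)
  have 2: "(\<lambda>x. (- \<i> * of_real \<omega> * of_real (\<epsilon> x)) *s S x - curl \<Omega> R x) = (\<lambda>x. (-1) *s ampere R S x)"
    by (simp add: ampere_def fun_eq_iff vec_eq_iff)
  show ?thesis unfolding b_U_def prod.case 1 2 L2_inner_scalar_right by simp
qed

lemma b_U_expand:
  assumes H: "H \<in> L2 \<Omega>" and E: "E \<in> L2 \<Omega>" and R: "R \<in> Hcurl \<Omega>" and S: "S \<in> Hcurl \<Omega>"
  shows "b_U \<Omega> \<mu> \<epsilon> \<omega> (H, E) (R, S) =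
    L2_inner \<Omega> (i\<mu> H) R + L2_inner \<Omega> H (curl \<Omega> S) +
    (L2_inner \<Omega> (i\<epsilon> E) S - L2_inner \<Omega> E (curl \<Omega> R))"
proof -
  have adj: "L2_inner \<Omega> F (\<lambda>x. (\<i> * of_real \<omega> * of_real (c x)) *s G x) =
      - L2_inner \<Omega> (\<lambda>x. (\<i> * of_real \<omega> * of_real (c x)) *s F x) G" for F G and c :: "real^3 \<Rightarrow> real"
  proof -
    have "(\<lambda>x. cnj (\<i> * of_real \<omega> * of_real (c x)) *s G x) = (\<lambda>x. (-1) *s ((\<i> * of_real \<omega> * of_real (c x)) *s G x))"
      by (simp add: fun_eq_iff vec_eq_iff)
    then show ?thesis unfolding L2_inner_coeff by (simp only: L2_inner_scalar_right) simp
  qed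
  note L = Hcurl_L2[OF R] Hcurl_L2[OF S] curl_in_L2[OF R] curl_in_L2[OF S]
  show ?thesis
    unfolding b_U_residuals faraday_def ampere_def
    by (simp add: L2_inner_diff_right L2_inner_add_right L2_i\<mu> L2_i\<epsilon> L H E adj)
qed

lemma b_M_faraday:
  "b_M \<Omega> \<mu> \<epsilon> \<omega> (H, E) (R, S) =
    L2_inner \<Omega> (faraday H E) R + L2_inner \<Omega> (i\<epsilon> E) S + L2_inner \<Omega> H (curl \<Omega> S)"
  by (simp add: b_M_def faraday_def)

text \<open>
  The ultraweak form arises from the mixed one by integrating the term with \<open>curl E\<close> by parts.
\<close>

lemma b_M_eq_b_U:
  assumes H: "H \<in> L2 \<Omega>" and E: "E \<in> Hcurl \<Omega>" and R: "R \<in> Hcurl \<Omega>" and S: "S \<in> Hcurl \<Omega>"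
    and green: "L2_inner \<Omega> (curl \<Omega> E) R = L2_inner \<Omega> E (curl \<Omega> R)"
  shows "b_M \<Omega> \<mu> \<epsilon> \<omega> (H, E) (R, S) = b_U \<Omega> \<mu> \<epsilon> \<omega> (H, E) (R, S)"
  unfolding b_U_expand[OF H Hcurl_L2[OF E] R S] b_M_def prod.case
  by (simp add: L2_inner_diff_left L2_i\<mu> H curl_in_L2 E Hcurl_L2 R green)

text \<open>
  Outside the resonances the first-order system is solvable for all right-hand sides: eliminate
  the magnetic field, solve the primal problem and recover the magnetic field from Faraday's law.
  Testing with compactly supported fields shows that it has a weak curl.
\<close>

lemma nonresonant_solvable:
  assumes nores: "\<not> resonance \<Omega> \<mu> \<epsilon> \<omega>" and f: "f \<in> L2 \<Omega>" and g: "g \<in> L2 \<Omega>"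
  obtains R S where "R \<in> Hcurl \<Omega>" "S \<in> Hcurl0 \<Omega>"
    "AE x in lebesgue_on \<Omega>. faraday R S x = f x" "AE x in lebesgue_on \<Omega>. ampere R S x = g x"
proof -
  define f' where "f' = (\<lambda>x. inverse (\<mu> x) *\<^sub>R f x)"
  define l where "l F = \<i> * of_real \<omega> * L2_inner \<Omega> g F - L2_inner \<Omega> f' (curl \<Omega> F)" for F
  have f': "f' \<in> L2 \<Omega>" unfolding f'_def by (rule L2_inv_\<mu>[OF f])
  have "l \<in> Hcurl0_dual \<Omega>"
    unfolding Hcurl0_dual_def
  proof (intro CollectI conjI ballI allI)
    fix F G assume FG: "F \<in> Hcurl0 \<Omega>" "G \<in> Hcurl0 \<Omega>"
    note h = FG[THEN Hcurl0_Hcurl]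
    note L = h[THEN Hcurl_L2] h[THEN curl_in_L2]
    have "L2_inner \<Omega> f' (curl \<Omega> (\<lambda>x. F x + G x)) = L2_inner \<Omega> f' (\<lambda>x. curl \<Omega> F x + curl \<Omega> G x)"
      by (intro L2_inner_cong_AE_right curl_in_L2 Hcurl_add[OF \<Omega>(1) h] L2_add L f' curl_add[OF \<Omega>(1) h])
    then show "l (\<lambda>x. F x + G x) = l F + l G"
      by (simp add: l_def L2_inner_add_right L f' g algebra_simps)
  next
    fix F a assume F: "F \<in> Hcurl0 \<Omega>"
    note h = F[THEN Hcurl0_Hcurl]
    have "L2_inner \<Omega> f' (curl \<Omega> (\<lambda>x. a *s F x)) = L2_inner \<Omega> f' (\<lambda>x. a *s curl \<Omega> F x)"
      by (intro L2_inner_cong_AE_right curl_in_L2 Hcurl_scalar[OF \<Omega>(1) h] L2_scalar f' h curl_scalar[OF \<Omega>(1) h])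
    then show "l (\<lambda>x. a *s F x) = cnj a * l F"
      by (simp add: l_def L2_inner_scalar_right algebra_simps)
  next
    show "\<exists>C. \<forall>F\<in>Hcurl0 \<Omega>. cmod (l F) \<le> C * Hcurl_norm \<Omega> F"
    proof (intro exI[of _ "\<bar>\<omega>\<bar> * L2_norm \<Omega> g + L2_norm \<Omega> f'"] ballI)
      fix F assume "F \<in> Hcurl0 \<Omega>"
      then have F: "F \<in> Hcurl \<Omega>" by (rule Hcurl0_Hcurl)
      have "cmod (l F) \<le> \<bar>\<omega>\<bar> * cmod (L2_inner \<Omega> g F) + cmod (L2_inner \<Omega> f' (curl \<Omega> F))"
        unfolding l_def by (rule order_trans[OF norm_triangle_ineq4]) (simp add: norm_mult)
      also have "\<dots> \<le> \<bar>\<omega>\<bar> * (L2_norm \<Omega> g * Hcurl_norm \<Omega> F) + L2_norm \<Omega> f' * Hcurl_norm \<Omega> F"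
        by (intro add_mono mult_left_mono order_trans[OF L2_inner_bound] L2_norm_le_Hcurl_norm
            L2_norm_curl_le_Hcurl_norm g f' Hcurl_L2 curl_in_L2 F L2_norm_nonneg) simp_all
      finally show "cmod (l F) \<le> (\<bar>\<omega>\<bar> * L2_norm \<Omega> g + L2_norm \<Omega> f') * Hcurl_norm \<Omega> F"
        by (simp add: algebra_simps)
    qed
  qed
  then obtain S where S: "S \<in> Hcurl0 \<Omega>" and sol: "\<And>F. F \<in> Hcurl0 \<Omega> \<Longrightarrow> b_E \<Omega> \<mu> \<epsilon> \<omega> S F = l F"
    using nores unfolding resonance_def cavity_solution_def by blast
  have SH: "S \<in> Hcurl \<Omega>" by (rule Hcurl0_Hcurl[OF S])
  note LS = Hcurl_L2[OF SH] curl_in_L2[OF SH]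
  define R where "R = (\<lambda>x. inverse (\<i> * of_real \<omega>) *s (inverse (\<mu> x) *\<^sub>R (f x + curl \<Omega> S x)))"
  define G where "G = (\<lambda>x. g x - (\<i> * of_real \<omega> * of_real (\<epsilon> x)) *s S x)"
  have LR: "R \<in> L2 \<Omega>" unfolding R_def by (intro L2_scalar L2_inv_\<mu> L2_add f LS)
  have LG: "G \<in> L2 \<Omega>" unfolding G_def by (intro L2_diff g L2_i\<epsilon> LS)
  have "is_weak_curl \<Omega> R G"
    unfolding is_weak_curl_def
  proof (intro conjI ballI LG)
    fix \<phi> assume \<phi>: "\<phi> \<in> test_fields \<Omega>"
    have \<phi>0: "\<phi> \<in> Hcurl0 \<Omega>" by (rule test_field_Hcurl0[OF \<Omega> \<phi>])
    note L\<phi> = test_field_L2(1)[OF \<Omega>(1) \<phi>] curl_in_L2[OF Hcurl0_Hcurl[OF \<phi>0]]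
      test_field_L2(1)[OF \<Omega>(1) classical_curl_test_field[OF \<phi>]]
    have eqS: "L2_inner \<Omega> (i\<epsilon> S) \<phi> =
        \<i> * of_real \<omega> * L2_inner \<Omega> (\<lambda>x. \<epsilon> x *\<^sub>R S x) \<phi>"
      by (simp only: scaleR_conv_scalar_mult vector_smult_assoc[symmetric] L2_inner_scalar_left mult.assoc)
    have "L2_inner \<Omega> R (classical_curl \<phi>) = L2_inner \<Omega> R (curl \<Omega> \<phi>)"
      using L2_inner_cong_AE_right[OF L\<phi>(2,3) LR curl_test_field[OF \<Omega> \<phi>]] by simp
    also have "\<dots> = inverse (\<i> * of_real \<omega>) *
        (L2_inner \<Omega> f' (curl \<Omega> \<phi>) + L2_inner \<Omega> (\<lambda>x. inverse (\<mu> x) *\<^sub>R curl \<Omega> S x) (curl \<Omega> \<phi>))"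
      unfolding R_def scaleR_add_right L2_inner_scalar_left
      by (subst L2_inner_add_left) (simp_all add: f'_def L2_inv_\<mu> f LS L\<phi>)
    also have "L2_inner \<Omega> f' (curl \<Omega> \<phi>) + L2_inner \<Omega> (\<lambda>x. inverse (\<mu> x) *\<^sub>R curl \<Omega> S x) (curl \<Omega> \<phi>) =
        \<i> * of_real \<omega> * L2_inner \<Omega> g \<phi> + of_real (\<omega>\<^sup>2) * L2_inner \<Omega> (\<lambda>x. \<epsilon> x *\<^sub>R S x) \<phi>"
      using sol[OF \<phi>0] unfolding b_E_def l_def by (simp add: algebra_simps)
    also have "inverse (\<i> * of_real \<omega>) * \<dots> = L2_inner \<Omega> g \<phi> - \<i> * of_real \<omega> * L2_inner \<Omega> (\<lambda>x. \<epsilon> x *\<^sub>R S x) \<phi>"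
      using \<omega> by (simp add: field_simps power2_eq_square)
    also have "\<dots> = L2_inner \<Omega> G \<phi>"
      unfolding G_def eqS[symmetric] by (simp add: L2_inner_diff_left g L2_i\<epsilon> LS L\<phi>)
    finally show "L2_inner \<Omega> R (classical_curl \<phi>) = L2_inner \<Omega> G \<phi>" .
  qed
  note R = curl_eq_weak_curl[OF \<Omega>(1) LR this]
  show thesis
  proof (rule that[OF R(1) S])
    show "AE x in lebesgue_on \<Omega>. faraday R S x = f x"
      using nonzero(1)
      by eventually_elim (simp add: faraday_def R_def scaleR_conv_scalar_mult vec_eq_iff field_simps \<omega>)
    show "AE x in lebesgue_on \<Omega>. ampere R S x = g x"
      using R(2) by eventually_elim (simp add: ampere_def G_def)
  qed
qed

end


section \<open>Passing from one formulation to another\<close>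

text \<open>
  \<open>E\<close> ranges over \<open>P\<close> and \<open>H\<close> over \<open>Q\<close>, and Green's formula holds between them. The cavity problem
  has \<open>P\<close> with and \<open>Q\<close> without boundary conditions; leaving both open makes room for the problem
  in which the two fields are exchanged.
\<close>

locale cavity = maxwell +
  fixes P Q :: "field3 set"
  assumes nonempty: "\<Omega> \<noteq> {}"
    and P: "Hcurl0 \<Omega> \<subseteq> P" "P \<subseteq> Hcurl \<Omega>" and Q: "Hcurl0 \<Omega> \<subseteq> Q" "Q \<subseteq> Hcurl \<Omega>"
    and green: "\<And>E H. E \<in> P \<Longrightarrow> H \<in> Q \<Longrightarrow> L2_inner \<Omega> (curl \<Omega> E) H = L2_inner \<Omega> E (curl \<Omega> H)"
begin

lemma green': "H \<in> Q \<Longrightarrow> E \<in> P \<Longrightarrow> L2_inner \<Omega> (curl \<Omega> H) E = L2_inner \<Omega> H (curl \<Omega> E)"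
  using green[of E H] L2_inner_cnj[of \<Omega> "curl \<Omega> H" E] L2_inner_cnj[of \<Omega> H "curl \<Omega> E"] by simp

lemma nonzero_element:
  obtains \<phi> where "\<phi> \<in> P" "\<phi> \<in> Q" "\<phi> \<in> L2 \<Omega>" "L2_norm \<Omega> \<phi> \<noteq> 0" "Hcurl_norm \<Omega> \<phi> \<noteq> 0"
proof -
  obtain \<phi> where \<phi>: "\<phi> \<in> test_fields \<Omega>" "L2_norm \<Omega> \<phi> \<noteq> 0"
    using nonzero_test_field[OF \<Omega>(1) nonempty] by blast
  have 0: "\<phi> \<in> Hcurl0 \<Omega>" by (rule test_field_Hcurl0[OF \<Omega> \<phi>(1)])
  have "Hcurl_norm \<Omega> \<phi> \<noteq> 0"
    using \<phi>(2) L2_norm_le_Hcurl_norm[of \<Omega> \<phi>] L2_norm_nonneg[of \<Omega> \<phi>] by simp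
  then show thesis using that 0 \<phi>(2) P(1) Q(1) Hcurl_L2[OF Hcurl0_Hcurl[OF 0]] by blast
qed

theorem primal_imp_strong:
  assumes "inf_sup P (Hcurl_norm \<Omega>) P (Hcurl_norm \<Omega>) (b_E \<Omega> \<mu> \<epsilon> \<omega>)"
  shows "inf_sup (Q \<times> P) (prod_norm (Hcurl_norm \<Omega>) (Hcurl_norm \<Omega>))
    (L2 \<Omega> \<times> L2 \<Omega>) (prod_norm (L2_norm \<Omega>) (L2_norm \<Omega>)) (b_S \<Omega> \<mu> \<epsilon> \<omega>)"
proof -
  let ?n = "prod_norm (L2_norm \<Omega>) (L2_norm \<Omega>)"
  obtain K1 where K1: "K1 > 0" "\<And>E M. E \<in> P \<Longrightarrow>
      (\<And>F. F \<in> P \<Longrightarrow> cmod (b_E \<Omega> \<mu> \<epsilon> \<omega> E F) \<le> M * Hcurl_norm \<Omega> F) \<Longrightarrow> Hcurl_norm \<Omega> E \<le> K1 * M"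
    using inf_sup_imp_estimate[OF assms Hcurl_norm_nonneg] by metis
  from primal_estimate_imp_strong_estimate[OF P(2) Q(2) green' K1]
  obtain K where K: "K > 0" and est: "\<And>E H. E \<in> P \<Longrightarrow> H \<in> Q \<Longrightarrow>
    Hcurl_norm \<Omega> H + Hcurl_norm \<Omega> E \<le> K * (L2_norm \<Omega> (faraday H E) + L2_norm \<Omega> (ampere H E))"
    by blast
  obtain \<phi> where \<phi>: "\<phi> \<in> L2 \<Omega>" "L2_norm \<Omega> \<phi> \<noteq> 0" by (rule nonzero_element)
  show ?thesis
  proof (rule estimate_imp_inf_sup[where K = "2 * K" and ?y0.0 = "(\<phi>, \<phi>)"])
    show "2 * K > 0" using K by simp
    show "?n y \<ge> 0" for y by (rule prod_norm_nonneg)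
    show "(\<phi>, \<phi>) \<in> L2 \<Omega> \<times> L2 \<Omega>" "?n (\<phi>, \<phi>) \<noteq> 0" using \<phi> by (simp_all add: prod_norm_eq_0_iff)
  next
    fix x y assume x: "x \<in> Q \<times> P" and y: "y \<in> L2 \<Omega> \<times> L2 \<Omega>" and y0: "?n y = 0"
    obtain H E R S where xy: "x = (H, E)" "y = (R, S)" by (cases x, cases y) blast
    have H: "H \<in> Hcurl \<Omega>" and E: "E \<in> Hcurl \<Omega>" using x xy P(2) Q(2) by auto
    show "b_S \<Omega> \<mu> \<epsilon> \<omega> x y = 0"
      using y y0 L2_faraday[OF Hcurl_L2[OF H] E] L2_ampere[OF H Hcurl_L2[OF E]]
      by (simp add: xy b_S_residuals prod_norm_eq_0_iff L2_inner_null_right)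
  next
    fix x M assume x: "x \<in> Q \<times> P" and M: "M \<ge> 0"
      and bound: "\<And>y. y \<in> L2 \<Omega> \<times> L2 \<Omega> \<Longrightarrow> cmod (b_S \<Omega> \<mu> \<epsilon> \<omega> x y) \<le> M * ?n y"
    obtain H E where xy: "x = (H, E)" by (cases x)
    have HQ: "H \<in> Q" and EP: "E \<in> P" and H: "H \<in> Hcurl \<Omega>" and E: "E \<in> Hcurl \<Omega>"
      using x xy P(2) Q(2) by auto
    note Lr = L2_faraday[OF Hcurl_L2[OF H] E] L2_ampere[OF H Hcurl_L2[OF E]]
    have r: "L2_norm \<Omega> (faraday H E) \<le> M"
      using bound[of "(faraday H E, \<lambda>x. 0)"] Lr(1)
      by (intro L2_norm_le_of_self_bound[OF _ M])
        (simp add: xy b_S_residuals L2_zero L2_inner_zero_right prod_norm_zero_right L2_norm_zero L2_norm_nonneg)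
    have s: "L2_norm \<Omega> (ampere H E) \<le> M"
      using bound[of "(\<lambda>x. 0, ampere H E)"] Lr(2)
      by (intro L2_norm_le_of_self_bound[OF _ M])
        (simp add: xy b_S_residuals L2_zero L2_inner_zero_right prod_norm_zero_left L2_norm_zero L2_norm_nonneg)
    have "prod_norm (Hcurl_norm \<Omega>) (Hcurl_norm \<Omega>) x \<le> Hcurl_norm \<Omega> H + Hcurl_norm \<Omega> E"
      unfolding xy by (intro prod_norm_le Hcurl_norm_nonneg)
    also have "\<dots> \<le> K * (M + M)"
      using K r s by (intro order_trans[OF est[OF EP HQ]] mult_left_mono add_mono) auto
    finally show "prod_norm (Hcurl_norm \<Omega>) (Hcurl_norm \<Omega>) x \<le> 2 * K * M" by simp
  qed
qed

text \<open>
  The ultraweak form tested with \<open>y\<close> is minus the inner product of \<open>x\<close> with the residuals of \<open>y\<close>. So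
  one solves the first-order system with right-hand side \<open>x\<close>; stability of the strong form bounds
  the solution \<open>y\<close> by \<open>x\<close>, and testing with it returns the square of the norm of \<open>x\<close>.
\<close>

theorem strong_imp_ultraweak:
  assumes S: "inf_sup (Q \<times> P) (prod_norm (Hcurl_norm \<Omega>) (Hcurl_norm \<Omega>))
      (L2 \<Omega> \<times> L2 \<Omega>) (prod_norm (L2_norm \<Omega>) (L2_norm \<Omega>)) (b_S \<Omega> \<mu> \<epsilon> \<omega>)"
    and solvable: "\<And>f g. f \<in> L2 \<Omega> \<Longrightarrow> g \<in> L2 \<Omega> \<Longrightarrow> \<exists>R S. R \<in> Q \<and> S \<in> P \<and>
      (AE x in lebesgue_on \<Omega>. faraday R S x = f x) \<and> (AE x in lebesgue_on \<Omega>. ampere R S x = g x)"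
  shows "inf_sup (L2 \<Omega> \<times> L2 \<Omega>) (prod_norm (L2_norm \<Omega>) (L2_norm \<Omega>))
    (Q \<times> P) (prod_norm (Hcurl_norm \<Omega>) (Hcurl_norm \<Omega>)) (b_U \<Omega> \<mu> \<epsilon> \<omega>)"
proof -
  let ?n = "prod_norm (Hcurl_norm \<Omega>) (Hcurl_norm \<Omega>)" and ?m = "prod_norm (L2_norm \<Omega>) (L2_norm \<Omega>)"
  obtain K where K: "K > 0" "\<And>x M. x \<in> Q \<times> P \<Longrightarrow>
      (\<And>y. y \<in> L2 \<Omega> \<times> L2 \<Omega> \<Longrightarrow> cmod (b_S \<Omega> \<mu> \<epsilon> \<omega> x y) \<le> M * ?m y) \<Longrightarrow> ?n x \<le> K * M"
    using inf_sup_imp_estimate[OF S prod_norm_nonneg] by metis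
  obtain \<phi> where \<phi>: "\<phi> \<in> P" "\<phi> \<in> Q" "Hcurl_norm \<Omega> \<phi> \<noteq> 0" by (rule nonzero_element)
  show ?thesis
  proof (rule estimate_imp_inf_sup[where K = "2 * K" and ?y0.0 = "(\<phi>, \<phi>)"])
    show "2 * K > 0" using K by simp
    show "?n y \<ge> 0" for y by (rule prod_norm_nonneg)
    show "(\<phi>, \<phi>) \<in> Q \<times> P" "?n (\<phi>, \<phi>) \<noteq> 0" using \<phi> by (simp_all add: prod_norm_eq_0_iff)
  next
    fix x y assume x: "x \<in> L2 \<Omega> \<times> L2 \<Omega>" and y: "y \<in> Q \<times> P" and y0: "?n y = 0"
    obtain H E R S where xy: "x = (H, E)" "y = (R, S)" by (cases x, cases y) blast
    have H: "H \<in> L2 \<Omega>" and E: "E \<in> L2 \<Omega>" and R: "R \<in> Hcurl \<Omega>" and S: "S \<in> Hcurl \<Omega>"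
      using x y xy P(2) Q(2) by auto
    have z: "Hcurl_norm \<Omega> R = 0" "Hcurl_norm \<Omega> S = 0" using y0 by (simp_all add: xy prod_norm_eq_0_iff)
    show "b_U \<Omega> \<mu> \<epsilon> \<omega> x y = 0"
      unfolding xy b_U_expand[OF H E R S]
      by (simp add: L2_inner_null_right L2_i\<mu> L2_i\<epsilon> H E R S Hcurl_L2 curl_in_L2 Hcurl_norm_0D z)
  next
    fix x M assume x: "x \<in> L2 \<Omega> \<times> L2 \<Omega>" and M: "M \<ge> 0"
      and bound: "\<And>y. y \<in> Q \<times> P \<Longrightarrow> cmod (b_U \<Omega> \<mu> \<epsilon> \<omega> x y) \<le> M * ?n y"
    obtain H E where xy: "x = (H, E)" by (cases x)
    have H: "H \<in> L2 \<Omega>" and E: "E \<in> L2 \<Omega>" using x xy by auto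
    obtain R S where RS: "R \<in> Q" "S \<in> P"
      and f: "AE x in lebesgue_on \<Omega>. faraday R S x = H x" and g: "AE x in lebesgue_on \<Omega>. ampere R S x = E x"
      using solvable[OF H E] by blast
    have R: "R \<in> Hcurl \<Omega>" and S: "S \<in> Hcurl \<Omega>" using RS P(2) Q(2) by auto
    note Lr = L2_faraday[OF Hcurl_L2[OF R] S] L2_ampere[OF R Hcurl_L2[OF S]]
    have "?n (R, S) \<le> K * (?m x + ?m x)"
    proof (rule K(2))
      show "(R, S) \<in> Q \<times> P" using RS by simp
      fix y assume "y \<in> L2 \<Omega> \<times> L2 \<Omega>"
      then obtain A C where y: "y = (A, C)" and A: "A \<in> L2 \<Omega>" and C: "C \<in> L2 \<Omega>" by auto
      have "cmod (b_S \<Omega> \<mu> \<epsilon> \<omega> (R, S) y) \<le> cmod (L2_inner \<Omega> H A) + cmod (L2_inner \<Omega> E C)"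
        unfolding y b_S_residuals L2_inner_cong_AE_left[OF Lr(1) H A f] L2_inner_cong_AE_left[OF Lr(2) E C g]
        by (rule norm_triangle_ineq)
      also have "\<dots> \<le> ?m x * ?m y + ?m x * ?m y"
        unfolding xy y
        by (intro add_mono order_trans[OF L2_inner_bound] mult_mono fst_le_prod_norm snd_le_prod_norm
            prod_norm_nonneg H E A C L2_norm_nonneg)
      finally show "cmod (b_S \<Omega> \<mu> \<epsilon> \<omega> (R, S) y) \<le> (?m x + ?m x) * ?m y" by (simp add: algebra_simps)
    qed
    then have y: "?n (R, S) \<le> 2 * K * ?m x" by simp
    have "b_U \<Omega> \<mu> \<epsilon> \<omega> x (R, S) = - of_real ((?m x)\<^sup>2)"
      unfolding xy b_U_residuals L2_inner_cong_AE_right[OF Lr(1) H H f] L2_inner_cong_AE_right[OF Lr(2) E E g]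
      by (simp add: L2_inner_self prod_norm_def)
    then have "cmod (b_U \<Omega> \<mu> \<epsilon> \<omega> x (R, S)) = (?m x)\<^sup>2"
      by (simp only: norm_minus_cancel norm_of_real) simp
    then have "(?m x)\<^sup>2 \<le> M * ?n (R, S)" using bound[of "(R, S)"] RS by simp
    also have "\<dots> \<le> M * (2 * K * ?m x)" using y M by (rule mult_left_mono)
    finally have *: "?m x * ?m x \<le> (2 * K * M) * ?m x" by (simp add: power2_eq_square algebra_simps)
    show "?m x \<le> 2 * K * M"
    proof (cases "?m x = 0")
      case False
      then have "?m x > 0" using prod_norm_nonneg[of "L2_norm \<Omega>" "L2_norm \<Omega>" x] by simp
      then show ?thesis using * by simp
    qed (use K(1) M in simp)
  qed
qed

text \<open>
  On \<open>L2 \<times> P\<close> the two forms agree for test functions in \<open>Q \<times> P\<close>, whose norm dominates the norm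
  of the mixed form; this controls \<open>H\<close> and \<open>E\<close> in \<open>L2\<close>. The curl of \<open>E\<close> is then read off from
  Faraday's law, whose residual is an admissible test function of the mixed form.
\<close>

theorem ultraweak_imp_mixed:
  assumes U: "inf_sup (L2 \<Omega> \<times> L2 \<Omega>) (prod_norm (L2_norm \<Omega>) (L2_norm \<Omega>))
    (Q \<times> P) (prod_norm (Hcurl_norm \<Omega>) (Hcurl_norm \<Omega>)) (b_U \<Omega> \<mu> \<epsilon> \<omega>)"
  shows "inf_sup (L2 \<Omega> \<times> P) (prod_norm (L2_norm \<Omega>) (Hcurl_norm \<Omega>))
    (L2 \<Omega> \<times> P) (prod_norm (L2_norm \<Omega>) (Hcurl_norm \<Omega>)) (b_M \<Omega> \<mu> \<epsilon> \<omega>)"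
proof -
  let ?n = "prod_norm (L2_norm \<Omega>) (Hcurl_norm \<Omega>)" and ?m = "prod_norm (L2_norm \<Omega>) (L2_norm \<Omega>)"
  obtain K where K: "K > 0" "\<And>x M. x \<in> L2 \<Omega> \<times> L2 \<Omega> \<Longrightarrow>
      (\<And>y. y \<in> Q \<times> P \<Longrightarrow> cmod (b_U \<Omega> \<mu> \<epsilon> \<omega> x y) \<le> M * prod_norm (Hcurl_norm \<Omega>) (Hcurl_norm \<Omega>) y) \<Longrightarrow>
      ?m x \<le> K * M"
    using inf_sup_imp_estimate[OF U prod_norm_nonneg] by metis
  obtain \<phi> where \<phi>: "\<phi> \<in> P" "\<phi> \<in> L2 \<Omega>" "L2_norm \<Omega> \<phi> \<noteq> 0" by (rule nonzero_element)
  show ?thesis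
  \<comment> \<open>\<open>2 * K\<close> accounts for the two \<open>L\<^sup>2\<close> norms and \<open>1 + \<bar>\<omega>\<bar> * B * K\<close> for \<open>curl E\<close>.\<close>
  proof (rule estimate_imp_inf_sup[where K = "2 * K + (1 + \<bar>\<omega>\<bar> * B * K)" and ?y0.0 = "(\<phi>, \<phi>)"])
    show "2 * K + (1 + \<bar>\<omega>\<bar> * B * K) > 0" using K(1) B by (simp add: add_pos_nonneg)
    show "?n y \<ge> 0" for y by (rule prod_norm_nonneg)
    show "(\<phi>, \<phi>) \<in> L2 \<Omega> \<times> P" "?n (\<phi>, \<phi>) \<noteq> 0" using \<phi> by (simp_all add: prod_norm_eq_0_iff)
  next
    fix x y assume x: "x \<in> L2 \<Omega> \<times> P" and y: "y \<in> L2 \<Omega> \<times> P" and y0: "?n y = 0"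
    obtain H E R S where xy: "x = (H, E)" "y = (R, S)" by (cases x, cases y) blast
    have H: "H \<in> L2 \<Omega>" and E: "E \<in> Hcurl \<Omega>" and R: "R \<in> L2 \<Omega>" and S: "S \<in> Hcurl \<Omega>"
      using x y xy P(2) by auto
    have z: "L2_norm \<Omega> R = 0" "Hcurl_norm \<Omega> S = 0" using y0 by (simp_all add: xy prod_norm_eq_0_iff)
    show "b_M \<Omega> \<mu> \<epsilon> \<omega> x y = 0"
      unfolding xy b_M_faraday
      by (simp add: L2_inner_null_right L2_i\<epsilon> L2_faraday H E R S Hcurl_L2 curl_in_L2 Hcurl_norm_0D z)
  next
    fix x M assume x: "x \<in> L2 \<Omega> \<times> P" and M: "M \<ge> 0"
      and bound: "\<And>y. y \<in> L2 \<Omega> \<times> P \<Longrightarrow> cmod (b_M \<Omega> \<mu> \<epsilon> \<omega> x y) \<le> M * ?n y"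
    obtain H E where xy: "x = (H, E)" by (cases x)
    have H: "H \<in> L2 \<Omega>" and EP: "E \<in> P" and E: "E \<in> Hcurl \<Omega>" using x xy P(2) by auto
    note Lr = L2_faraday[OF H E]
    have "?m (H, E) \<le> K * M"
    proof (rule K(2))
      show "(H, E) \<in> L2 \<Omega> \<times> L2 \<Omega>" using H Hcurl_L2[OF E] by simp
      fix y assume "y \<in> Q \<times> P"
      then obtain R S where y: "y = (R, S)" and RQ: "R \<in> Q" and SP: "S \<in> P" by auto
      have R: "R \<in> Hcurl \<Omega>" and S: "S \<in> Hcurl \<Omega>" using RQ SP P(2) Q(2) by auto
      have "cmod (b_U \<Omega> \<mu> \<epsilon> \<omega> (H, E) y) \<le> M * ?n (R, S)"
        using bound[of "(R, S)"] SP Hcurl_L2[OF R] b_M_eq_b_U[OF H E R S green[OF EP RQ]] by (simp add: xy y)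
      also have "\<dots> \<le> M * prod_norm (Hcurl_norm \<Omega>) (Hcurl_norm \<Omega>) y"
        unfolding y using M by (intro mult_left_mono prod_norm_mono L2_norm_le_Hcurl_norm)
          (simp_all add: Hcurl_norm_nonneg L2_norm_nonneg)
      finally show "cmod (b_U \<Omega> \<mu> \<epsilon> \<omega> (H, E) y) \<le> M * prod_norm (Hcurl_norm \<Omega>) (Hcurl_norm \<Omega>) y" .
    qed
    then have HE: "L2_norm \<Omega> H \<le> K * M" "L2_norm \<Omega> E \<le> K * M"
      by (rule order_trans[OF fst_le_prod_norm], rule order_trans[OF snd_le_prod_norm])
    note Z = zero_Hcurl0[OF \<Omega>]
    have "b_M \<Omega> \<mu> \<epsilon> \<omega> x (faraday H E, \<lambda>x. 0) = L2_inner \<Omega> (faraday H E) (faraday H E)"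
      using L2_inner_null_right[OF H curl_in_L2[OF Hcurl0_Hcurl[OF Z(1)]] Hcurl_norm_0D(2)[OF Z(2)]]
      by (simp add: xy b_M_faraday L2_inner_zero_right)
    then have "L2_norm \<Omega> (faraday H E) \<le> M"
      using bound[of "(faraday H E, \<lambda>x. 0)"] Lr Z(1) P(1)
      by (intro L2_norm_le_of_self_bound[OF _ M])
        (simp add: prod_norm_zero_right Z(2) L2_norm_nonneg subset_iff)
    moreover have "L2_norm \<Omega> (curl \<Omega> E) \<le> L2_norm \<Omega> (i\<mu> H) + L2_norm \<Omega> (faraday H E)"
      using L2_norm_triangle_diff[OF L2_i\<mu>[OF H] Lr] by (simp add: faraday_def)
    moreover have "L2_norm \<Omega> (i\<mu> H) \<le> \<bar>\<omega>\<bar> * B * (K * M)"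
      using HE B by (intro order_trans[OF norm_i\<mu>[OF H]] mult_left_mono) auto
    moreover have "?n x \<le> L2_norm \<Omega> H + (L2_norm \<Omega> E + L2_norm \<Omega> (curl \<Omega> E))"
      unfolding xy using prod_norm_le[of "L2_norm \<Omega>" H "Hcurl_norm \<Omega>" E] Hcurl_norm_le[of \<Omega> E]
      by (simp add: Hcurl_norm_nonneg L2_norm_nonneg)
    ultimately have "?n x \<le> K * M + (K * M + (M + \<bar>\<omega>\<bar> * B * (K * M)))" using HE by linarith
    then show "?n x \<le> (2 * K + (1 + \<bar>\<omega>\<bar> * B * K)) * M" by (simp add: algebra_simps)
  qed
qed

text \<open>
  Completing \<open>E\<close> by the magnetic field that satisfies Faraday's law exactly turns the mixed form into
  a multiple of the primal one.
\<close>

theorem mixed_imp_primal: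
  assumes "inf_sup (L2 \<Omega> \<times> P) (prod_norm (L2_norm \<Omega>) (Hcurl_norm \<Omega>))
    (L2 \<Omega> \<times> P) (prod_norm (L2_norm \<Omega>) (Hcurl_norm \<Omega>)) (b_M \<Omega> \<mu> \<epsilon> \<omega>)"
  shows "inf_sup P (Hcurl_norm \<Omega>) P (Hcurl_norm \<Omega>) (b_E \<Omega> \<mu> \<epsilon> \<omega>)"
proof -
  let ?n = "prod_norm (L2_norm \<Omega>) (Hcurl_norm \<Omega>)"
  obtain K where K: "K > 0" "\<And>x M. x \<in> L2 \<Omega> \<times> P \<Longrightarrow>
      (\<And>y. y \<in> L2 \<Omega> \<times> P \<Longrightarrow> cmod (b_M \<Omega> \<mu> \<epsilon> \<omega> x y) \<le> M * ?n y) \<Longrightarrow> ?n x \<le> K * M"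
    using inf_sup_imp_estimate[OF assms prod_norm_nonneg] by metis
  obtain \<phi> where \<phi>: "\<phi> \<in> P" "Hcurl_norm \<Omega> \<phi> \<noteq> 0" by (rule nonzero_element)
  show ?thesis
  proof (rule estimate_imp_inf_sup[where K = "K / \<bar>\<omega>\<bar>" and ?y0.0 = \<phi>])
    show "K / \<bar>\<omega>\<bar> > 0" using K(1) \<omega> by simp
    show "\<phi> \<in> P" "Hcurl_norm \<Omega> \<phi> \<noteq> 0" by (fact \<phi>)+
    show "Hcurl_norm \<Omega> F \<ge> 0" for F by (rule Hcurl_norm_nonneg)
    show "b_E \<Omega> \<mu> \<epsilon> \<omega> E F = 0" if "E \<in> P" "F \<in> P" "Hcurl_norm \<Omega> F = 0" for E F
      using that P(2)
      by (simp add: b_E_def L2_inner_null_right L2_inv_\<mu> L2_\<epsilon> Hcurl_L2 curl_in_L2 Hcurl_norm_0D subset_iff)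
    fix E M assume E0: "E \<in> P" and M: "M \<ge> 0"
      and bound: "\<And>F. F \<in> P \<Longrightarrow> cmod (b_E \<Omega> \<mu> \<epsilon> \<omega> E F) \<le> M * Hcurl_norm \<Omega> F"
    have E: "E \<in> Hcurl \<Omega>" using E0 P(2) by blast
    note L = Hcurl_L2[OF E] curl_in_L2[OF E]
    \<comment> \<open>This choice of \<open>H\<close> satisfies Faraday's law exactly.\<close>
    define H where "H = (\<lambda>x. (- \<i> / of_real \<omega>) *s (inverse (\<mu> x) *\<^sub>R curl \<Omega> E x))"
    have H: "H \<in> L2 \<Omega>" unfolding H_def by (intro L2_scalar L2_inv_\<mu> L)
    have "AE x in lebesgue_on \<Omega>. faraday H E x = 0"
      using nonzero(1)
      by eventually_elim (simp add: faraday_def H_def scaleR_conv_scalar_mult vec_eq_iff field_simps \<omega>)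
    then have far: "L2_inner \<Omega> (faraday H E) R = 0" if "R \<in> L2 \<Omega>" for R
      using L2_inner_cong_AE_left[OF L2_faraday[OF H E] L2_zero that] by (simp add: L2_inner_zero_left)
    have "b_M \<Omega> \<mu> \<epsilon> \<omega> (H, E) (R, S) = - (\<i> / of_real \<omega>) * b_E \<Omega> \<mu> \<epsilon> \<omega> E S" if R: "R \<in> L2 \<Omega>" for R S
    proof -
      have "L2_inner \<Omega> (i\<epsilon> E) S = \<i> * of_real \<omega> * L2_inner \<Omega> (\<lambda>x. \<epsilon> x *\<^sub>R E x) S"
        by (simp only: scaleR_conv_scalar_mult vector_smult_assoc[symmetric] L2_inner_scalar_left mult.assoc)
      moreover have "L2_inner \<Omega> H (curl \<Omega> S) = - \<i> / of_real \<omega> * L2_inner \<Omega> (\<lambda>x. inverse (\<mu> x) *\<^sub>R curl \<Omega> E x) (curl \<Omega> S)"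
        unfolding H_def by (rule L2_inner_scalar_left)
      ultimately show ?thesis
        using far[OF R] \<omega> unfolding b_M_faraday b_E_def
        by (simp add: field_simps power2_eq_square)
    qed
    then have scaled: "cmod (b_M \<Omega> \<mu> \<epsilon> \<omega> (H, E) (R, S)) = cmod (b_E \<Omega> \<mu> \<epsilon> \<omega> E S) / \<bar>\<omega>\<bar>" if "R \<in> L2 \<Omega>" for R S
      using that by (simp add: norm_mult norm_divide)
    have "?n (H, E) \<le> K * (M / \<bar>\<omega>\<bar>)"
    proof (rule K(2))
      show "(H, E) \<in> L2 \<Omega> \<times> P" using H E0 by simp
      fix y assume "y \<in> L2 \<Omega> \<times> P"
      then obtain R S where y: "y = (R, S)" and R: "R \<in> L2 \<Omega>" and S: "S \<in> P" by auto
      have "cmod (b_M \<Omega> \<mu> \<epsilon> \<omega> (H, E) y) = cmod (b_E \<Omega> \<mu> \<epsilon> \<omega> E S) / \<bar>\<omega>\<bar>"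
        unfolding y by (rule scaled[OF R])
      also have "\<dots> \<le> (M * ?n y) / \<bar>\<omega>\<bar>"
        unfolding y using M
        by (intro divide_right_mono order_trans[OF bound[OF S]] mult_left_mono snd_le_prod_norm) simp_all
      finally show "cmod (b_M \<Omega> \<mu> \<epsilon> \<omega> (H, E) y) \<le> M / \<bar>\<omega>\<bar> * ?n y" by simp
    qed
    then show "Hcurl_norm \<Omega> E \<le> K / \<bar>\<omega>\<bar> * M"
      using snd_le_prod_norm[of "Hcurl_norm \<Omega>" E "L2_norm \<Omega>" H] by simp
  qed
qed

end


section \<open>Exchanging the electric and the magnetic field\<close>

text \<open>
  Exchanging the two fields and the two coefficients and reversing the frequency turns the Maxwell
  system into its negative. It maps the primal form for \<open>H\<close> to the one for \<open>E\<close> and the dual mixed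
  form to the mixed one, so three of the implications follow from their counterparts.
\<close>

lemma L2_inner_uminus_left: "L2_inner \<Omega> (\<lambda>x. - F x) G = - L2_inner \<Omega> F G"
  by (simp add: L2_inner_def cdot.minus_left)

lemma L2_inner_uminus_right: "L2_inner \<Omega> F (\<lambda>x. - G x) = - L2_inner \<Omega> F G"
  by (simp add: L2_inner_def cdot.minus_right)

lemma b_H_swap: "b_H \<Omega> \<mu> \<epsilon> \<omega> = b_E \<Omega> \<epsilon> \<mu> (- \<omega>)"
  by (simp add: fun_eq_iff b_H_def b_E_def)

lemma b_S_swap: "b_S \<Omega> \<mu> \<epsilon> \<omega> (H, E) (R, S) = - b_S \<Omega> \<epsilon> \<mu> (- \<omega>) (E, H) (S, R)"
proof -
  have "(\<lambda>x. (\<i> * of_real (- \<omega>) * of_real (\<epsilon> x)) *s E x - curl \<Omega> H x) =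
      (\<lambda>x. - ((\<i> * of_real \<omega> * of_real (\<epsilon> x)) *s E x + curl \<Omega> H x))"
    "(\<lambda>x. (\<i> * of_real (- \<omega>) * of_real (\<mu> x)) *s H x + curl \<Omega> E x) =
      (\<lambda>x. - ((\<i> * of_real \<omega> * of_real (\<mu> x)) *s H x - curl \<Omega> E x))"
    by (simp_all add: fun_eq_iff vec_eq_iff)
  then show ?thesis by (simp only: b_S_def prod.case L2_inner_uminus_left) simp
qed

lemma b_U_swap: "b_U \<Omega> \<mu> \<epsilon> \<omega> (H, E) (R, S) = - b_U \<Omega> \<epsilon> \<mu> (- \<omega>) (E, H) (S, R)"
proof -
  have "(\<lambda>x. (- \<i> * of_real (- \<omega>) * of_real (\<epsilon> x)) *s S x + curl \<Omega> R x) =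
      (\<lambda>x. - ((- \<i> * of_real \<omega> * of_real (\<epsilon> x)) *s S x - curl \<Omega> R x))"
    "(\<lambda>x. (- \<i> * of_real (- \<omega>) * of_real (\<mu> x)) *s R x - curl \<Omega> S x) =
      (\<lambda>x. - ((- \<i> * of_real \<omega> * of_real (\<mu> x)) *s R x + curl \<Omega> S x))"
    by (simp_all add: fun_eq_iff vec_eq_iff)
  then show ?thesis by (simp only: b_U_def prod.case L2_inner_uminus_right) simp
qed

lemma b_D_swap: "b_D \<Omega> \<mu> \<epsilon> \<omega> (H, E) (R, S) = - b_M \<Omega> \<epsilon> \<mu> (- \<omega>) (E, H) (S, R)"
proof -
  have "(\<lambda>x. (\<i> * of_real (- \<omega>) * of_real (\<epsilon> x)) *s E x - curl \<Omega> H x) =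
      (\<lambda>x. - ((\<i> * of_real \<omega> * of_real (\<epsilon> x)) *s E x + curl \<Omega> H x))"
    "(\<lambda>x. (\<i> * of_real (- \<omega>) * of_real (\<mu> x)) *s H x) =
      (\<lambda>x. - ((\<i> * of_real \<omega> * of_real (\<mu> x)) *s H x))"
    by (simp_all add: fun_eq_iff vec_eq_iff)
  then show ?thesis by (simp only: b_D_def b_M_def prod.case L2_inner_uminus_left) simp
qed

lemma inf_sup_prod_swap:
  assumes b: "\<And>u v r s. b (u, v) (r, s) = - b' (v, u) (s, r)"
  shows "inf_sup (X \<times> X') (prod_norm n n') (Y \<times> Y') (prod_norm m m') b \<longleftrightarrow>
    inf_sup (X' \<times> X) (prod_norm n' n) (Y' \<times> Y) (prod_norm m' m) b'"
proof -
  have swap: "prod_norm k k' (u, v) = prod_norm k' k (v, u)"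
    for k :: "'u \<Rightarrow> real" and k' :: "'v \<Rightarrow> real" and u v
    by (simp add: prod_norm_def add.commute)
  let ?Y = "{y \<in> Y \<times> Y'. prod_norm m m' y \<noteq> 0}"
  have img: "{y \<in> Y' \<times> Y. prod_norm m' m y \<noteq> 0} = prod.swap ` ?Y"
    by (auto simp: image_iff swap[of m m'])
  have "(SUP y\<in>{y \<in> Y' \<times> Y. prod_norm m' m y \<noteq> 0}. ereal (cmod (b' (v, u) y) / prod_norm m' m y)) =
      (SUP y\<in>?Y. ereal (cmod (b (u, v) y) / prod_norm m m' y))" for u v
    unfolding img image_image by (rule SUP_cong) (auto simp: b swap[of m m'])
  then show ?thesis
    unfolding inf_sup_def by (auto simp: swap[of n n'])
qed


section \<open>The cavity problem\<close>

lemma bounded_coeff_of_bounds: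
  assumes "a \<in> borel_measurable (lebesgue_on \<Omega>)" "m > 0" "AE x in lebesgue_on \<Omega>. m \<le> a x \<and> a x \<le> B"
    and C: "B \<le> C" "inverse m \<le> C"
  shows "bounded_coeff \<Omega> C (\<lambda>x. of_real (a x))" "bounded_coeff \<Omega> C (\<lambda>x. of_real (inverse (a x)))"
    "AE x in lebesgue_on \<Omega>. a x \<noteq> 0"
proof -
  have [measurable]: "a \<in> borel_measurable (lebesgue_on \<Omega>)" by fact
  have "AE x in lebesgue_on \<Omega>. \<bar>a x\<bar> \<le> C" "AE x in lebesgue_on \<Omega>. \<bar>inverse (a x)\<bar> \<le> C"
    using assms(3)
  proof (eventually_elim, goal_cases)
    case (1 x)
    then show ?case using assms(2) C(1) by simp
  next
    case 2
    show ?case using assms(3)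
    proof eventually_elim
      case (elim x)
      then have "inverse (a x) \<le> inverse m" using assms(2) by (intro le_imp_inverse_le) auto
      then have "inverse (a x) \<le> C" using C(2) by (rule order_trans)
      moreover have "inverse (a x) \<ge> 0" using elim assms(2) by simp
      ultimately show ?case by (simp only: abs_of_nonneg)
    qed
  qed
  then show "bounded_coeff \<Omega> C (\<lambda>x. of_real (a x))" "bounded_coeff \<Omega> C (\<lambda>x. of_real (inverse (a x)))"
    unfolding bounded_coeff_def norm_of_real by auto
  show "AE x in lebesgue_on \<Omega>. a x \<noteq> 0"
    using assms(3) by eventually_elim (use assms(2) in auto)
qed

theorem theorem6p3:
  fixes \<Omega> :: "(real^3) set" and \<T> :: "(real^3) set set"
    and \<mu> \<epsilon> :: "real^3 \<Rightarrow> real" and \<omega> :: real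
  assumes "open \<Omega>" and "\<Omega> \<noteq> {}" and "bounded \<Omega>" and "connected \<Omega>" and "contractible \<Omega>"
    and "lipschitz_boundary \<Omega>"
    and "tetrahedral_mesh \<T> \<Omega>"
    and "piecewise_constant_pos \<T> \<mu>" and "piecewise_constant_pos \<T> \<epsilon>"
    and "\<omega> > 0" and "\<not> resonance \<Omega> \<mu> \<epsilon> \<omega>"
  shows "(inf_sup_E \<Omega> \<mu> \<epsilon> \<omega> \<longrightarrow> inf_sup_S \<Omega> \<mu> \<epsilon> \<omega>) \<and>
         (inf_sup_S \<Omega> \<mu> \<epsilon> \<omega> \<longrightarrow> inf_sup_U \<Omega> \<mu> \<epsilon> \<omega>) \<and>
         (inf_sup_U \<Omega> \<mu> \<epsilon> \<omega> \<longrightarrow> inf_sup_D \<Omega> \<mu> \<epsilon> \<omega>) \<and>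
         (inf_sup_D \<Omega> \<mu> \<epsilon> \<omega> \<longrightarrow> inf_sup_H \<Omega> \<mu> \<epsilon> \<omega>) \<and>
         (inf_sup_H \<Omega> \<mu> \<epsilon> \<omega> \<longrightarrow> inf_sup_S \<Omega> \<mu> \<epsilon> \<omega>) \<and>
         (inf_sup_U \<Omega> \<mu> \<epsilon> \<omega> \<longrightarrow> inf_sup_M \<Omega> \<mu> \<epsilon> \<omega>) \<and>
         (inf_sup_M \<Omega> \<mu> \<epsilon> \<omega> \<longrightarrow> inf_sup_E \<Omega> \<mu> \<epsilon> \<omega>)"
proof -
  note \<mu> = piecewise_constant_bounds[OF assms(1,2,7,8)] and \<epsilon> = piecewise_constant_bounds[OF assms(1,2,7,9)]
  obtain m1 B1 where m1: "m1 > 0" "AE x in lebesgue_on \<Omega>. m1 \<le> \<mu> x \<and> \<mu> x \<le> B1" using \<mu>(2) by blast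
  obtain m2 B2 where m2: "m2 > 0" "AE x in lebesgue_on \<Omega>. m2 \<le> \<epsilon> x \<and> \<epsilon> x \<le> B2" using \<epsilon>(2) by blast
  define C where "C = max (max B1 (inverse m1)) (max B2 (inverse m2))"
  have C: "B1 \<le> C" "inverse m1 \<le> C" "B2 \<le> C" "inverse m2 \<le> C" by (simp_all add: C_def)
  have "C \<ge> 0" using C(2) m1(1) by (meson inverse_nonnegative_iff_nonnegative less_imp_le order_trans)
  have "\<omega> \<noteq> 0" using assms(10) by simp
  note coeff = bounded_coeff_of_bounds[OF \<mu>(1) m1 C(1,2)] bounded_coeff_of_bounds[OF \<epsilon>(1) m2 C(3,4)]
  have sub: "Hcurl0 \<Omega> \<subseteq> Hcurl \<Omega>" using Hcurl0_Hcurl by blast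
  note green = green_Hcurl0[OF assms(1,3,6)]
  interpret cavity \<Omega> \<mu> \<epsilon> \<omega> C "Hcurl0 \<Omega>" "Hcurl \<Omega>"
    by unfold_locales (simp_all add: assms \<open>\<omega> \<noteq> 0\<close> \<open>C \<ge> 0\<close> coeff sub green del: of_real_inverse)
  interpret swap: cavity \<Omega> \<epsilon> \<mu> "- \<omega>" C "Hcurl \<Omega>" "Hcurl0 \<Omega>"
    by unfold_locales (simp_all add: assms \<open>\<omega> \<noteq> 0\<close> \<open>C \<ge> 0\<close> coeff sub green' del: of_real_inverse)
  have solvable: "\<exists>R S. R \<in> Hcurl \<Omega> \<and> S \<in> Hcurl0 \<Omega> \<and>
      (AE x in lebesgue_on \<Omega>. faraday R S x = f x) \<and> (AE x in lebesgue_on \<Omega>. ampere R S x = g x)"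
    if f: "f \<in> L2 \<Omega>" and g: "g \<in> L2 \<Omega>" for f g
    by (rule nonresonant_solvable[OF assms(11) f g]) blast
  note S_swap = inf_sup_prod_swap[where b = "b_S \<Omega> \<mu> \<epsilon> \<omega>" and b' = "b_S \<Omega> \<epsilon> \<mu> (- \<omega>)", OF b_S_swap]
    and U_swap = inf_sup_prod_swap[where b = "b_U \<Omega> \<mu> \<epsilon> \<omega>" and b' = "b_U \<Omega> \<epsilon> \<mu> (- \<omega>)", OF b_U_swap]
    and D_swap = inf_sup_prod_swap[where b = "b_D \<Omega> \<mu> \<epsilon> \<omega>" and b' = "b_M \<Omega> \<epsilon> \<mu> (- \<omega>)", OF b_D_swap]
  note defs = inf_sup_E_def inf_sup_S_def inf_sup_U_def inf_sup_D_def inf_sup_H_def inf_sup_M_def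
  have "inf_sup_E \<Omega> \<mu> \<epsilon> \<omega> \<Longrightarrow> inf_sup_S \<Omega> \<mu> \<epsilon> \<omega>"
    unfolding defs by (rule primal_imp_strong)
  moreover have "inf_sup_S \<Omega> \<mu> \<epsilon> \<omega> \<Longrightarrow> inf_sup_U \<Omega> \<mu> \<epsilon> \<omega>"
    unfolding defs by (rule strong_imp_ultraweak[OF _ solvable])
  moreover have "inf_sup_U \<Omega> \<mu> \<epsilon> \<omega> \<Longrightarrow> inf_sup_M \<Omega> \<mu> \<epsilon> \<omega>"
    unfolding defs by (rule ultraweak_imp_mixed)
  moreover have "inf_sup_M \<Omega> \<mu> \<epsilon> \<omega> \<Longrightarrow> inf_sup_E \<Omega> \<mu> \<epsilon> \<omega>"
    unfolding defs by (rule mixed_imp_primal)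
  moreover have "inf_sup_U \<Omega> \<mu> \<epsilon> \<omega> \<Longrightarrow> inf_sup_D \<Omega> \<mu> \<epsilon> \<omega>"
    unfolding defs U_swap D_swap by (rule swap.ultraweak_imp_mixed)
  moreover have "inf_sup_D \<Omega> \<mu> \<epsilon> \<omega> \<Longrightarrow> inf_sup_H \<Omega> \<mu> \<epsilon> \<omega>"
    unfolding defs D_swap b_H_swap by (rule swap.mixed_imp_primal)
  moreover have "inf_sup_H \<Omega> \<mu> \<epsilon> \<omega> \<Longrightarrow> inf_sup_S \<Omega> \<mu> \<epsilon> \<omega>"
    unfolding defs S_swap b_H_swap by (rule swap.primal_imp_strong)
  ultimately show ?thesis by blast
qed

end
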